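(* Let $\mathbb F$ be a field, $H$ a Hopf algebra over $\mathbb F$ with invertible antipode and with a Hopf pairing $\varphi$, let $\tau:H\to H$ be a Hopf algebra endomorphism, and let $\chi:H\to\mathbb F$ be a $\tau$-twisted compatible linear map. Let $H^\imath_\tau$ be the $\tau$-twisted iHopf algebra of $H$ and $(H\otimes H)^\imath$ the iHopf algebra of diagonal type; these are associative algebras with units $1$ and $1\otimes 1$, respectively. Then there exist natural algebra homomorphisms $\xi_{\tau,\chi}: H^\imath_\tau\to (H\otimes H)^\imath$ and $\Psi: H_\tau^\imath\to H^\imath_\tau\otimes (H\otimes H)^\imath$, given by $$\xi_{\tau,\chi}(a)= \sum \chi(a_{(2)})\, \tau(a_{(3)})\otimes a_{(1)},\qquad \Psi(a)= \sum \varphi(\tau(a_{(4)}),a_{(2)})\, a_{(3)}\otimes (\tau(a_{(5)})\otimes a_{(1)}).$$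
   Context: Sweedler notation: $\Delta^{(n)}(a)=\sum a_{(1)}\otimes\cdots\otimes a_{(n+1)}$ is the iterated coproduct. A Hopf pairing on a Hopf algebra $H$ (counit $\varepsilon$, antipode $S$) is a bilinear form $\varphi:H\times H\to\mathbb F$ with $\varphi(a,1)=\varepsilon(a)$, $\varphi(1,b)=\varepsilon(b)$, $\varphi(a,bb')=\varphi(\Delta(a),b\otimes b')$, $\varphi(aa',b)=\varphi(a\otimes a',\Delta(b))$, $\varphi(a,S(b))=\varphi(S(a),b)$, where $\varphi(a\otimes a',b\otimes b')=\varphi(a,b)\varphi(a',b')$. For a Hopf algebra $H$ with Hopf pairing $\varphi$, the iHopf algebra is the vector space $H$ with multiplication $a\ast b=\sum\varphi(b_{(2)},a_{(1)})\,a_{(2)}b_{(1)}$. For a Hopf algebra endomorphism $\tau$, $\varphi\circ(\tau\otimes 1)$ is again a Hopf pairing and $H^\imath_\tau$ is the iHopf algebra of $(H,\varphi\circ(\tau\otimes1))$, i.e. $a\ast b=\sum\varphi(\tau(b_{(2)}),a_{(1)})\,a_{(2)}b_{(1)}$. $H\otimes H$ is the tensor product Hopf algebra with the Hopf pairing $\varphi_\sharp(c\otimes d,a\otimes b)=\varphi(a,d)\varphi(c,b)$; $(H\otimes H)^\imath$ is the iHopf algebra of $(H\otimes H,\varphi_\sharp)$, so $(a\otimes b)\ast(c\otimes d)=\sum\varphi(a_{(1)},d_{(2)})\varphi(c_{(2)},b_{(1)})\,a_{(2)}c_{(1)}\otimes b_{(2)}d_{(1)}$. A linear map $\chi:H\to\mathbb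 F$ is $\tau$-twisted compatible if $\chi(ab)=\sum\chi(a_{(1)})\chi(b_{(2)})\varphi(\tau(a_{(2)}),b_{(1)})$ for all $a,b\in H$. *)

theory Defs
  imports "HOL-Algebra.Module"
begin

section \<open>Linear maps and associative algebras\<close>

definition regular_module :: "('f, 'm) ring_scheme \<Rightarrow> ('f, 'f) module" where
  "regular_module F =
     \<lparr>carrier = carrier F, monoid.mult = monoid.mult F, one = one F,
      ring.zero = ring.zero F, add = add F, smult = monoid.mult F\<rparr>"

definition linear_maps ::
    "('f, 'm) ring_scheme \<Rightarrow> ('f, 'a, 'x) module_scheme \<Rightarrow> ('f, 'b, 'y) module_scheme
      \<Rightarrow> ('a \<Rightarrow> 'b) set" where
  "linear_maps F M N =
     {h \<in> carrier M \<rightarrow> carrier N.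
        (\<forall>x\<in>carrier M. \<forall>y\<in>carrier M. h (x \<oplus>\<^bsub>M\<^esub> y) = h x \<oplus>\<^bsub>N\<^esub> h y) \<and>
        (\<forall>c\<in>carrier F. \<forall>x\<in>carrier M. h (c \<odot>\<^bsub>M\<^esub> x) = c \<odot>\<^bsub>N\<^esub> h x)}"

definition bilinear_form ::
    "('f, 'm) ring_scheme \<Rightarrow> ('f, 'a, 'x) module_scheme \<Rightarrow> ('a \<Rightarrow> 'a \<Rightarrow> 'f) \<Rightarrow> bool" where
  "bilinear_form F M \<phi> \<longleftrightarrow>
     (\<forall>x\<in>carrier M. (\<lambda>y. \<phi> x y) \<in> linear_maps F M (regular_module F)) \<and>
     (\<forall>y\<in>carrier M. (\<lambda>x. \<phi> x y) \<in> linear_maps F M (regular_module F))"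

text \<open>The library locale \<^locale>\<open>algebra\<close> demands commutativity; this is its
  noncommutative counterpart.\<close>

locale unital_algebra = module + ring M +
  assumes smult_mult_left:
      "\<lbrakk>c \<in> carrier R; x \<in> carrier M; y \<in> carrier M\<rbrakk> \<Longrightarrow>
        (c \<odot>\<^bsub>M\<^esub> x) \<otimes>\<^bsub>M\<^esub> y = c \<odot>\<^bsub>M\<^esub> (x \<otimes>\<^bsub>M\<^esub> y)"
    and smult_mult_right:
      "\<lbrakk>c \<in> carrier R; x \<in> carrier M; y \<in> carrier M\<rbrakk> \<Longrightarrow>
        x \<otimes>\<^bsub>M\<^esub> (c \<odot>\<^bsub>M\<^esub> y) = c \<odot>\<^bsub>M\<^esub> (x \<otimes>\<^bsub>M\<^esub> y)"

text \<open>Homomorphisms in \<open>algebra_homs\<close> need not preserve the unit.\<close>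

definition algebra_homs ::
    "('f, 'm) ring_scheme \<Rightarrow> ('f, 'a, 'x) module_scheme \<Rightarrow> ('f, 'b, 'y) module_scheme
      \<Rightarrow> ('a \<Rightarrow> 'b) set" where
  "algebra_homs F A B =
     {h \<in> linear_maps F A B.
        \<forall>x\<in>carrier A. \<forall>y\<in>carrier A. h (x \<otimes>\<^bsub>A\<^esub> y) = h x \<otimes>\<^bsub>B\<^esub> h y}"

definition unital_algebra_homs ::
    "('f, 'm) ring_scheme \<Rightarrow> ('f, 'a, 'x) module_scheme \<Rightarrow> ('f, 'b, 'y) module_scheme
      \<Rightarrow> ('a \<Rightarrow> 'b) set" where
  "unital_algebra_homs F A B = {h \<in> algebra_homs F A B. h \<one>\<^bsub>A\<^esub> = \<one>\<^bsub>B\<^esub>}"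


section \<open>Tensor products\<close>

text \<open>The list \<open>[(x1, y1), \<dots>, (xn, yn)]\<close> stands for the formal sum of the symbols
  \<open>xi \<otimes> yi\<close>. The tensor product is the quotient of the formal sums by the congruence
  generated by the usual relations. A scalar is absorbed into a factor, and
  \<open>(- x) \<otimes> y\<close> is the negative of \<open>x \<otimes> y\<close>, so no formal coefficients are needed.\<close>

inductive tensor_eq ::
    "('f, 'm) ring_scheme \<Rightarrow> ('f, 'a, 'x) module_scheme \<Rightarrow> ('f, 'b, 'y) module_scheme
      \<Rightarrow> ('a \<times> 'b) list \<Rightarrow> ('a \<times> 'b) list \<Rightarrow> bool"
  for F M N where
    refl: "set xs \<subseteq> carrier M \<times> carrier N \<Longrightarrow> tensor_eq F M N xs xs"
  | sym: "tensor_eq F M N xs ys \<Longrightarrow> tensor_eq F M N ys xs"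
  | trans: "\<lbrakk>tensor_eq F M N xs ys; tensor_eq F M N ys zs\<rbrakk> \<Longrightarrow> tensor_eq F M N xs zs"
  | append: "\<lbrakk>tensor_eq F M N xs xs'; tensor_eq F M N ys ys'\<rbrakk>
      \<Longrightarrow> tensor_eq F M N (xs @ ys) (xs' @ ys')"
  | commute: "\<lbrakk>set xs \<subseteq> carrier M \<times> carrier N; set ys \<subseteq> carrier M \<times> carrier N\<rbrakk>
      \<Longrightarrow> tensor_eq F M N (xs @ ys) (ys @ xs)"
  | zero: "y \<in> carrier N \<Longrightarrow> tensor_eq F M N [(\<zero>\<^bsub>M\<^esub>, y)] []"
  | add_left: "\<lbrakk>x \<in> carrier M; x' \<in> carrier M; y \<in> carrier N\<rbrakk>
      \<Longrightarrow> tensor_eq F M N [(x \<oplus>\<^bsub>M\<^esub> x', y)] [(x, y), (x', y)]"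
  | add_right: "\<lbrakk>x \<in> carrier M; y \<in> carrier N; y' \<in> carrier N\<rbrakk>
      \<Longrightarrow> tensor_eq F M N [(x, y \<oplus>\<^bsub>N\<^esub> y')] [(x, y), (x, y')]"
  | scalar: "\<lbrakk>c \<in> carrier F; x \<in> carrier M; y \<in> carrier N\<rbrakk>
      \<Longrightarrow> tensor_eq F M N [(c \<odot>\<^bsub>M\<^esub> x, y)] [(x, c \<odot>\<^bsub>N\<^esub> y)]"

definition tensor_class ::
    "('f, 'm) ring_scheme \<Rightarrow> ('f, 'a, 'x) module_scheme \<Rightarrow> ('f, 'b, 'y) module_scheme
      \<Rightarrow> ('a \<times> 'b) list \<Rightarrow> ('a \<times> 'b) list set" where
  "tensor_class F M N xs = {ys. tensor_eq F M N xs ys}"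

definition pure_tensor ::
    "('f, 'm) ring_scheme \<Rightarrow> ('f, 'a, 'x) module_scheme \<Rightarrow> ('f, 'b, 'y) module_scheme
      \<Rightarrow> 'a \<Rightarrow> 'b \<Rightarrow> ('a \<times> 'b) list set" where
  "pure_tensor F M N x y = tensor_class F M N [(x, y)]"

definition tensor_rep :: "('a \<times> 'b) list set \<Rightarrow> ('a \<times> 'b) list" where
  "tensor_rep X = (SOME xs. xs \<in> X)"

text \<open>For \<open>X\<close> the class of a formal sum of symbols \<open>xi \<otimes> yi\<close>, the value of
  \<open>tensor_sum P f X\<close> is the sum of the \<open>f xi yi\<close> in \<open>P\<close>. For bilinear \<open>f\<close> it does
  not depend on the chosen representative, and it is the value at \<open>X\<close> of the linear map
  induced by \<open>f\<close>. All uses below are of this kind.\<close>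

definition tensor_sum ::
    "('c, 'z) ring_scheme \<Rightarrow> ('a \<Rightarrow> 'b \<Rightarrow> 'c) \<Rightarrow> ('a \<times> 'b) list set \<Rightarrow> 'c" where
  "tensor_sum P f X = foldr (\<lambda>(x, y) s. f x y \<oplus>\<^bsub>P\<^esub> s) (tensor_rep X) \<zero>\<^bsub>P\<^esub>"

definition tensor_algebra ::
    "('f, 'm) ring_scheme \<Rightarrow> ('f, 'a, 'x) module_scheme \<Rightarrow> ('f, 'b, 'y) module_scheme
      \<Rightarrow> ('f, ('a \<times> 'b) list set) module" where
  "tensor_algebra F A B =
     \<lparr>carrier = tensor_class F A B ` {xs. set xs \<subseteq> carrier A \<times> carrier B},
      monoid.mult = (\<lambda>X Y. tensor_class F A B
        [(x \<otimes>\<^bsub>A\<^esub> x', y \<otimes>\<^bsub>B\<^esub> y'). (x, y) \<leftarrow> tensor_rep X, (x', y') \<leftarrow> tensor_rep Y]),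
      one = pure_tensor F A B \<one>\<^bsub>A\<^esub> \<one>\<^bsub>B\<^esub>,
      ring.zero = tensor_class F A B [],
      add = (\<lambda>X Y. tensor_class F A B (tensor_rep X @ tensor_rep Y)),
      smult = (\<lambda>c X. tensor_class F A B [(c \<odot>\<^bsub>A\<^esub> x, y). (x, y) \<leftarrow> tensor_rep X])\<rparr>"


section \<open>Hopf algebras\<close>

record ('f, 'h) hopf = "('f, 'h) module" +
  comult :: "'h \<Rightarrow> ('h \<times> 'h) list set"
  counit :: "'h \<Rightarrow> 'f"
  antipode :: "'h \<Rightarrow> 'h"

text \<open>Sweedler sums: \<open>sweedler2 H P f a\<close>, \<open>sweedler3 H P f a\<close>, \dots{} are the sums in
  \<open>P\<close> of \<open>f a(1) a(2)\<close>, \<open>f a(1) a(2) a(3)\<close>, \dots{} over the components of the iterated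
  coproduct of \<open>a\<close>. The coproduct is iterated on the last factor; by coassociativity any
  other choice gives the same result.\<close>

definition sweedler2 ::
    "('f, 'h, 'x) hopf_scheme \<Rightarrow> ('c, 'z) ring_scheme \<Rightarrow> ('h \<Rightarrow> 'h \<Rightarrow> 'c) \<Rightarrow> 'h \<Rightarrow> 'c" where
  "sweedler2 H P f a = tensor_sum P f (comult H a)"

definition sweedler3 ::
    "('f, 'h, 'x) hopf_scheme \<Rightarrow> ('c, 'z) ring_scheme \<Rightarrow> ('h \<Rightarrow> 'h \<Rightarrow> 'h \<Rightarrow> 'c) \<Rightarrow> 'h \<Rightarrow> 'c"
  where
  "sweedler3 H P f a = sweedler2 H P (\<lambda>a1. sweedler2 H P (f a1)) a"

definition sweedler4 ::
    "('f, 'h, 'x) hopf_scheme \<Rightarrow> ('c, 'z) ring_scheme \<Rightarrow> ('h \<Rightarrow> 'h \<Rightarrow> 'h \<Rightarrow> 'h \<Rightarrow> 'c)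
      \<Rightarrow> 'h \<Rightarrow> 'c" where
  "sweedler4 H P f a = sweedler2 H P (\<lambda>a1. sweedler3 H P (f a1)) a"

definition sweedler5 ::
    "('f, 'h, 'x) hopf_scheme \<Rightarrow> ('c, 'z) ring_scheme
      \<Rightarrow> ('h \<Rightarrow> 'h \<Rightarrow> 'h \<Rightarrow> 'h \<Rightarrow> 'h \<Rightarrow> 'c) \<Rightarrow> 'h \<Rightarrow> 'c" where
  "sweedler5 H P f a = sweedler2 H P (\<lambda>a1. sweedler4 H P (f a1)) a"

text \<open>Coassociativity is stated in \<open>H \<otimes> (H \<otimes> H)\<close>, into which \<open>(H \<otimes> H) \<otimes> H\<close> is
  identified by the canonical isomorphism.\<close>

locale hopf_algebra = R?: field R + unital_algebra R H
  for R (structure) and H :: "('f, 'h, 'x) hopf_scheme" (structure) +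
  assumes comult_hom: "comult H \<in> unital_algebra_homs R H (tensor_algebra R H H)"
    and counit_hom: "counit H \<in> unital_algebra_homs R H (regular_module R)"
    and coassoc: "a \<in> carrier H \<Longrightarrow>
      sweedler2 H (tensor_algebra R H (tensor_algebra R H H))
        (\<lambda>a1 a2. sweedler2 H (tensor_algebra R H (tensor_algebra R H H))
          (\<lambda>a11 a12. pure_tensor R H (tensor_algebra R H H) a11 (pure_tensor R H H a12 a2)) a1) a
      = sweedler2 H (tensor_algebra R H (tensor_algebra R H H))
        (\<lambda>a1 a2. pure_tensor R H (tensor_algebra R H H) a1 (comult H a2)) a"
    and counit_left: "a \<in> carrier H \<Longrightarrow> sweedler2 H H (\<lambda>a1 a2. counit H a1 \<odot>\<^bsub>H\<^esub> a2) a = a"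
    and counit_right: "a \<in> carrier H \<Longrightarrow> sweedler2 H H (\<lambda>a1 a2. counit H a2 \<odot>\<^bsub>H\<^esub> a1) a = a"
    and antipode_linear: "antipode H \<in> linear_maps R H H"
    and antipode_left: "a \<in> carrier H \<Longrightarrow>
      sweedler2 H H (\<lambda>a1 a2. antipode H a1 \<otimes>\<^bsub>H\<^esub> a2) a = counit H a \<odot>\<^bsub>H\<^esub> \<one>\<^bsub>H\<^esub>"
    and antipode_right: "a \<in> carrier H \<Longrightarrow>
      sweedler2 H H (\<lambda>a1 a2. a1 \<otimes>\<^bsub>H\<^esub> antipode H a2) a = counit H a \<odot>\<^bsub>H\<^esub> \<one>\<^bsub>H\<^esub>"

definition hopf_endomorphism ::
    "('f, 'm) ring_scheme \<Rightarrow> ('f, 'h, 'x) hopf_scheme \<Rightarrow> ('h \<Rightarrow> 'h) \<Rightarrow> bool" where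
  "hopf_endomorphism F H \<tau> \<longleftrightarrow>
     \<tau> \<in> unital_algebra_homs F H H \<and>
     (\<forall>a\<in>carrier H.
        comult H (\<tau> a) =
          sweedler2 H (tensor_algebra F H H) (\<lambda>a1 a2. pure_tensor F H H (\<tau> a1) (\<tau> a2)) a \<and>
        counit H (\<tau> a) = counit H a \<and>
        antipode H (\<tau> a) = \<tau> (antipode H a))"

definition tensor_hopf ::
    "('f, 'm) ring_scheme \<Rightarrow> ('f, 'h, 'x) hopf_scheme \<Rightarrow> ('f, 'k, 'y) hopf_scheme
      \<Rightarrow> ('f, ('h \<times> 'k) list set) hopf" where
  "tensor_hopf F H K =
     (let T = tensor_algebra F H K; TT = tensor_algebra F T T in
     \<lparr>carrier = carrier T, monoid.mult = monoid.mult T, one = one T,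
      ring.zero = ring.zero T, add = add T, smult = smult T,
      comult = tensor_sum TT (\<lambda>c d.
        sweedler2 H TT (\<lambda>c1 c2. sweedler2 K TT (\<lambda>d1 d2.
          pure_tensor F T T (pure_tensor F H K c1 d1) (pure_tensor F H K c2 d2)) d) c),
      counit = tensor_sum F (\<lambda>c d. counit H c \<otimes>\<^bsub>F\<^esub> counit K d),
      antipode = tensor_sum T (\<lambda>c d. pure_tensor F H K (antipode H c) (antipode K d))\<rparr>)"


section \<open>Hopf pairings and iHopf algebras\<close>

definition hopf_pairing ::
    "('f, 'm) ring_scheme \<Rightarrow> ('f, 'h, 'x) hopf_scheme \<Rightarrow> ('h \<Rightarrow> 'h \<Rightarrow> 'f) \<Rightarrow> bool" where
  "hopf_pairing F H \<phi> \<longleftrightarrow>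
     bilinear_form F H \<phi> \<and>
     (\<forall>a\<in>carrier H. \<phi> a \<one>\<^bsub>H\<^esub> = counit H a) \<and>
     (\<forall>b\<in>carrier H. \<phi> \<one>\<^bsub>H\<^esub> b = counit H b) \<and>
     (\<forall>a\<in>carrier H. \<forall>b\<in>carrier H. \<forall>b'\<in>carrier H.
        \<phi> a (b \<otimes>\<^bsub>H\<^esub> b') = sweedler2 H F (\<lambda>a1 a2. \<phi> a1 b \<otimes>\<^bsub>F\<^esub> \<phi> a2 b') a) \<and>
     (\<forall>a\<in>carrier H. \<forall>a'\<in>carrier H. \<forall>b\<in>carrier H.
        \<phi> (a \<otimes>\<^bsub>H\<^esub> a') b = sweedler2 H F (\<lambda>b1 b2. \<phi> a b1 \<otimes>\<^bsub>F\<^esub> \<phi> a' b2) b) \<and>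
     (\<forall>a\<in>carrier H. \<forall>b\<in>carrier H. \<phi> a (antipode H b) = \<phi> (antipode H a) b)"

definition iHopf ::
    "('f, 'h, 'x) hopf_scheme \<Rightarrow> ('h \<Rightarrow> 'h \<Rightarrow> 'f) \<Rightarrow> ('f, 'h) module" where
  "iHopf H \<phi> =
     \<lparr>carrier = carrier H,
      monoid.mult = (\<lambda>a b. sweedler2 H H (\<lambda>a1 a2. sweedler2 H H (\<lambda>b1 b2.
        \<phi> b2 a1 \<odot>\<^bsub>H\<^esub> (a2 \<otimes>\<^bsub>H\<^esub> b1)) b) a),
      one = one H, ring.zero = ring.zero H, add = add H, smult = smult H\<rparr>"

definition twisted_iHopf ::
    "('f, 'h, 'x) hopf_scheme \<Rightarrow> ('h \<Rightarrow> 'h \<Rightarrow> 'f) \<Rightarrow> ('h \<Rightarrow> 'h) \<Rightarrow> ('f, 'h) module" where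
  "twisted_iHopf H \<phi> \<tau> = iHopf H (\<lambda>a b. \<phi> (\<tau> a) b)"

text \<open>The pairing sending \<open>c \<otimes> d\<close> and \<open>a \<otimes> b\<close> to \<open>\<phi>(a, d) \<phi>(c, b)\<close>.\<close>

definition diagonal_pairing ::
    "('f, 'm) ring_scheme \<Rightarrow> ('h \<Rightarrow> 'h \<Rightarrow> 'f)
      \<Rightarrow> ('h \<times> 'h) list set \<Rightarrow> ('h \<times> 'h) list set \<Rightarrow> 'f" where
  "diagonal_pairing F \<phi> X Y =
     tensor_sum F (\<lambda>c d. tensor_sum F (\<lambda>a b. \<phi> a d \<otimes>\<^bsub>F\<^esub> \<phi> c b) Y) X"

definition diagonal_iHopf ::
    "('f, 'm) ring_scheme \<Rightarrow> ('f, 'h, 'x) hopf_scheme \<Rightarrow> ('h \<Rightarrow> 'h \<Rightarrow> 'f)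
      \<Rightarrow> ('f, ('h \<times> 'h) list set) module" where
  "diagonal_iHopf F H \<phi> = iHopf (tensor_hopf F H H) (diagonal_pairing F \<phi>)"

definition twisted_compatible ::
    "('f, 'm) ring_scheme \<Rightarrow> ('f, 'h, 'x) hopf_scheme \<Rightarrow> ('h \<Rightarrow> 'h \<Rightarrow> 'f) \<Rightarrow> ('h \<Rightarrow> 'h)
      \<Rightarrow> ('h \<Rightarrow> 'f) \<Rightarrow> bool" where
  "twisted_compatible F H \<phi> \<tau> \<chi> \<longleftrightarrow>
     (\<forall>a\<in>carrier H. \<forall>b\<in>carrier H.
        \<chi> (a \<otimes>\<^bsub>H\<^esub> b) =
          sweedler2 H F (\<lambda>a1 a2. sweedler2 H F (\<lambda>b1 b2.
            \<chi> a1 \<otimes>\<^bsub>F\<^esub> \<chi> b2 \<otimes>\<^bsub>F\<^esub> \<phi> (\<tau> a2) b1) b) a)"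

end

theory Submission
  imports Defs
begin

text \<open>Over a pairing \<open>\<phi>\<close>, expanding both bracketings of \<open>(a * b) * c\<close> by the Hopf pairing
  axioms and coassociativity gives the same sum
  \<open>\<phi>(b3, a1) \<phi>(c2, a2) \<phi>(c3, b1) a3 b2 c1\<close>, so iHopf algebras are associative. This applies to
  \<open>H\<close> with \<open>\<phi> \<circ> (\<tau> \<otimes> 1)\<close> and to \<open>H \<otimes> H\<close> with the diagonal pairing. For the
  homomorphisms, let \<open>X\<close> be a linear map from \<open>H\<close> to an algebra \<open>A\<close> with
  \<open>X(ab) = \<Sum> \<phi>(\<tau>(a2), b1) X(a1) X(b2)\<close>. Then \<open>a \<mapsto> \<Sum> X(a2) \<otimes> (\<tau>(a3) \<otimes> a1)\<close> is multiplicative: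
  both sides become the sum of
  \<open>\<phi>(\<tau>(a4), b2) \<phi>(\<tau>(b5), a1) X(a3) X(b3) \<otimes> (\<tau>(a5) \<tau>(b4) \<otimes> a2 b1)\<close>. The case \<open>X = \<chi>\<close> is \<open>\<xi>\<close>,
  and \<open>X(a) = \<Sum> \<phi>(\<tau>(a3), a1) a2\<close> gives \<open>\<Psi>\<close>.\<close>

section \<open>Linear and bilinear maps\<close>

text \<open>The law for X is dictated by a count of pairings. Multiplying the images of a and b in
  \<open>diagonal_iHopf\<close> creates two of them. The factor \<phi>(\<tau>(b5), a1) is the one in
  the product of \<open>twisted_iHopf\<close>; the factor \<phi>(\<tau>(a4), b2) has no counterpart
  there and disappears exactly when X(a3) X(b3) is gathered into X of a product. Twisted
  compatibility is this law for scalar values. For \<Psi>, pairing two products yields four factors,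
  to be shared out among two contractions, one product of \<open>twisted_iHopf\<close> and the
  pairing in the law. The obstacle is that a Sweedler sum is evaluated on a chosen representative of
  a class. Regrouping its legs or multiplying them out is justified only for summands linear in
  every leg, so such steps carry linearity and closure conditions, and the collections
  \<open>lin\<close> and \<open>closed\<close> exist to discharge them. Likewise H \<otimes> H must
  be shown to be a bialgebra, and its diagonal pairing multiplicative, before the associativity
  argument applies to it.\<close>

lemma regular_module_simps [simp]:
  "carrier (regular_module R) = carrier R"
  "monoid.mult (regular_module R) = monoid.mult R"
  "one (regular_module R) = one R"
  "ring.zero (regular_module R) = ring.zero R"
  "add (regular_module R) = add R"
  "smult (regular_module R) = monoid.mult R"
  by (simp_all add: regular_module_def)

lemma cring_regular_module:
  assumes "cring R"
  shows "cring (regular_module R)"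
proof -
  interpret cring R by fact
  show ?thesis
    by (intro cringI abelian_groupI comm_monoidI)
      (auto simp: a_ac m_ac r_distr intro: bexI[of _ "\<ominus>\<^bsub>R\<^esub> _"] l_neg)
qed

lemma unital_algebra_regular_module:
  assumes "cring R"
  shows "unital_algebra R (regular_module R)"
proof -
  interpret cring R by fact
  interpret M: cring "regular_module R" by (rule cring_regular_module) fact
  show ?thesis
    by (intro unital_algebra.intro module.intro module_axioms.intro unital_algebra_axioms.intro
        is_cring M.ring_axioms M.abelian_group_axioms)
      (auto simp: l_distr r_distr m_ac)
qed

lemma module_regular_module: "cring R \<Longrightarrow> module R (regular_module R)"
  by (intro unital_algebra.axioms(1) unital_algebra_regular_module)

lemma linear_mapsI:
  assumes "\<And>x. x \<in> carrier M \<Longrightarrow> h x \<in> carrier N"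
    and "\<And>x y. \<lbrakk>x \<in> carrier M; y \<in> carrier M\<rbrakk> \<Longrightarrow> h (x \<oplus>\<^bsub>M\<^esub> y) = h x \<oplus>\<^bsub>N\<^esub> h y"
    and "\<And>c x. \<lbrakk>c \<in> carrier R; x \<in> carrier M\<rbrakk> \<Longrightarrow> h (c \<odot>\<^bsub>M\<^esub> x) = c \<odot>\<^bsub>N\<^esub> h x"
  shows "h \<in> linear_maps R M N"
  using assms by (auto simp: linear_maps_def)

lemma linear_closed: "\<lbrakk>h \<in> linear_maps R M N; x \<in> carrier M\<rbrakk> \<Longrightarrow> h x \<in> carrier N"
  by (auto simp: linear_maps_def)

lemma linear_add:
  "\<lbrakk>h \<in> linear_maps R M N; x \<in> carrier M; y \<in> carrier M\<rbrakk> \<Longrightarrow> h (x \<oplus>\<^bsub>M\<^esub> y) = h x \<oplus>\<^bsub>N\<^esub> h y"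
  by (auto simp: linear_maps_def)

lemma linear_smult:
  "\<lbrakk>h \<in> linear_maps R M N; c \<in> carrier R; x \<in> carrier M\<rbrakk> \<Longrightarrow> h (c \<odot>\<^bsub>M\<^esub> x) = c \<odot>\<^bsub>N\<^esub> h x"
  by (auto simp: linear_maps_def)

lemma linear_zero:
  assumes "module R M" "module R N" "h \<in> linear_maps R M N"
  shows "h \<zero>\<^bsub>M\<^esub> = \<zero>\<^bsub>N\<^esub>"
proof -
  interpret M: module R M by fact
  interpret N: module R N by fact
  have "h \<zero>\<^bsub>M\<^esub> = h (\<zero>\<^bsub>R\<^esub> \<odot>\<^bsub>M\<^esub> \<zero>\<^bsub>M\<^esub>)" by simp
  also have "\<dots> = \<zero>\<^bsub>N\<^esub>"
    using assms(3) by (simp add: linear_smult linear_closed del: M.smult_l_null M.smult_r_null)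
  finally show ?thesis .
qed

lemma linear_id: "(\<lambda>x. x) \<in> linear_maps R M M"
  by (simp add: linear_maps_def)

lemma linear_comp:
  "\<lbrakk>h \<in> linear_maps R N P; g \<in> linear_maps R M N\<rbrakk> \<Longrightarrow> (\<lambda>x. h (g x)) \<in> linear_maps R M P"
  by (auto intro!: linear_mapsI simp: linear_add linear_smult linear_closed)

lemma linear_cong:
  assumes "module R M" "\<And>x. x \<in> carrier M \<Longrightarrow> h x = k x"
  shows "h \<in> linear_maps R M N \<longleftrightarrow> k \<in> linear_maps R M N"
proof -
  interpret M: module R M by fact
  show ?thesis using assms(2) by (auto simp: linear_maps_def Pi_def)
qed

text \<open>\<open>bilinear_form\<close> is the case of equal factors and values in
  \<open>regular_module R\<close>. A general target puts scalar multiplication, products and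
  \<open>pure_tensor\<close> on the same footing as pairings.\<close>

definition bilinear_maps ::
    "('f, 'm) ring_scheme \<Rightarrow> ('f, 'a, 'x) module_scheme \<Rightarrow> ('f, 'b, 'y) module_scheme
      \<Rightarrow> ('f, 'c, 'z) module_scheme \<Rightarrow> ('a \<Rightarrow> 'b \<Rightarrow> 'c) set" where
  "bilinear_maps R M N P =
     {f. (\<forall>x\<in>carrier M. f x \<in> linear_maps R N P) \<and>
         (\<forall>y\<in>carrier N. (\<lambda>x. f x y) \<in> linear_maps R M P)}"

lemma bilinear_mapsI:
  assumes "\<And>x. x \<in> carrier M \<Longrightarrow> (\<lambda>y. f x y) \<in> linear_maps R N P"
    and "\<And>y. y \<in> carrier N \<Longrightarrow> (\<lambda>x. f x y) \<in> linear_maps R M P"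
  shows "f \<in> bilinear_maps R M N P"
  using assms by (simp add: bilinear_maps_def)

text \<open>The argument is \<open>g x\<close> rather than \<open>x\<close>, so the rule can be
  applied backwards at any depth: linearity of a nested expression is reduced to that of its
  subterms until \<open>linear_id\<close> ends the descent.\<close>

lemma bilinear_left:
  "\<lbrakk>f \<in> bilinear_maps R M N P; g \<in> linear_maps R L M; y \<in> carrier N\<rbrakk>
    \<Longrightarrow> (\<lambda>x. f (g x) y) \<in> linear_maps R L P"
  by (rule linear_comp[where h = "\<lambda>x. f x y"]) (auto simp: bilinear_maps_def)

lemma bilinear_right:
  "\<lbrakk>f \<in> bilinear_maps R M N P; x \<in> carrier M; g \<in> linear_maps R L N\<rbrakk>
    \<Longrightarrow> (\<lambda>y. f x (g y)) \<in> linear_maps R L P"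
  by (rule linear_comp[where h = "f x"]) (auto simp: bilinear_maps_def)

lemma bilinear_closed:
  "\<lbrakk>f \<in> bilinear_maps R M N P; x \<in> carrier M; y \<in> carrier N\<rbrakk> \<Longrightarrow> f x y \<in> carrier P"
  by (auto simp: bilinear_maps_def intro: linear_closed)

lemma bilinear_smult:
  assumes "module R M"
  shows "smult M \<in> bilinear_maps R (regular_module R) M M"
proof -
  interpret module R M by fact
  show ?thesis
    by (intro bilinear_mapsI linear_mapsI)
      (auto simp: smult_l_distr smult_r_distr smult_assoc1[symmetric] m_comm)
qed

lemma bilinear_mult:
  assumes "unital_algebra R A"
  shows "monoid.mult A \<in> bilinear_maps R A A A"
proof -
  interpret unital_algebra R A by fact
  show ?thesis
    by (intro bilinear_mapsI linear_mapsI)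
      (auto simp: l_distr r_distr smult_mult_left smult_mult_right)
qed

lemma bilinear_mult_scalar:
  assumes "cring R"
  shows "monoid.mult R \<in> bilinear_maps R (regular_module R) (regular_module R) (regular_module R)"
  using bilinear_mult[OF unital_algebra_regular_module[OF assms]] by simp


section \<open>Tensor products of modules\<close>

text \<open>This is \<open>tensor_sum\<close> with the choice of a representative stripped off, so
  that induction over the list is available.\<close>

definition list_sum :: "('c, 'z) ring_scheme \<Rightarrow> ('a \<Rightarrow> 'b \<Rightarrow> 'c) \<Rightarrow> ('a \<times> 'b) list \<Rightarrow> 'c" where
  "list_sum P f xs = foldr (\<lambda>(x, y) s. f x y \<oplus>\<^bsub>P\<^esub> s) xs \<zero>\<^bsub>P\<^esub>"

lemma list_sum_simps [simp]:
  "list_sum P f [] = \<zero>\<^bsub>P\<^esub>"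
  "list_sum P f ((x, y) # xs) = f x y \<oplus>\<^bsub>P\<^esub> list_sum P f xs"
  by (simp_all add: list_sum_def)

lemma tensor_sum_list_sum: "tensor_sum P f X = list_sum P f (tensor_rep X)"
  by (simp add: tensor_sum_def list_sum_def)

lemma list_sum_cong:
  "\<lbrakk>xs = ys; \<And>x y. (x, y) \<in> set ys \<Longrightarrow> f x y = g x y\<rbrakk> \<Longrightarrow> list_sum P f xs = list_sum P g ys"
  by (induction ys arbitrary: xs) auto

lemma list_sum_closed:
  assumes "abelian_group P" "\<And>x y. (x, y) \<in> set xs \<Longrightarrow> f x y \<in> carrier P"
  shows "list_sum P f xs \<in> carrier P"
proof -
  interpret abelian_group P by fact
  show ?thesis using assms(2) by (induction xs) auto
qed

lemma list_sum_append:
  assumes "abelian_group P" "\<And>x y. (x, y) \<in> set (xs @ ys) \<Longrightarrow> f x y \<in> carrier P"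
  shows "list_sum P f (xs @ ys) = list_sum P f xs \<oplus>\<^bsub>P\<^esub> list_sum P f ys"
proof -
  interpret abelian_group P by fact
  show ?thesis
    using assms(2) by (induction xs) (auto simp: list_sum_closed assms(1) a_assoc)
qed

lemma list_sum_add:
  assumes "abelian_group P" "\<And>x y. (x, y) \<in> set xs \<Longrightarrow> f x y \<in> carrier P"
    and "\<And>x y. (x, y) \<in> set xs \<Longrightarrow> g x y \<in> carrier P"
  shows "list_sum P (\<lambda>x y. f x y \<oplus>\<^bsub>P\<^esub> g x y) xs = list_sum P f xs \<oplus>\<^bsub>P\<^esub> list_sum P g xs"
proof -
  interpret abelian_group P by fact
  show ?thesis
    using assms(2,3) by (induction xs) (auto simp: list_sum_closed assms(1) a_ac)
qed

lemma list_sum_swap: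
  assumes "abelian_group P"
    and "\<And>x y u v. \<lbrakk>(x, y) \<in> set xs; (u, v) \<in> set us\<rbrakk> \<Longrightarrow> f x y u v \<in> carrier P"
  shows "list_sum P (\<lambda>x y. list_sum P (f x y) us) xs =
    list_sum P (\<lambda>u v. list_sum P (\<lambda>x y. f x y u v) xs) us"
proof -
  interpret abelian_group P by fact
  have zero: "list_sum P (\<lambda>u v. \<zero>\<^bsub>P\<^esub>) us = \<zero>\<^bsub>P\<^esub>"
    by (induction us) auto
  show ?thesis
    using assms(2)
    by (induction xs) (auto simp: zero list_sum_add[OF assms(1)] list_sum_closed assms(1))
qed

lemma linear_list_sum:
  assumes "module R P" "module R Q" "h \<in> linear_maps R P Q"
    and "\<And>x y. (x, y) \<in> set xs \<Longrightarrow> f x y \<in> carrier P"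
  shows "h (list_sum P f xs) = list_sum Q (\<lambda>x y. h (f x y)) xs"
proof -
  interpret P: module R P by fact
  show ?thesis
    using assms(4)
    by (induction xs)
      (auto simp: linear_zero[OF assms(1-3)] linear_add[OF assms(3)]
        list_sum_closed P.abelian_group_axioms)
qed

lemma linear_maps_list_sum:
  assumes "module R M" "module R P"
    and "\<And>x y. (x, y) \<in> set xs \<Longrightarrow> (\<lambda>z. f z x y) \<in> linear_maps R M P"
  shows "(\<lambda>z. list_sum P (f z) xs) \<in> linear_maps R M P"
proof -
  interpret P: module R P by fact
  interpret M: module R M by fact
  have "(\<lambda>z. \<zero>\<^bsub>P\<^esub>) \<in> linear_maps R M P"
    by (auto simp: linear_maps_def)
  moreover have "(\<lambda>z. g z \<oplus>\<^bsub>P\<^esub> k z) \<in> linear_maps R M P"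
    if "g \<in> linear_maps R M P" "k \<in> linear_maps R M P" for g k
    using that by (intro linear_mapsI)
      (auto simp: linear_add linear_smult linear_closed P.smult_r_distr P.a_ac)
  ultimately show ?thesis
    using assms(3) by (induction xs) auto
qed

section \<open>The congruence on formal sums\<close>

lemma tensor_eq_carrier:
  assumes "module R M" "module R N" "tensor_eq R M N xs ys"
  shows "set xs \<subseteq> carrier M \<times> carrier N \<and> set ys \<subseteq> carrier M \<times> carrier N"
proof -
  interpret M: module R M by fact
  interpret N: module R N by fact
  show ?thesis using assms(3) by induction auto
qed

text \<open>Each generating relation of the tensor product is matched by one law of bilinearity.
  This is what makes \<open>tensor_sum\<close> independent of the chosen representative.\<close>

lemma list_sum_tensor_eq:
  assumes "module R M" "module R N" "module R P" "f \<in> bilinear_maps R M N P"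
    and "tensor_eq R M N xs ys"
  shows "list_sum P f xs = list_sum P f ys"
proof -
  interpret M: module R M by fact
  interpret N: module R N by fact
  interpret P: module R P by fact
  have l: "f x \<in> linear_maps R N P" if "x \<in> carrier M" for x
    using assms(4) that by (simp add: bilinear_maps_def)
  have r: "(\<lambda>x. f x y) \<in> linear_maps R M P" if "y \<in> carrier N" for y
    using assms(4) that by (simp add: bilinear_maps_def)
  note closed = bilinear_closed[OF assms(4)]
  have app: "list_sum P f (xs @ ys) = list_sum P f xs \<oplus>\<^bsub>P\<^esub> list_sum P f ys"
    and sum: "list_sum P f xs \<in> carrier P"
    if "set xs \<subseteq> carrier M \<times> carrier N" "set ys \<subseteq> carrier M \<times> carrier N" for xs ys
    using that by (auto intro!: list_sum_append list_sum_closed closed P.abelian_group_axioms)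
  show ?thesis using assms(5)
  proof induction
    case (append xs xs' ys ys')
    then show ?case
      using tensor_eq_carrier[OF assms(1,2)] by (simp add: app)
  next
    case (commute xs ys)
    then show ?case by (simp add: app sum[OF _ commute(2)] sum[OF _ commute(1)] P.a_comm)
  next
    case (zero y)
    then show ?case using linear_zero[OF assms(1,3) r] by simp
  next
    case (add_left x x' y)
    then show ?case using linear_add[OF r] by (simp add: closed P.a_assoc)
  next
    case (add_right x y y')
    then show ?case using linear_add[OF l] by (simp add: closed P.a_assoc)
  next
    case (scalar c x y)
    then show ?case using linear_smult[OF l] linear_smult[OF r] by simp
  qed auto
qed

lemma tensor_class_eqI: "tensor_eq R M N xs ys \<Longrightarrow> tensor_class R M N xs = tensor_class R M N ys"
  by (auto simp: tensor_class_def intro: tensor_eq.trans tensor_eq.sym)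

text \<open>All that is ever known about a chosen representative is its congruence to the list one
  started from.\<close>

lemma tensor_eq_rep:
  assumes "set xs \<subseteq> carrier M \<times> carrier N"
  shows "tensor_eq R M N xs (tensor_rep (tensor_class R M N xs))"
proof -
  have "xs \<in> tensor_class R M N xs"
    using assms by (simp add: tensor_class_def tensor_eq.refl)
  then have "tensor_rep (tensor_class R M N xs) \<in> tensor_class R M N xs"
    unfolding tensor_rep_def by (rule someI)
  then show ?thesis by (simp add: tensor_class_def)
qed

section \<open>The module of classes of formal sums\<close>

lemma tensor_algebra_simps:
  "carrier (tensor_algebra R M N) = tensor_class R M N ` {xs. set xs \<subseteq> carrier M \<times> carrier N}"
  "\<zero>\<^bsub>tensor_algebra R M N\<^esub> = tensor_class R M N []"
  "\<one>\<^bsub>tensor_algebra R M N\<^esub> = pure_tensor R M N \<one>\<^bsub>M\<^esub> \<one>\<^bsub>N\<^esub>"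
  "X \<oplus>\<^bsub>tensor_algebra R M N\<^esub> Y = tensor_class R M N (tensor_rep X @ tensor_rep Y)"
  "c \<odot>\<^bsub>tensor_algebra R M N\<^esub> X =
    tensor_class R M N (map (\<lambda>(x, y). (c \<odot>\<^bsub>M\<^esub> x, y)) (tensor_rep X))"
  by (simp_all add: tensor_algebra_def)

lemma tensor_rep_carrier:
  assumes "module R M" "module R N" "X \<in> carrier (tensor_algebra R M N)"
  shows "set (tensor_rep X) \<subseteq> carrier M \<times> carrier N"
  using assms(3) tensor_eq_carrier[OF assms(1,2) tensor_eq_rep]
  by (auto simp: tensor_algebra_simps)

lemma tensor_class_rep:
  assumes "X \<in> carrier (tensor_algebra R M N)"
  shows "tensor_class R M N (tensor_rep X) = X"
  using assms tensor_class_eqI[OF tensor_eq_rep] by (fastforce simp: tensor_algebra_simps)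

lemma tensor_class_add:
  assumes "set xs \<subseteq> carrier M \<times> carrier N" "set ys \<subseteq> carrier M \<times> carrier N"
  shows "tensor_class R M N xs \<oplus>\<^bsub>tensor_algebra R M N\<^esub> tensor_class R M N ys =
    tensor_class R M N (xs @ ys)"
  unfolding tensor_algebra_simps
  using tensor_class_eqI[OF tensor_eq.append[OF tensor_eq_rep[OF assms(1)] tensor_eq_rep[OF assms(2)]]]
  by (rule HOL.sym)

text \<open>Scaling is defined on a chosen representative, always in the left factor; compatibility
  with the congruence makes it an operation on classes.\<close>

lemma tensor_eq_map_smult:
  assumes "module R M" "module R N" "c \<in> carrier R" "tensor_eq R M N xs ys"
  shows "tensor_eq R M N (map (\<lambda>(x, y). (c \<odot>\<^bsub>M\<^esub> x, y)) xs) (map (\<lambda>(x, y). (c \<odot>\<^bsub>M\<^esub> x, y)) ys)"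
proof -
  interpret M: module R M by fact
  interpret N: module R N by fact
  show ?thesis using assms(4)
  proof induction
    case (refl xs)
    then show ?case using assms(3) by (intro tensor_eq.refl) auto
  next
    case (commute xs ys)
    then show ?case using assms(3) by (simp, intro tensor_eq.commute) auto
  next
    case (append xs xs' ys ys')
    then show ?case by (simp add: tensor_eq.append)
  next
    case (zero y)
    then show ?case using assms(3) by (simp add: tensor_eq.zero)
  next
    case (add_left x x' y)
    then show ?case using assms(3) by (simp add: tensor_eq.add_left M.smult_r_distr)
  next
    case (add_right x y y')
    then show ?case using assms(3) by (simp add: tensor_eq.add_right)
  next
    case (scalar d x y)
    \<comment> \<open>The scalar d crosses to the right factor of the already scaled symbol;
      commutativity of the scalars then identifies c (d x) with d (c x).\<close>
    then have "tensor_eq R M N [(d \<odot>\<^bsub>M\<^esub> (c \<odot>\<^bsub>M\<^esub> x), y)] [(c \<odot>\<^bsub>M\<^esub> x, d \<odot>\<^bsub>N\<^esub> y)]"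
      using assms(3) by (intro tensor_eq.scalar) auto
    with scalar assms(3) show ?case
      by (simp add: M.smult_assoc1[symmetric] M.R.m_comm)
  qed (blast intro: tensor_eq.sym tensor_eq.trans)+
qed

lemma tensor_class_smult:
  assumes "module R M" "module R N" "c \<in> carrier R" "set xs \<subseteq> carrier M \<times> carrier N"
  shows "c \<odot>\<^bsub>tensor_algebra R M N\<^esub> tensor_class R M N xs =
    tensor_class R M N (map (\<lambda>(x, y). (c \<odot>\<^bsub>M\<^esub> x, y)) xs)"
  unfolding tensor_algebra_simps
  by (rule HOL.sym, intro tensor_class_eqI tensor_eq_map_smult tensor_eq_rep assms)

lemma tensor_class_closed:
  "set xs \<subseteq> carrier M \<times> carrier N \<Longrightarrow> tensor_class R M N xs \<in> carrier (tensor_algebra R M N)"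
  by (simp add: tensor_algebra_simps)

text \<open>Formal sums carry no negatives of their own. The inverse of a class is its multiple by
  -1, which rests on additivity in the scalar; that is the only module law that is not immediate
  from concatenating and mapping lists.\<close>

lemma module_tensor_algebra:
  assumes "module R M" "module R N"
  shows "module R (tensor_algebra R M N)"
proof -
  interpret M: module R M by fact
  interpret N: module R N by fact
  let ?T = "tensor_algebra R M N"
  let ?cls = "tensor_class R M N"
  let ?C = "{xs. set xs \<subseteq> carrier M \<times> carrier N}"
  let ?s = "\<lambda>c. map (\<lambda>(x, y). (c \<odot>\<^bsub>M\<^esub> x, y))"
  have carr: "carrier ?T = ?cls ` ?C" and zero: "\<zero>\<^bsub>?T\<^esub> = ?cls []"
    by (simp_all add: tensor_algebra_simps)
  have add: "?cls xs \<oplus>\<^bsub>?T\<^esub> ?cls ys = ?cls (xs @ ys)" if "xs \<in> ?C" "ys \<in> ?C" for xs ys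
    using that by (simp add: tensor_class_add)
  have smult: "c \<odot>\<^bsub>?T\<^esub> ?cls xs = ?cls (?s c xs)" if "c \<in> carrier R" "xs \<in> ?C" for c xs
    using that by (simp add: tensor_class_smult assms)
  have sC: "?s c xs \<in> ?C" if "c \<in> carrier R" "xs \<in> ?C" for c xs
    using that by auto
  have aC: "xs @ ys \<in> ?C" if "xs \<in> ?C" "ys \<in> ?C" for xs ys
    using that by auto
  have comm: "?cls (xs @ ys) = ?cls (ys @ xs)" if "xs \<in> ?C" "ys \<in> ?C" for xs ys
    using that by (intro tensor_class_eqI tensor_eq.commute) auto
  \<comment> \<open>Splitting every symbol interleaves the multiples by c and by d, whereas the
    right-hand side has them in two blocks. The induction step therefore has to move blocks past
    each other by \<open>comm\<close>.\<close>
  have distr: "?cls (?s (c \<oplus>\<^bsub>R\<^esub> d) xs) = ?cls (?s c xs @ ?s d xs)"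
    if cd: "c \<in> carrier R" "d \<in> carrier R" and "xs \<in> ?C" for c d xs
    using \<open>xs \<in> ?C\<close>
  proof (induction xs)
    case (Cons z xs)
    obtain x y where z: "z = (x, y)" "x \<in> carrier M" "y \<in> carrier N"
      using Cons.prems by (cases z) auto
    have xs: "xs \<in> ?C" using Cons.prems by auto
    have C: "[(c \<odot>\<^bsub>M\<^esub> x, y)] \<in> ?C" "[(d \<odot>\<^bsub>M\<^esub> x, y)] \<in> ?C" "[((c \<oplus>\<^bsub>R\<^esub> d) \<odot>\<^bsub>M\<^esub> x, y)] \<in> ?C"
      using z cd by auto
    note sC' = sC[OF cd(1) xs] sC[OF cd(2) xs]
    have "?cls (?s (c \<oplus>\<^bsub>R\<^esub> d) (z # xs)) = ?cls [((c \<oplus>\<^bsub>R\<^esub> d) \<odot>\<^bsub>M\<^esub> x, y)] \<oplus>\<^bsub>?T\<^esub> ?cls (?s (c \<oplus>\<^bsub>R\<^esub> d) xs)"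
      using z add[OF C(3) sC[OF _ xs]] cd by simp
    also have "?cls [((c \<oplus>\<^bsub>R\<^esub> d) \<odot>\<^bsub>M\<^esub> x, y)] = ?cls [(c \<odot>\<^bsub>M\<^esub> x, y), (d \<odot>\<^bsub>M\<^esub> x, y)]"
      using z cd by (auto simp: M.smult_l_distr intro!: tensor_class_eqI tensor_eq.add_left)
    also have "?cls (?s (c \<oplus>\<^bsub>R\<^esub> d) xs) = ?cls (?s d xs @ ?s c xs)"
      using Cons.IH xs comm[OF sC'] by simp
    also have "?cls [(c \<odot>\<^bsub>M\<^esub> x, y), (d \<odot>\<^bsub>M\<^esub> x, y)] \<oplus>\<^bsub>?T\<^esub> ?cls (?s d xs @ ?s c xs) =
        ?cls ([(c \<odot>\<^bsub>M\<^esub> x, y)] @ ([(d \<odot>\<^bsub>M\<^esub> x, y)] @ ?s d xs) @ ?s c xs)"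
      using z C aC[OF sC'(2,1)] by (subst add) auto
    also have "\<dots> = ?cls [(c \<odot>\<^bsub>M\<^esub> x, y)] \<oplus>\<^bsub>?T\<^esub> ?cls (([(d \<odot>\<^bsub>M\<^esub> x, y)] @ ?s d xs) @ ?s c xs)"
      using C aC[OF aC[OF C(2) sC'(2)] sC'(1)] by (subst add) auto
    also have "?cls (([(d \<odot>\<^bsub>M\<^esub> x, y)] @ ?s d xs) @ ?s c xs) =
        ?cls (?s c xs @ ([(d \<odot>\<^bsub>M\<^esub> x, y)] @ ?s d xs))"
      by (intro comm aC C sC')
    also have "?cls [(c \<odot>\<^bsub>M\<^esub> x, y)] \<oplus>\<^bsub>?T\<^esub> \<dots> = ?cls (?s c (z # xs) @ ?s d (z # xs))"
      using z C aC[OF sC'(1) aC[OF C(2) sC'(2)]] by (subst add) auto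
    finally show ?case .
  qed simp
  show ?thesis
  proof (intro moduleI abelian_groupI)
    fix X assume "X \<in> carrier ?T"
    then obtain xs where xs: "xs \<in> ?C" "X = ?cls xs" by (auto simp: carr)
    let ?Y = "?cls (?s (\<ominus>\<^bsub>R\<^esub> \<one>\<^bsub>R\<^esub>) xs)"
    have one: "?s \<one>\<^bsub>R\<^esub> xs = xs"
      using xs(1) by (intro map_idI) auto
    \<comment> \<open>Scaling by zero leaves symbols of the form (0, y), and the relation
      \<open>zero\<close> removes them one at a time.\<close>
    have "?s \<zero>\<^bsub>R\<^esub> xs \<in> ?C \<Longrightarrow> ?cls (?s \<zero>\<^bsub>R\<^esub> xs) = ?cls []"
      using xs(1)
    proof (induction xs)
      case (Cons z xs)
      obtain x y where z: "z = (x, y)" "x \<in> carrier M" "y \<in> carrier N"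
        using Cons.prems by (cases z) auto
      have "?cls ([(\<zero>\<^bsub>M\<^esub>, y)] @ ?s \<zero>\<^bsub>R\<^esub> xs) = ?cls [(\<zero>\<^bsub>M\<^esub>, y)] \<oplus>\<^bsub>?T\<^esub> ?cls (?s \<zero>\<^bsub>R\<^esub> xs)"
        using Cons.prems z by (intro add[symmetric]) auto
      also have "\<dots> = ?cls [] \<oplus>\<^bsub>?T\<^esub> ?cls []"
        using Cons z tensor_class_eqI[OF tensor_eq.zero[of y N R M]] by auto
      also have "\<dots> = ?cls []" by (subst add) auto
      finally show ?case using z by simp
    qed simp
    then have "?cls (?s \<zero>\<^bsub>R\<^esub> xs) = \<zero>\<^bsub>?T\<^esub>" using sC[OF _ xs(1), of "\<zero>\<^bsub>R\<^esub>"] by (simp add: zero)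
    moreover have "?cls (?s (\<ominus>\<^bsub>R\<^esub> \<one>\<^bsub>R\<^esub>) xs) \<oplus>\<^bsub>?T\<^esub> ?cls (?s \<one>\<^bsub>R\<^esub> xs) = ?cls (?s \<zero>\<^bsub>R\<^esub> xs)"
      using distr[of "\<ominus>\<^bsub>R\<^esub> \<one>\<^bsub>R\<^esub>" "\<one>\<^bsub>R\<^esub>" xs] xs(1) sC[OF _ xs(1), of "\<ominus>\<^bsub>R\<^esub> \<one>\<^bsub>R\<^esub>"]
      by (simp add: add one M.R.l_neg)
    ultimately have "?Y \<oplus>\<^bsub>?T\<^esub> X = \<zero>\<^bsub>?T\<^esub>" by (simp add: one xs)
    moreover have "?Y \<in> carrier ?T"
      unfolding carr by (rule imageI[OF sC[OF _ xs(1)]]) simp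
    ultimately show "\<exists>Y\<in>carrier ?T. Y \<oplus>\<^bsub>?T\<^esub> X = \<zero>\<^bsub>?T\<^esub>" by blast
  next
    fix X Y assume "X \<in> carrier ?T" "Y \<in> carrier ?T"
    then show "X \<oplus>\<^bsub>?T\<^esub> Y \<in> carrier ?T" "X \<oplus>\<^bsub>?T\<^esub> Y = Y \<oplus>\<^bsub>?T\<^esub> X"
      using aC comm by (fastforce simp: carr add)+
  next
    fix X Y Z assume "X \<in> carrier ?T" "Y \<in> carrier ?T" "Z \<in> carrier ?T"
    then show "X \<oplus>\<^bsub>?T\<^esub> Y \<oplus>\<^bsub>?T\<^esub> Z = X \<oplus>\<^bsub>?T\<^esub> (Y \<oplus>\<^bsub>?T\<^esub> Z)"
      by (clarsimp simp: carr add aC)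
  next
    fix X assume "X \<in> carrier ?T"
    then show "\<zero>\<^bsub>?T\<^esub> \<oplus>\<^bsub>?T\<^esub> X = X" by (clarsimp simp: carr add zero)
  next
    fix c X assume c: "c \<in> carrier R" and "X \<in> carrier ?T"
    then obtain xs where xs: "xs \<in> ?C" "X = ?cls xs" by (auto simp: carr)
    show "c \<odot>\<^bsub>?T\<^esub> X \<in> carrier ?T"
      unfolding xs(2) smult[OF c xs(1)] carr by (rule imageI[OF sC[OF c xs(1)]])
  next
    fix c d X assume cd: "c \<in> carrier R" "d \<in> carrier R" and "X \<in> carrier ?T"
    then obtain xs where xs: "xs \<in> ?C" "X = ?cls xs" by (auto simp: carr)
    show "(c \<oplus>\<^bsub>R\<^esub> d) \<odot>\<^bsub>?T\<^esub> X = c \<odot>\<^bsub>?T\<^esub> X \<oplus>\<^bsub>?T\<^esub> d \<odot>\<^bsub>?T\<^esub> X"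
      unfolding xs(2) using cd
      by (simp only: smult[OF _ xs(1)] M.R.a_closed add[OF sC[OF _ xs(1)] sC[OF _ xs(1)]]
          distr[OF _ _ xs(1)])
    show "(c \<otimes>\<^bsub>R\<^esub> d) \<odot>\<^bsub>?T\<^esub> X = c \<odot>\<^bsub>?T\<^esub> (d \<odot>\<^bsub>?T\<^esub> X)"
      unfolding xs(2) using cd
      by (simp only: smult[OF _ xs(1)] M.R.m_closed smult[OF _ sC[OF _ xs(1)]])
        (use xs(1) in \<open>auto intro!: arg_cong[where f = ?cls] M.smult_assoc1\<close>)
  next
    fix c X Y assume c: "c \<in> carrier R" and "X \<in> carrier ?T" "Y \<in> carrier ?T"
    then obtain xs ys where xs: "xs \<in> ?C" "X = ?cls xs" and ys: "ys \<in> ?C" "Y = ?cls ys"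
      by (auto simp: carr)
    show "c \<odot>\<^bsub>?T\<^esub> (X \<oplus>\<^bsub>?T\<^esub> Y) = c \<odot>\<^bsub>?T\<^esub> X \<oplus>\<^bsub>?T\<^esub> c \<odot>\<^bsub>?T\<^esub> Y"
      unfolding xs(2) ys(2) add[OF xs(1) ys(1)] smult[OF c xs(1)] smult[OF c ys(1)]
        smult[OF c aC[OF xs(1) ys(1)]] add[OF sC[OF c xs(1)] sC[OF c ys(1)]]
      by simp
  next
    fix X assume "X \<in> carrier ?T"
    then obtain xs where xs: "xs \<in> ?C" "X = ?cls xs" by (auto simp: carr)
    have "?s \<one>\<^bsub>R\<^esub> xs = xs" using xs(1) by (intro map_idI) auto
    then show "\<one>\<^bsub>R\<^esub> \<odot>\<^bsub>?T\<^esub> X = X" by (simp only: xs(2) smult[OF _ xs(1)] M.R.one_closed)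
  qed (auto simp: carr zero M.R.is_cring)
qed

section \<open>Pure tensors and the universal property\<close>

lemma pure_tensor_closed:
  "\<lbrakk>x \<in> carrier M; y \<in> carrier N\<rbrakk> \<Longrightarrow> pure_tensor R M N x y \<in> carrier (tensor_algebra R M N)"
  by (simp add: pure_tensor_def tensor_class_closed)

lemma bilinear_pure_tensor:
  assumes "module R M" "module R N"
  shows "pure_tensor R M N \<in> bilinear_maps R M N (tensor_algebra R M N)"
proof -
  interpret M: module R M by fact
  interpret N: module R N by fact
  show ?thesis
    unfolding pure_tensor_def
    by (intro bilinear_mapsI linear_mapsI)
      (auto simp: tensor_class_closed tensor_class_add tensor_class_smult assms
        intro!: tensor_class_eqI tensor_eq.add_left tensor_eq.add_right
          tensor_eq.scalar[THEN tensor_eq.sym])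
qed

lemma tensor_sum_class:
  assumes "module R M" "module R N" "module R P" "f \<in> bilinear_maps R M N P"
    and "set xs \<subseteq> carrier M \<times> carrier N"
  shows "tensor_sum P f (tensor_class R M N xs) = list_sum P f xs"
  unfolding tensor_sum_list_sum
  using list_sum_tensor_eq[OF assms(1-4) tensor_eq_rep[OF assms(5)]] by simp

lemma tensor_sum_pure_tensor:
  assumes "module R M" "module R N" "module R P" "f \<in> bilinear_maps R M N P"
    and "x \<in> carrier M" "y \<in> carrier N"
  shows "tensor_sum P f (pure_tensor R M N x y) = f x y"
proof -
  interpret P: module R P by fact
  show ?thesis
    unfolding pure_tensor_def
    by (subst tensor_sum_class[OF assms(1-4)]) (auto simp: assms bilinear_closed[OF assms(4)])
qed

lemma linear_tensor_sum:
  assumes "module R M" "module R N" "module R P" "f \<in> bilinear_maps R M N P"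
  shows "tensor_sum P f \<in> linear_maps R (tensor_algebra R M N) P"
proof -
  interpret M: module R M by fact
  interpret N: module R N by fact
  interpret P: module R P by fact
  note closed = bilinear_closed[OF assms(4)] and sum = tensor_sum_class[OF assms]
  have smult: "list_sum P f (map (\<lambda>(x, y). (c \<odot>\<^bsub>M\<^esub> x, y)) xs) = c \<odot>\<^bsub>P\<^esub> list_sum P f xs"
    if c: "c \<in> carrier R" and "set xs \<subseteq> carrier M \<times> carrier N" for c xs
    using that(2)
  proof (induction xs)
    case (Cons z xs)
    then obtain x y where z: "z = (x, y)" "x \<in> carrier M" "y \<in> carrier N" by (cases z) auto
    have "list_sum P f xs \<in> carrier P"
      using Cons.prems by (intro list_sum_closed P.abelian_group_axioms closed) auto
    moreover have "f (c \<odot>\<^bsub>M\<^esub> x) y = c \<odot>\<^bsub>P\<^esub> f x y"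
      using linear_smult[OF bilinear_left[OF assms(4) linear_id z(3)] c z(2)] .
    ultimately show ?case using Cons z c by (simp add: P.smult_r_distr closed)
  qed (simp add: c)
  show ?thesis
  proof (rule linear_mapsI)
    fix X assume "X \<in> carrier (tensor_algebra R M N)"
    then obtain xs where xs: "set xs \<subseteq> carrier M \<times> carrier N" "X = tensor_class R M N xs"
      by (auto simp: tensor_algebra_simps)
    show "tensor_sum P f X \<in> carrier P"
      unfolding xs(2) sum[OF xs(1)]
      using xs(1) by (intro list_sum_closed P.abelian_group_axioms closed) auto
    show "tensor_sum P f (c \<odot>\<^bsub>tensor_algebra R M N\<^esub> X) = c \<odot>\<^bsub>P\<^esub> tensor_sum P f X"
      if c: "c \<in> carrier R" for c
    proof -
      have "set (map (\<lambda>(x, y). (c \<odot>\<^bsub>M\<^esub> x, y)) xs) \<subseteq> carrier M \<times> carrier N"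
        using xs(1) c by auto
      then show ?thesis
        unfolding xs(2) tensor_class_smult[OF assms(1,2) c xs(1)] sum[OF xs(1)]
        by (subst sum) (simp_all add: smult[OF c xs(1)])
    qed
    fix Y assume "Y \<in> carrier (tensor_algebra R M N)"
    then obtain ys where ys: "set ys \<subseteq> carrier M \<times> carrier N" "Y = tensor_class R M N ys"
      by (auto simp: tensor_algebra_simps)
    have xys: "set (xs @ ys) \<subseteq> carrier M \<times> carrier N" using xs(1) ys(1) by simp
    show "tensor_sum P f (X \<oplus>\<^bsub>tensor_algebra R M N\<^esub> Y) = tensor_sum P f X \<oplus>\<^bsub>P\<^esub> tensor_sum P f Y"
      unfolding xs(2) ys(2) tensor_class_add[OF xs(1) ys(1)] sum[OF xs(1)] sum[OF ys(1)] sum[OF xys]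
      using xs(1) ys(1) by (intro list_sum_append P.abelian_group_axioms closed) auto
  qed
qed

lemma tensor_class_list_sum:
  assumes "module R M" "module R N" "set xs \<subseteq> carrier M \<times> carrier N"
  shows "tensor_class R M N xs = list_sum (tensor_algebra R M N) (pure_tensor R M N) xs"
  using assms(3)
proof (induction xs)
  case (Cons z xs)
  obtain x y where z: "z = (x, y)" by (cases z)
  show ?case
    using Cons tensor_class_add[of "[z]" M N xs R] by (simp add: z pure_tensor_def)
qed (simp add: tensor_algebra_simps)

text \<open>Pure tensors span. Identities that are linear in an element of a tensor product can be
  checked on them, without any appeal to representatives.\<close>

lemma linear_tensor_ext:
  assumes "module R M" "module R N" "module R P"
    and "h \<in> linear_maps R (tensor_algebra R M N) P" "k \<in> linear_maps R (tensor_algebra R M N) P"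
    and "\<And>x y. \<lbrakk>x \<in> carrier M; y \<in> carrier N\<rbrakk> \<Longrightarrow> h (pure_tensor R M N x y) = k (pure_tensor R M N x y)"
    and "X \<in> carrier (tensor_algebra R M N)"
  shows "h X = k X"
proof -
  obtain xs where xs: "set xs \<subseteq> carrier M \<times> carrier N" "X = tensor_class R M N xs"
    using assms(7) by (auto simp: tensor_algebra_simps)
  have pure: "pure_tensor R M N x y \<in> carrier (tensor_algebra R M N)" if "(x, y) \<in> set xs" for x y
    using xs(1) that by (auto intro: pure_tensor_closed)
  have "h' X = list_sum P (\<lambda>x y. h' (pure_tensor R M N x y)) xs"
    if "h' \<in> linear_maps R (tensor_algebra R M N) P" for h'
    unfolding xs(2) tensor_class_list_sum[OF assms(1,2) xs(1)]
    by (rule linear_list_sum[OF module_tensor_algebra[OF assms(1,2)] assms(3) that pure])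
  from this[OF assms(4)] this[OF assms(5)] show ?thesis
    using xs(1) by (auto intro!: list_sum_cong assms(6))
qed

text \<open>Both sides are evaluated on the same chosen representative, so termwise equality is
  enough. Bilinearity becomes an issue only where the representative changes.\<close>

lemma tensor_sum_cong:
  assumes "module R M" "module R N" "X \<in> carrier (tensor_algebra R M N)"
    and "\<And>x y. \<lbrakk>x \<in> carrier M; y \<in> carrier N\<rbrakk> \<Longrightarrow> f x y = g x y"
  shows "tensor_sum P f X = tensor_sum P g X"
  unfolding tensor_sum_list_sum
  using tensor_rep_carrier[OF assms(1-3)] by (intro list_sum_cong assms(4)) auto

lemma tensor_sum_closed:
  assumes "module R M" "module R N" "module R P" "X \<in> carrier (tensor_algebra R M N)"
    and "\<And>x y. \<lbrakk>x \<in> carrier M; y \<in> carrier N\<rbrakk> \<Longrightarrow> f x y \<in> carrier P"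
  shows "tensor_sum P f X \<in> carrier P"
proof -
  interpret P: module R P by fact
  show ?thesis
    unfolding tensor_sum_list_sum using tensor_rep_carrier[OF assms(1,2,4)]
    by (intro list_sum_closed P.abelian_group_axioms assms(5)) auto
qed

text \<open>With \<open>X\<close> and \<open>Y\<close> fixed, these are two finite sums over fixed
  lists, so the exchange is that of ordinary double sums.\<close>

lemma tensor_sum_swap:
  assumes "module R M" "module R N" "module R M'" "module R N'" "module R P"
    and "X \<in> carrier (tensor_algebra R M N)" "Y \<in> carrier (tensor_algebra R M' N')"
    and "\<And>x y u v. \<lbrakk>x \<in> carrier M; y \<in> carrier N; u \<in> carrier M'; v \<in> carrier N'\<rbrakk>
      \<Longrightarrow> f x y u v \<in> carrier P"
  shows "tensor_sum P (\<lambda>x y. tensor_sum P (f x y) Y) X =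
    tensor_sum P (\<lambda>u v. tensor_sum P (\<lambda>x y. f x y u v) X) Y"
proof -
  interpret P: module R P by fact
  show ?thesis
    unfolding tensor_sum_list_sum
    using tensor_rep_carrier[OF assms(1,2,6)] tensor_rep_carrier[OF assms(3,4,7)]
    by (intro list_sum_swap P.abelian_group_axioms assms(8)) auto
qed

lemma linear_commutes_tensor_sum:
  assumes "module R M" "module R N" "module R P" "module R Q" "h \<in> linear_maps R P Q"
    and "\<And>x y. \<lbrakk>x \<in> carrier M; y \<in> carrier N\<rbrakk> \<Longrightarrow> f x y \<in> carrier P"
    and "X \<in> carrier (tensor_algebra R M N)"
  shows "h (tensor_sum P f X) = tensor_sum Q (\<lambda>x y. h (f x y)) X"
  unfolding tensor_sum_list_sum
  using tensor_rep_carrier[OF assms(1,2,7)] by (intro linear_list_sum[OF assms(3-5)] assms(6)) auto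

lemma linear_maps_tensor_sum:
  assumes "module R L" "module R M" "module R N" "module R P" "X \<in> carrier (tensor_algebra R M N)"
    and "\<And>x y. \<lbrakk>x \<in> carrier M; y \<in> carrier N\<rbrakk> \<Longrightarrow> (\<lambda>z. f z x y) \<in> linear_maps R L P"
  shows "(\<lambda>z. tensor_sum P (f z) X) \<in> linear_maps R L P"
  unfolding tensor_sum_list_sum
  using tensor_rep_carrier[OF assms(2,3,5)]
  by (intro linear_maps_list_sum[OF assms(1,4)] assms(6)) auto

section \<open>The product on a tensor product of algebras\<close>

lemma tensor_mult_tensor_sum:
  assumes "unital_algebra R A" "unital_algebra R B"
    and "X \<in> carrier (tensor_algebra R A B)" "Y \<in> carrier (tensor_algebra R A B)"
  shows "X \<otimes>\<^bsub>tensor_algebra R A B\<^esub> Y =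
    tensor_sum (tensor_algebra R A B) (\<lambda>x y. tensor_sum (tensor_algebra R A B) (\<lambda>x' y'.
      pure_tensor R A B (x \<otimes>\<^bsub>A\<^esub> x') (y \<otimes>\<^bsub>B\<^esub> y')) Y) X"
proof -
  interpret A: unital_algebra R A by fact
  interpret B: unital_algebra R B by fact
  let ?T = "tensor_algebra R A B"
  interpret T: module R ?T
    by (rule module_tensor_algebra[OF A.module_axioms B.module_axioms])
  let ?C = "{xs. set xs \<subseteq> carrier A \<times> carrier B}"
  have row: "list_sum ?T (pure_tensor R A B) (map (\<lambda>(x', y'). (x \<otimes>\<^bsub>A\<^esub> x', y \<otimes>\<^bsub>B\<^esub> y')) ys) =
      list_sum ?T (\<lambda>x' y'. pure_tensor R A B (x \<otimes>\<^bsub>A\<^esub> x') (y \<otimes>\<^bsub>B\<^esub> y')) ys" for x y ys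
    by (induction ys) auto
  have "list_sum ?T (pure_tensor R A B) [(x \<otimes>\<^bsub>A\<^esub> x', y \<otimes>\<^bsub>B\<^esub> y'). (x, y) \<leftarrow> xs, (x', y') \<leftarrow> ys] =
    list_sum ?T (\<lambda>x y. list_sum ?T (\<lambda>x' y'. pure_tensor R A B (x \<otimes>\<^bsub>A\<^esub> x') (y \<otimes>\<^bsub>B\<^esub> y')) ys) xs"
    if "xs \<in> ?C" "ys \<in> ?C" for xs ys
    using that(1)
  proof (induction xs)
    case (Cons z xs)
    then obtain x y where z: "z = (x, y)" "x \<in> carrier A" "y \<in> carrier B" by (cases z) auto
    have "list_sum ?T (pure_tensor R A B)
        (map (\<lambda>(x', y'). (x \<otimes>\<^bsub>A\<^esub> x', y \<otimes>\<^bsub>B\<^esub> y')) ys @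
          [(x \<otimes>\<^bsub>A\<^esub> x', y \<otimes>\<^bsub>B\<^esub> y'). (x, y) \<leftarrow> xs, (x', y') \<leftarrow> ys]) =
      list_sum ?T (pure_tensor R A B) (map (\<lambda>(x', y'). (x \<otimes>\<^bsub>A\<^esub> x', y \<otimes>\<^bsub>B\<^esub> y')) ys) \<oplus>\<^bsub>?T\<^esub>
      list_sum ?T (pure_tensor R A B) [(x \<otimes>\<^bsub>A\<^esub> x', y \<otimes>\<^bsub>B\<^esub> y'). (x, y) \<leftarrow> xs, (x', y') \<leftarrow> ys]"
      using Cons.prems that(2) z
      by (intro list_sum_append T.abelian_group_axioms) (auto intro!: pure_tensor_closed)
    then show ?case using Cons z row by simp
  qed simp
  note * = this
  let ?xs = "tensor_rep X" and ?ys = "tensor_rep Y"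
  have rep: "?xs \<in> ?C" "?ys \<in> ?C"
    using tensor_rep_carrier[OF A.module_axioms B.module_axioms] assms(3,4) by auto
  have "X \<otimes>\<^bsub>?T\<^esub> Y =
      tensor_class R A B [(x \<otimes>\<^bsub>A\<^esub> x', y \<otimes>\<^bsub>B\<^esub> y'). (x, y) \<leftarrow> ?xs, (x', y') \<leftarrow> ?ys]"
    by (simp add: tensor_algebra_def)
  also have "\<dots> = list_sum ?T (pure_tensor R A B)
      [(x \<otimes>\<^bsub>A\<^esub> x', y \<otimes>\<^bsub>B\<^esub> y'). (x, y) \<leftarrow> ?xs, (x', y') \<leftarrow> ?ys]"
    using rep by (intro tensor_class_list_sum A.module_axioms B.module_axioms) auto
  finally show ?thesis
    unfolding tensor_sum_list_sum *[OF rep] .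
qed

text \<open>Linearity in four variables descends in two stages, one tensor product at a time. It is
  used for the product of a tensor algebra, written as in \<open>tensor_mult_tensor_sum\<close>, and
  for the diagonal pairing.\<close>

lemma bilinear_tensor_sum2:
  assumes "module R M" "module R N" "module R M'" "module R N'" "module R P"
    and "\<And>y u v. \<lbrakk>y \<in> carrier N; u \<in> carrier M'; v \<in> carrier N'\<rbrakk> \<Longrightarrow> (\<lambda>x. f x y u v) \<in> linear_maps R M P"
    and "\<And>x u v. \<lbrakk>x \<in> carrier M; u \<in> carrier M'; v \<in> carrier N'\<rbrakk> \<Longrightarrow> (\<lambda>y. f x y u v) \<in> linear_maps R N P"
    and "\<And>x y v. \<lbrakk>x \<in> carrier M; y \<in> carrier N; v \<in> carrier N'\<rbrakk> \<Longrightarrow> (\<lambda>u. f x y u v) \<in> linear_maps R M' P"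
    and "\<And>x y u. \<lbrakk>x \<in> carrier M; y \<in> carrier N; u \<in> carrier M'\<rbrakk> \<Longrightarrow> (\<lambda>v. f x y u v) \<in> linear_maps R N' P"
  shows "(\<lambda>X Y. tensor_sum P (\<lambda>x y. tensor_sum P (f x y) Y) X)
    \<in> bilinear_maps R (tensor_algebra R M N) (tensor_algebra R M' N') P"
proof (rule bilinear_mapsI)
  fix X assume X: "X \<in> carrier (tensor_algebra R M N)"
  show "(\<lambda>Y. tensor_sum P (\<lambda>x y. tensor_sum P (f x y) Y) X)
    \<in> linear_maps R (tensor_algebra R M' N') P"
    by (intro linear_maps_tensor_sum[OF _ assms(1,2,5) X] module_tensor_algebra assms(3,4)
        linear_tensor_sum[OF assms(3-5)] bilinear_mapsI assms(8,9))
next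
  fix Y assume Y: "Y \<in> carrier (tensor_algebra R M' N')"
  show "(\<lambda>X. tensor_sum P (\<lambda>x y. tensor_sum P (f x y) Y) X)
    \<in> linear_maps R (tensor_algebra R M N) P"
    by (intro linear_tensor_sum[OF assms(1,2,5)] bilinear_mapsI assms(1,2,6,7)
        linear_maps_tensor_sum[OF _ assms(3-5) Y])
qed

lemma
  assumes "unital_algebra R A" "unital_algebra R B"
  shows bilinear_tensor_mult: "monoid.mult (tensor_algebra R A B) \<in> bilinear_maps R
      (tensor_algebra R A B) (tensor_algebra R A B) (tensor_algebra R A B)" (is ?bil)
    and pure_tensor_mult:
      "\<lbrakk>x \<in> carrier A; x' \<in> carrier A; y \<in> carrier B; y' \<in> carrier B\<rbrakk> \<Longrightarrow>
        pure_tensor R A B x y \<otimes>\<^bsub>tensor_algebra R A B\<^esub> pure_tensor R A B x' y' =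
        pure_tensor R A B (x \<otimes>\<^bsub>A\<^esub> x') (y \<otimes>\<^bsub>B\<^esub> y')"
proof -
  interpret A: unital_algebra R A by fact
  interpret B: unital_algebra R B by fact
  let ?T = "tensor_algebra R A B"
  note mods = A.module_axioms B.module_axioms
  note modT = module_tensor_algebra[OF mods]
  note lins = bilinear_left[OF bilinear_pure_tensor[OF mods]] bilinear_right[OF bilinear_pure_tensor[OF mods]]
    bilinear_left[OF bilinear_mult[OF assms(1)]] bilinear_right[OF bilinear_mult[OF assms(1)]]
    bilinear_left[OF bilinear_mult[OF assms(2)]] bilinear_right[OF bilinear_mult[OF assms(2)]]
    linear_id A.m_closed B.m_closed
  have bil: "(\<lambda>X Y. tensor_sum ?T (\<lambda>x y. tensor_sum ?T (\<lambda>x' y'.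
      pure_tensor R A B (x \<otimes>\<^bsub>A\<^esub> x') (y \<otimes>\<^bsub>B\<^esub> y')) Y) X) \<in> bilinear_maps R ?T ?T ?T" (is "?m \<in> _")
    by (intro bilinear_tensor_sum2 mods modT lins)
  show ?bil
  proof (rule bilinear_mapsI)
    fix X assume X: "X \<in> carrier ?T"
    \<comment> \<open>The product agrees with the expression \<open>?m\<close> on carrier elements
      only, so linearity is carried over by \<open>linear_cong\<close> instead of by rewriting the
      function.\<close>
    show "(\<lambda>Y. X \<otimes>\<^bsub>?T\<^esub> Y) \<in> linear_maps R ?T ?T"
      using bilinear_right[OF bil X linear_id]
      by (subst linear_cong[OF modT]) (rule tensor_mult_tensor_sum[OF assms X])
    show "(\<lambda>Y. Y \<otimes>\<^bsub>?T\<^esub> X) \<in> linear_maps R ?T ?T"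
      using bilinear_left[OF bil linear_id X]
      by (subst linear_cong[OF modT]) (rule tensor_mult_tensor_sum[OF assms _ X])
  qed
  assume xy: "x \<in> carrier A" "x' \<in> carrier A" "y \<in> carrier B" "y' \<in> carrier B"
  have "pure_tensor R A B x y \<otimes>\<^bsub>?T\<^esub> pure_tensor R A B x' y' =
      ?m (pure_tensor R A B x y) (pure_tensor R A B x' y')"
    using xy by (intro tensor_mult_tensor_sum assms pure_tensor_closed)
  also have "\<dots> = tensor_sum ?T (\<lambda>x' y'. pure_tensor R A B (x \<otimes>\<^bsub>A\<^esub> x') (y \<otimes>\<^bsub>B\<^esub> y'))
      (pure_tensor R A B x' y')"
    using xy by (intro tensor_sum_pure_tensor mods modT bilinear_mapsI lins
        linear_maps_tensor_sum[OF _ mods modT] pure_tensor_closed)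
  also have "\<dots> = pure_tensor R A B (x \<otimes>\<^bsub>A\<^esub> x') (y \<otimes>\<^bsub>B\<^esub> y')"
    using xy by (intro tensor_sum_pure_tensor mods modT bilinear_mapsI lins)
  finally show "pure_tensor R A B x y \<otimes>\<^bsub>?T\<^esub> pure_tensor R A B x' y' =
      pure_tensor R A B (x \<otimes>\<^bsub>A\<^esub> x') (y \<otimes>\<^bsub>B\<^esub> y')" .
qed

text \<open>Associativity and the unit laws are linear in each argument, so
  \<open>linear_tensor_ext\<close>, applied to one argument after another, reduces them to pure
  tensors, where they hold in each factor.\<close>

lemma unital_algebra_tensor_algebra:
  assumes "unital_algebra R A" "unital_algebra R B"
  shows "unital_algebra R (tensor_algebra R A B)"
proof -
  interpret A: unital_algebra R A by fact
  interpret B: unital_algebra R B by fact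
  let ?T = "tensor_algebra R A B"
  note mods = A.module_axioms B.module_axioms
  note modT = module_tensor_algebra[OF mods]
  interpret T: module R ?T by (rule modT)
  note bil = bilinear_tensor_mult[OF assms]
  note lins = bilinear_left[OF bil] bilinear_right[OF bil] linear_id
  note ext = linear_tensor_ext[OF mods modT]
  note closed = pure_tensor_closed bilinear_closed[OF bil] A.m_closed B.m_closed
  note mult = pure_tensor_mult[OF assms]
  have one: "\<one>\<^bsub>?T\<^esub> = pure_tensor R A B \<one>\<^bsub>A\<^esub> \<one>\<^bsub>B\<^esub>" by (simp add: tensor_algebra_simps)
  have assoc: "X \<otimes>\<^bsub>?T\<^esub> Y \<otimes>\<^bsub>?T\<^esub> Z = X \<otimes>\<^bsub>?T\<^esub> (Y \<otimes>\<^bsub>?T\<^esub> Z)"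
    if XYZ: "X \<in> carrier ?T" "Y \<in> carrier ?T" "Z \<in> carrier ?T" for X Y Z
  proof (rule ext[of "\<lambda>X. X \<otimes>\<^bsub>?T\<^esub> Y \<otimes>\<^bsub>?T\<^esub> Z"])
    fix x1 x2 assume x: "x1 \<in> carrier A" "x2 \<in> carrier B"
    let ?x = "pure_tensor R A B x1 x2"
    show "?x \<otimes>\<^bsub>?T\<^esub> Y \<otimes>\<^bsub>?T\<^esub> Z = ?x \<otimes>\<^bsub>?T\<^esub> (Y \<otimes>\<^bsub>?T\<^esub> Z)"
    proof (rule ext[of "\<lambda>Y. ?x \<otimes>\<^bsub>?T\<^esub> Y \<otimes>\<^bsub>?T\<^esub> Z"])
      fix y1 y2 assume y: "y1 \<in> carrier A" "y2 \<in> carrier B"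
      let ?y = "pure_tensor R A B y1 y2"
      show "?x \<otimes>\<^bsub>?T\<^esub> ?y \<otimes>\<^bsub>?T\<^esub> Z = ?x \<otimes>\<^bsub>?T\<^esub> (?y \<otimes>\<^bsub>?T\<^esub> Z)"
        by (rule ext[of "\<lambda>Z. ?x \<otimes>\<^bsub>?T\<^esub> ?y \<otimes>\<^bsub>?T\<^esub> Z"], (intro lins closed x y)+)
          (simp_all add: x y XYZ mult A.m_assoc B.m_assoc)
    qed (intro lins closed x XYZ)+
  qed (intro lins closed XYZ)+
  have l_one: "\<one>\<^bsub>?T\<^esub> \<otimes>\<^bsub>?T\<^esub> X = X" if "X \<in> carrier ?T" for X
    by (rule ext[OF _ linear_id _ that], unfold one, intro lins closed A.one_closed B.one_closed)
      (simp add: mult)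
  have r_one: "X \<otimes>\<^bsub>?T\<^esub> \<one>\<^bsub>?T\<^esub> = X" if "X \<in> carrier ?T" for X
    by (rule ext[OF _ linear_id _ that], unfold one, intro lins closed A.one_closed B.one_closed)
      (simp add: mult)
  have linl: "(\<lambda>X. X \<otimes>\<^bsub>?T\<^esub> Y) \<in> linear_maps R ?T ?T"
    and linr: "(\<lambda>X. Y \<otimes>\<^bsub>?T\<^esub> X) \<in> linear_maps R ?T ?T" if "Y \<in> carrier ?T" for Y
    using that by (auto intro: lins)
  show ?thesis
    by (intro unital_algebra.intro ringI modT T.abelian_group_axioms monoidI unital_algebra_axioms.intro)
      (simp_all add: assoc l_one[unfolded one] r_one[unfolded one] bilinear_closed[OF bil] linear_add[OF linl] linear_add[OF linr]
        linear_smult[OF linl] linear_smult[OF linr] one pure_tensor_closed)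
qed

section \<open>Sweedler calculus in bialgebras\<close>

text \<open>Rearranging Sweedler sums needs only linearity of the comultiplication. With this isolated,
  the rules are available for \<open>tensor_hopf\<close> before its coassociativity is known.\<close>

locale comultiplication = module R H
  for R :: "('f, 'm) ring_scheme" and H :: "('f, 'h, 'x) hopf_scheme" +
  assumes linear_comult: "comult H \<in> linear_maps R H (tensor_algebra R H H)"
begin

abbreviation S where "S \<equiv> sweedler2 H"

lemma module_H: "module R H" ..

lemma cring_R: "cring R" ..

lemmas module_scalars = module_regular_module[OF cring_R]

lemma comult_closed: "a \<in> carrier H \<Longrightarrow> comult H a \<in> carrier (tensor_algebra R H H)"
  by (rule linear_closed[OF linear_comult])

lemma S_cong:
  assumes "\<And>x y. \<lbrakk>x \<in> carrier H; y \<in> carrier H\<rbrakk> \<Longrightarrow> f x y = g x y" "a \<in> carrier H"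
  shows "S P f a = S P g a"
  unfolding sweedler2_def
  by (rule tensor_sum_cong[OF module_H module_H comult_closed[OF assms(2)] assms(1)])

lemma S_closed:
  assumes "module R P" "a \<in> carrier H"
    and "\<And>x y. \<lbrakk>x \<in> carrier H; y \<in> carrier H\<rbrakk> \<Longrightarrow> f x y \<in> carrier P"
  shows "S P f a \<in> carrier P"
  unfolding sweedler2_def
  by (rule tensor_sum_closed[OF module_H module_H assms(1) comult_closed[OF assms(2)] assms(3)])

text \<open>Sums of scalars are taken in \<open>regular_module R\<close>, so that the rules for sums in a module
  apply to them.\<close>

lemma S_regular: "S (regular_module R) f a = S R f a"
  by (simp add: sweedler2_def tensor_sum_def)

text \<open>Here the variable sits in the element that is comultiplied, so the summand must be
  linear in both legs. In \<open>linear_S_inner\<close> it occurs in the summand only, and linearity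
  in that variable suffices.\<close>

lemma linear_S:
  assumes "module R P" "\<And>y. y \<in> carrier H \<Longrightarrow> (\<lambda>x. f x y) \<in> linear_maps R H P"
    and "\<And>x. x \<in> carrier H \<Longrightarrow> (\<lambda>y. f x y) \<in> linear_maps R H P"
    and "g \<in> linear_maps R L H"
  shows "(\<lambda>z. S P f (g z)) \<in> linear_maps R L P"
  unfolding sweedler2_def
  by (intro linear_comp[OF linear_tensor_sum linear_comp[OF linear_comult]] module_H bilinear_mapsI assms)

lemma linear_S_inner:
  assumes "module R P" "module R L" "a \<in> carrier H"
    and "\<And>x y. \<lbrakk>x \<in> carrier H; y \<in> carrier H\<rbrakk> \<Longrightarrow> (\<lambda>z. f z x y) \<in> linear_maps R L P"
  shows "(\<lambda>z. S P (f z) a) \<in> linear_maps R L P"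
  unfolding sweedler2_def
  by (intro linear_maps_tensor_sum[OF assms(2) module_H module_H assms(1)] comult_closed assms(3,4))

lemma linear_commutes_S:
  assumes "h \<in> linear_maps R P Q" "module R P" "module R Q" "a \<in> carrier H"
    and "\<And>x y. \<lbrakk>x \<in> carrier H; y \<in> carrier H\<rbrakk> \<Longrightarrow> f x y \<in> carrier P"
  shows "h (S P f a) = S Q (\<lambda>x y. h (f x y)) a"
  unfolding sweedler2_def
  by (intro linear_commutes_tensor_sum[OF module_H module_H] comult_closed assms)

lemma S_swap:
  assumes "module R P" "a \<in> carrier H" "b \<in> carrier H"
    and "\<And>x y u v. \<lbrakk>x \<in> carrier H; y \<in> carrier H; u \<in> carrier H; v \<in> carrier H\<rbrakk>
      \<Longrightarrow> f x y u v \<in> carrier P"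
  shows "S P (\<lambda>x y. S P (\<lambda>u v. f x y u v) b) a = S P (\<lambda>u v. S P (\<lambda>x y. f x y u v) a) b"
  unfolding sweedler2_def
  by (intro tensor_sum_swap[OF module_H module_H module_H module_H] comult_closed assms)

lemma S_smult:
  assumes "module R P" "c \<in> carrier R" "a \<in> carrier H"
    and "\<And>x y. \<lbrakk>x \<in> carrier H; y \<in> carrier H\<rbrakk> \<Longrightarrow> f x y \<in> carrier P"
  shows "c \<odot>\<^bsub>P\<^esub> S P f a = S P (\<lambda>x y. c \<odot>\<^bsub>P\<^esub> f x y) a"
  using bilinear_right[OF bilinear_smult[OF assms(1)] _ linear_id, of c] assms
  by (intro linear_commutes_S) simp_all

lemma S_smult_left:
  assumes "module R P" "p \<in> carrier P" "a \<in> carrier H"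
    and "\<And>x y. \<lbrakk>x \<in> carrier H; y \<in> carrier H\<rbrakk> \<Longrightarrow> f x y \<in> carrier R"
  shows "S R f a \<odot>\<^bsub>P\<^esub> p = S P (\<lambda>x y. f x y \<odot>\<^bsub>P\<^esub> p) a"
  using linear_commutes_S[OF bilinear_left[OF bilinear_smult[OF assms(1)] linear_id assms(2)]
      module_scalars assms(1,3)] assms(4)
  by (simp add: S_regular)

end

text \<open>These are the axioms to be verified for \<open>tensor_hopf\<close>, so that what is
  proved here holds for H and for H \<otimes> H alike.\<close>

locale bialgebra = unital_algebra R H
  for R :: "('f, 'm) ring_scheme" and H :: "('f, 'h, 'x) hopf_scheme" +
  assumes comult_hom: "comult H \<in> unital_algebra_homs R H (tensor_algebra R H H)"
    and counit_hom: "counit H \<in> unital_algebra_homs R H (regular_module R)"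
    and coassoc: "a \<in> carrier H \<Longrightarrow>
      sweedler2 H (tensor_algebra R H (tensor_algebra R H H))
        (\<lambda>a1 a2. sweedler2 H (tensor_algebra R H (tensor_algebra R H H))
          (\<lambda>a11 a12. pure_tensor R H (tensor_algebra R H H) a11 (pure_tensor R H H a12 a2)) a1) a
      = sweedler2 H (tensor_algebra R H (tensor_algebra R H H))
        (\<lambda>a1 a2. pure_tensor R H (tensor_algebra R H H) a1 (comult H a2)) a"
    and counit_left: "a \<in> carrier H \<Longrightarrow> sweedler2 H H (\<lambda>a1 a2. counit H a1 \<odot>\<^bsub>H\<^esub> a2) a = a"
    and counit_right: "a \<in> carrier H \<Longrightarrow> sweedler2 H H (\<lambda>a1 a2. counit H a2 \<odot>\<^bsub>H\<^esub> a1) a = a"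

lemma hopf_algebra_imp_bialgebra: "hopf_algebra R H \<Longrightarrow> bialgebra R H"
  by (auto simp: bialgebra_def bialgebra_axioms_def hopf_algebra_def hopf_algebra_axioms_def)

sublocale bialgebra \<subseteq> comultiplication
  using comult_hom by unfold_locales (simp add: unital_algebra_homs_def algebra_homs_def)

context bialgebra
begin

lemma unital_algebra_H: "unital_algebra R H" ..

lemma linear_counit: "counit H \<in> linear_maps R H (regular_module R)"
  using counit_hom by (simp add: unital_algebra_homs_def algebra_homs_def)

lemma counit_closed: "a \<in> carrier H \<Longrightarrow> counit H a \<in> carrier R"
  using linear_closed[OF linear_counit] by simp

lemma counit_one: "counit H \<one>\<^bsub>H\<^esub> = \<one>\<^bsub>R\<^esub>"
  using counit_hom by (simp add: unital_algebra_homs_def)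

lemma counit_mult:
  "\<lbrakk>a \<in> carrier H; b \<in> carrier H\<rbrakk> \<Longrightarrow> counit H (a \<otimes>\<^bsub>H\<^esub> b) = counit H a \<otimes>\<^bsub>R\<^esub> counit H b"
  using counit_hom by (simp add: unital_algebra_homs_def algebra_homs_def)

text \<open>A trilinear f induces a linear map on H \<otimes> (H \<otimes> H). Applying that map to
  the axiom \<open>coassoc\<close> turns an identity of tensors into one for arbitrary Sweedler
  sums.\<close>

lemma S_coassoc:
  assumes "module R P" "a \<in> carrier H"
    and lin: "\<And>y z. \<lbrakk>y \<in> carrier H; z \<in> carrier H\<rbrakk> \<Longrightarrow> (\<lambda>x. f x y z) \<in> linear_maps R H P"
      "\<And>x z. \<lbrakk>x \<in> carrier H; z \<in> carrier H\<rbrakk> \<Longrightarrow> (\<lambda>y. f x y z) \<in> linear_maps R H P"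
      "\<And>x y. \<lbrakk>x \<in> carrier H; y \<in> carrier H\<rbrakk> \<Longrightarrow> (\<lambda>z. f x y z) \<in> linear_maps R H P"
  shows "S P (\<lambda>x z. S P (\<lambda>u v. f u v z) x) a = S P (\<lambda>x y. S P (\<lambda>u v. f x u v) y) a"
proof -
  let ?H2 = "tensor_algebra R H H"
  let ?H3 = "tensor_algebra R H ?H2"
  note m2 = module_tensor_algebra[OF module_H module_H]
  note m3 = module_tensor_algebra[OF module_H m2]
  let ?h = "tensor_sum P (\<lambda>x. tensor_sum P (f x))"
  have bil: "f x \<in> bilinear_maps R H H P" if "x \<in> carrier H" for x
    by (intro bilinear_mapsI lin that)
  have bil': "(\<lambda>x. tensor_sum P (f x)) \<in> bilinear_maps R H ?H2 P"
    using bil by (intro bilinear_mapsI linear_tensor_sum linear_maps_tensor_sum[OF module_H module_H module_H]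
        module_H assms(1) lin)
  have h: "?h \<in> linear_maps R ?H3 P"
    by (intro linear_tensor_sum module_H m2 assms(1) bil')
  have pure: "?h (pure_tensor R H ?H2 x Y) = tensor_sum P (f x) Y"
    if "x \<in> carrier H" "Y \<in> carrier ?H2" for x Y
    by (rule tensor_sum_pure_tensor[OF module_H m2 assms(1) bil' that])
  have pure2: "tensor_sum P (f x) (pure_tensor R H H y z) = f x y z"
    if "x \<in> carrier H" "y \<in> carrier H" "z \<in> carrier H" for x y z
    by (rule tensor_sum_pure_tensor[OF module_H module_H assms(1) bil[OF that(1)] that(2,3)])
  have "S P (\<lambda>x z. S P (\<lambda>u v. f u v z) x) a =
    S P (\<lambda>x z. ?h (S ?H3 (\<lambda>u v. pure_tensor R H ?H2 u (pure_tensor R H H v z)) x)) a"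
    by (intro S_cong assms(2), subst linear_commutes_S[OF h m3 assms(1)])
      (auto simp: pure pure2 pure_tensor_closed intro!: S_cong)
  also have "\<dots> = ?h (S ?H3 (\<lambda>x z. S ?H3
      (\<lambda>u v. pure_tensor R H ?H2 u (pure_tensor R H H v z)) x) a)"
    by (intro linear_commutes_S[OF h m3 assms(1), symmetric] S_closed m3 pure_tensor_closed assms(2))
  also have "\<dots> = ?h (S ?H3 (\<lambda>x Y. pure_tensor R H ?H2 x (comult H Y)) a)"
    by (simp only: coassoc[OF assms(2)])
  also have "\<dots> = S P (\<lambda>x Y. ?h (pure_tensor R H ?H2 x (comult H Y))) a"
    by (intro linear_commutes_S[OF h m3 assms(1)] pure_tensor_closed comult_closed assms(2))
  also have "\<dots> = S P (\<lambda>x y. S P (\<lambda>u v. f x u v) y) a"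
    by (intro S_cong assms(2)) (simp add: pure comult_closed sweedler2_def)
  finally show ?thesis .
qed

text \<open>The linear map on H \<otimes> H induced by f is applied to the multiplicativity of
  \<open>comult\<close>.\<close>

lemma S_mult:
  assumes "module R P" "a \<in> carrier H" "b \<in> carrier H"
    and lin: "\<And>y. y \<in> carrier H \<Longrightarrow> (\<lambda>x. f x y) \<in> linear_maps R H P"
      "\<And>x. x \<in> carrier H \<Longrightarrow> (\<lambda>y. f x y) \<in> linear_maps R H P"
  shows "S P f (a \<otimes>\<^bsub>H\<^esub> b) = S P (\<lambda>a1 a2. S P (\<lambda>b1 b2. f (a1 \<otimes>\<^bsub>H\<^esub> b1) (a2 \<otimes>\<^bsub>H\<^esub> b2)) b) a"
proof -
  let ?H2 = "tensor_algebra R H H"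
  note m2 = module_tensor_algebra[OF module_H module_H]
  have bil: "f \<in> bilinear_maps R H H P" by (intro bilinear_mapsI lin)
  note f = linear_tensor_sum[OF module_H module_H assms(1) bil]
  have "S P f (a \<otimes>\<^bsub>H\<^esub> b) = tensor_sum P f (comult H a \<otimes>\<^bsub>?H2\<^esub> comult H b)"
    using comult_hom assms(2,3) by (simp add: sweedler2_def unital_algebra_homs_def algebra_homs_def)
  also have "\<dots> = tensor_sum P f (S ?H2 (\<lambda>a1 a2. S ?H2 (\<lambda>b1 b2.
      pure_tensor R H H (a1 \<otimes>\<^bsub>H\<^esub> b1) (a2 \<otimes>\<^bsub>H\<^esub> b2)) b) a)"
    by (subst tensor_mult_tensor_sum) (auto simp: unital_algebra_H comult_closed assms sweedler2_def)
  also have "\<dots> = S P (\<lambda>a1 a2. S P (\<lambda>b1 b2. f (a1 \<otimes>\<^bsub>H\<^esub> b1) (a2 \<otimes>\<^bsub>H\<^esub> b2)) b) a"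
    using assms(2,3)
    by (subst linear_commutes_S[OF f m2 assms(1)])
      (auto intro!: S_closed m2 pure_tensor_closed S_cong
        simp: linear_commutes_S[OF f m2 assms(1)] pure_tensor_closed
          tensor_sum_pure_tensor[OF module_H module_H assms(1) bil])
  finally show ?thesis .
qed

lemma S_one:
  assumes "module R P" "\<And>y. y \<in> carrier H \<Longrightarrow> (\<lambda>x. f x y) \<in> linear_maps R H P"
    and "\<And>x. x \<in> carrier H \<Longrightarrow> (\<lambda>y. f x y) \<in> linear_maps R H P"
  shows "S P f \<one>\<^bsub>H\<^esub> = f \<one>\<^bsub>H\<^esub> \<one>\<^bsub>H\<^esub>"
proof -
  have "comult H \<one>\<^bsub>H\<^esub> = pure_tensor R H H \<one>\<^bsub>H\<^esub> \<one>\<^bsub>H\<^esub>"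
    using comult_hom by (simp add: unital_algebra_homs_def tensor_algebra_simps)
  moreover have "f \<in> bilinear_maps R H H P" by (intro bilinear_mapsI assms)
  ultimately show ?thesis
    by (simp add: sweedler2_def tensor_sum_pure_tensor[OF module_H module_H assms(1)])
qed

lemma S_counit_left:
  assumes "module R P" "f \<in> linear_maps R H P" "a \<in> carrier H"
  shows "S P (\<lambda>x y. counit H x \<odot>\<^bsub>P\<^esub> f y) a = f a"
proof -
  have "f a = f (S H (\<lambda>x y. counit H x \<odot>\<^bsub>H\<^esub> y) a)" by (simp add: counit_left assms(3))
  also have "\<dots> = S P (\<lambda>x y. f (counit H x \<odot>\<^bsub>H\<^esub> y)) a"
    by (rule linear_commutes_S[OF assms(2) module_H assms(1,3)]) (simp add: counit_closed)
  also have "\<dots> = S P (\<lambda>x y. counit H x \<odot>\<^bsub>P\<^esub> f y) a"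
    by (intro S_cong assms) (simp add: linear_smult[OF assms(2)] counit_closed)
  finally show ?thesis by simp
qed

lemma S_counit_right:
  assumes "module R P" "f \<in> linear_maps R H P" "a \<in> carrier H"
  shows "S P (\<lambda>x y. counit H y \<odot>\<^bsub>P\<^esub> f x) a = f a"
proof -
  have "f a = f (S H (\<lambda>x y. counit H y \<odot>\<^bsub>H\<^esub> x) a)" by (simp add: counit_right assms(3))
  also have "\<dots> = S P (\<lambda>x y. f (counit H y \<odot>\<^bsub>H\<^esub> x)) a"
    by (rule linear_commutes_S[OF assms(2) module_H assms(1,3)]) (simp add: counit_closed)
  also have "\<dots> = S P (\<lambda>x y. counit H y \<odot>\<^bsub>P\<^esub> f x) a"
    by (intro S_cong assms) (simp add: linear_smult[OF assms(2)] counit_closed)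
  finally show ?thesis by simp
qed

end

section \<open>Hopf pairings and the associativity of iHopf algebras\<close>

text \<open>Associativity of the iHopf product is proved once, in this locale. It is then used for
  \<phi> twisted by \<tau> (\<open>paired_twist\<close>) and for the diagonal pairing on H \<otimes>
  H (\<open>paired_diagonal\<close>).\<close>

locale paired_bialgebra = bialgebra R H
  for R :: "('f, 'm) ring_scheme" and H :: "('f, 'h, 'x) hopf_scheme" +
  fixes \<phi> :: "'h \<Rightarrow> 'h \<Rightarrow> 'f"
  assumes bilinear_pairing: "\<phi> \<in> bilinear_maps R H H (regular_module R)"
    and pairing_one_right: "a \<in> carrier H \<Longrightarrow> \<phi> a \<one>\<^bsub>H\<^esub> = counit H a"
    and pairing_one_left: "b \<in> carrier H \<Longrightarrow> \<phi> \<one>\<^bsub>H\<^esub> b = counit H b"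
    and pairing_mult_right: "\<lbrakk>a \<in> carrier H; b \<in> carrier H; b' \<in> carrier H\<rbrakk> \<Longrightarrow>
      \<phi> a (b \<otimes>\<^bsub>H\<^esub> b') = sweedler2 H R (\<lambda>a1 a2. \<phi> a1 b \<otimes>\<^bsub>R\<^esub> \<phi> a2 b') a"
    and pairing_mult_left: "\<lbrakk>a \<in> carrier H; a' \<in> carrier H; b \<in> carrier H\<rbrakk> \<Longrightarrow>
      \<phi> (a \<otimes>\<^bsub>H\<^esub> a') b = sweedler2 H R (\<lambda>b1 b2. \<phi> a b1 \<otimes>\<^bsub>R\<^esub> \<phi> a' b2) b"
begin

lemma pairing_closed: "\<lbrakk>a \<in> carrier H; b \<in> carrier H\<rbrakk> \<Longrightarrow> \<phi> a b \<in> carrier R"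
  using bilinear_closed[OF bilinear_pairing] by simp

text \<open>Premises about scalars are unfolded to \<open>carrier R\<close>, the form in which
  \<open>closed\<close> proves them, while linearity itself keeps \<open>regular_module R\<close> as
  its target.\<close>

lemmas lin = linear_id
  bilinear_left[OF bilinear_pairing] bilinear_right[OF bilinear_pairing]
  bilinear_left[OF bilinear_mult[OF unital_algebra_H]]
  bilinear_right[OF bilinear_mult[OF unital_algebra_H]]
  bilinear_left[OF bilinear_mult_scalar[OF cring_R], unfolded regular_module_simps(1)]
  bilinear_right[OF bilinear_mult_scalar[OF cring_R], unfolded regular_module_simps(1)]
  bilinear_left[OF bilinear_smult]
  bilinear_right[OF bilinear_smult, unfolded regular_module_simps(1)]
  linear_S linear_S_inner
lemmas closed = pairing_closed m_closed R.m_closed S_closed module_H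

definition star where
  "star a b = S H (\<lambda>a1 a2. S H (\<lambda>b1 b2. \<phi> b2 a1 \<odot>\<^bsub>H\<^esub> (a2 \<otimes>\<^bsub>H\<^esub> b1)) b) a"

lemma bilinear_star: "star \<in> bilinear_maps R H H H"
  unfolding star_def
  by (intro bilinear_mapsI lin closed smult_closed)

lemma star_closed: "\<lbrakk>a \<in> carrier H; b \<in> carrier H\<rbrakk> \<Longrightarrow> star a b \<in> carrier H"
  by (rule bilinear_closed[OF bilinear_star])

lemma linear_star:
  assumes "h \<in> linear_maps R H P" "module R P" "a \<in> carrier H" "b \<in> carrier H"
  shows "h (star a b) = S P (\<lambda>a1 a2. S P (\<lambda>b1 b2. \<phi> b2 a1 \<odot>\<^bsub>P\<^esub> h (a2 \<otimes>\<^bsub>H\<^esub> b1)) b) a"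
proof -
  have "h (star a b) =
      S P (\<lambda>a1 a2. h (S H (\<lambda>b1 b2. \<phi> b2 a1 \<odot>\<^bsub>H\<^esub> (a2 \<otimes>\<^bsub>H\<^esub> b1)) b)) a"
    unfolding star_def
    by (intro linear_commutes_S closed smult_closed assms)
  also have "\<dots> = S P (\<lambda>a1 a2. S P (\<lambda>b1 b2. h (\<phi> b2 a1 \<odot>\<^bsub>H\<^esub> (a2 \<otimes>\<^bsub>H\<^esub> b1))) b) a"
    by (rule S_cong, rule linear_commutes_S) (assumption | intro closed smult_closed assms)+
  also have "\<dots> = S P (\<lambda>a1 a2. S P (\<lambda>b1 b2. \<phi> b2 a1 \<odot>\<^bsub>P\<^esub> h (a2 \<otimes>\<^bsub>H\<^esub> b1)) b) a"
    by (rule S_cong, rule S_cong, rule linear_smult[OF assms(1)]) (assumption | intro closed assms)+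
  finally show ?thesis .
qed

text \<open>The pairing with x1 y1 comultiplies the last leg of c. The legs of c thus come out
  nested to the right at once, in contrast to those of a in \<open>star_mult\<close>.\<close>

lemma mult_star:
  assumes "x \<in> carrier H" "y \<in> carrier H" "c \<in> carrier H"
  shows "star (x \<otimes>\<^bsub>H\<^esub> y) c = S H (\<lambda>x1 x2. S H (\<lambda>y1 y2. S H (\<lambda>c1 c'. S H (\<lambda>c2 c3.
    (\<phi> c2 x1 \<otimes>\<^bsub>R\<^esub> \<phi> c3 y1) \<odot>\<^bsub>H\<^esub> (x2 \<otimes>\<^bsub>H\<^esub> y2 \<otimes>\<^bsub>H\<^esub> c1)) c') c) y) x"
proof -
  have "star (x \<otimes>\<^bsub>H\<^esub> y) c = S H (\<lambda>x1 x2. S H (\<lambda>y1 y2. S H (\<lambda>c1 c'.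
      \<phi> c' (x1 \<otimes>\<^bsub>H\<^esub> y1) \<odot>\<^bsub>H\<^esub> (x2 \<otimes>\<^bsub>H\<^esub> y2 \<otimes>\<^bsub>H\<^esub> c1)) c) y) x"
    unfolding star_def by (intro S_mult lin closed smult_closed assms)
  also have "\<dots> = S H (\<lambda>x1 x2. S H (\<lambda>y1 y2. S H (\<lambda>c1 c'. S H (\<lambda>c2 c3.
    (\<phi> c2 x1 \<otimes>\<^bsub>R\<^esub> \<phi> c3 y1) \<odot>\<^bsub>H\<^esub> (x2 \<otimes>\<^bsub>H\<^esub> y2 \<otimes>\<^bsub>H\<^esub> c1)) c') c) y) x"
    by (rule S_cong, rule S_cong, rule S_cong, subst pairing_mult_right)
      (intro S_smult_left closed assms | assumption)+
  finally show ?thesis .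
qed

text \<open>Here the pairing comultiplies the first leg of a, so the legs come out nested to the
  left and coassociativity has to renumber them.\<close>

lemma star_mult:
  assumes "x \<in> carrier H" "y \<in> carrier H" "a \<in> carrier H"
  shows "star a (x \<otimes>\<^bsub>H\<^esub> y) = S H (\<lambda>x1 x2. S H (\<lambda>y1 y2. S H (\<lambda>a1 a'. S H (\<lambda>a2 a3.
    (\<phi> x2 a1 \<otimes>\<^bsub>R\<^esub> \<phi> y2 a2) \<odot>\<^bsub>H\<^esub> (a3 \<otimes>\<^bsub>H\<^esub> (x1 \<otimes>\<^bsub>H\<^esub> y1))) a') a) y) x"
proof -
  have "star a (x \<otimes>\<^bsub>H\<^esub> y) = S H (\<lambda>a1 a2. S H (\<lambda>x1 x2. S H (\<lambda>y1 y2.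
      \<phi> (x2 \<otimes>\<^bsub>H\<^esub> y2) a1 \<odot>\<^bsub>H\<^esub> (a2 \<otimes>\<^bsub>H\<^esub> (x1 \<otimes>\<^bsub>H\<^esub> y1))) y) x) a"
    unfolding star_def by (rule S_cong, rule S_mult) (assumption | intro lin closed smult_closed assms)+
  also have "\<dots> = S H (\<lambda>x1 x2. S H (\<lambda>a1 a2. S H (\<lambda>y1 y2.
      \<phi> (x2 \<otimes>\<^bsub>H\<^esub> y2) a1 \<odot>\<^bsub>H\<^esub> (a2 \<otimes>\<^bsub>H\<^esub> (x1 \<otimes>\<^bsub>H\<^esub> y1))) y) a) x"
    by (intro S_swap closed smult_closed assms)
  also have "\<dots> = S H (\<lambda>x1 x2. S H (\<lambda>y1 y2. S H (\<lambda>a1 a2.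
      \<phi> (x2 \<otimes>\<^bsub>H\<^esub> y2) a1 \<odot>\<^bsub>H\<^esub> (a2 \<otimes>\<^bsub>H\<^esub> (x1 \<otimes>\<^bsub>H\<^esub> y1))) a) y) x"
    by (rule S_cong, rule S_swap) (assumption | intro closed smult_closed assms)+
  also have "\<dots> = S H (\<lambda>x1 x2. S H (\<lambda>y1 y2. S H (\<lambda>a' a3. S H (\<lambda>a1 a2.
    (\<phi> x2 a1 \<otimes>\<^bsub>R\<^esub> \<phi> y2 a2) \<odot>\<^bsub>H\<^esub> (a3 \<otimes>\<^bsub>H\<^esub> (x1 \<otimes>\<^bsub>H\<^esub> y1))) a') a) y) x"
    by (rule S_cong, rule S_cong, rule S_cong, subst pairing_mult_left)
      (intro S_smult_left closed assms | assumption)+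
  also have "\<dots> = S H (\<lambda>x1 x2. S H (\<lambda>y1 y2. S H (\<lambda>a1 a'. S H (\<lambda>a2 a3.
    (\<phi> x2 a1 \<otimes>\<^bsub>R\<^esub> \<phi> y2 a2) \<odot>\<^bsub>H\<^esub> (a3 \<otimes>\<^bsub>H\<^esub> (x1 \<otimes>\<^bsub>H\<^esub> y1))) a') a) y) x"
    by (rule S_cong, rule S_cong, rule S_coassoc) (assumption | intro lin closed smult_closed assms)+
  finally show ?thesis .
qed

lemma sweedler3_swap:
  assumes "module R P" "a \<in> carrier H" "b \<in> carrier H"
    and "\<And>x y z u v w. \<lbrakk>x \<in> carrier H; y \<in> carrier H; z \<in> carrier H;
      u \<in> carrier H; v \<in> carrier H; w \<in> carrier H\<rbrakk> \<Longrightarrow> f x y z u v w \<in> carrier P"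
  shows "S P (\<lambda>x a'. S P (\<lambda>y z. S P (\<lambda>u b'. S P (\<lambda>v w. f x y z u v w) b') b) a') a =
    S P (\<lambda>u b'. S P (\<lambda>v w. S P (\<lambda>x a'. S P (\<lambda>y z. f x y z u v w) a') a) b') b"
proof -
  have "S P (\<lambda>x a'. S P (\<lambda>y z. S P (\<lambda>u b'. S P (\<lambda>v w. f x y z u v w) b') b) a') a =
    S P (\<lambda>x a'. S P (\<lambda>u b'. S P (\<lambda>y z. S P (\<lambda>v w. f x y z u v w) b') a') b) a"
    by (rule S_cong, rule S_swap) (assumption | intro S_closed assms)+
  also have "\<dots> = S P (\<lambda>u b'. S P (\<lambda>x a'. S P (\<lambda>y z. S P (\<lambda>v w. f x y z u v w) b') a') a) b"
    by (intro S_swap S_closed assms)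
  also have "\<dots> = S P (\<lambda>u b'. S P (\<lambda>x a'. S P (\<lambda>v w. S P (\<lambda>y z. f x y z u v w) a') b') a) b"
    by (rule S_cong, rule S_cong, rule S_swap) (assumption | intro S_closed assms)+
  also have "\<dots> = S P (\<lambda>u b'. S P (\<lambda>v w. S P (\<lambda>x a'. S P (\<lambda>y z. f x y z u v w) a') a) b') b"
    by (rule S_cong, rule S_swap) (assumption | intro S_closed assms)+
  finally show ?thesis .
qed

lemma star_assoc:
  assumes [simp]: "a \<in> carrier H" "b \<in> carrier H" "c \<in> carrier H"
  shows "star (star a b) c = star a (star b c)"
proof -
  \<comment> \<open>The common form of both sides. Besides the use hidden in
    \<open>star_mult\<close>, coassociativity is applied once on each side: the left bracketing
    comultiplies the first leg of b again, the right one the first leg of c.\<close>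
  define G where "G a1 a2 a3 b1 b2 b3 c1 c2 c3 =
    (\<phi> b3 a1 \<otimes>\<^bsub>R\<^esub> \<phi> c2 a2 \<otimes>\<^bsub>R\<^esub> \<phi> c3 b1) \<odot>\<^bsub>H\<^esub> (a3 \<otimes>\<^bsub>H\<^esub> b2 \<otimes>\<^bsub>H\<^esub> c1)"
    for a1 a2 a3 b1 b2 b3 c1 c2 c3
  note closed = closed smult_closed pairing_closed assms
  have G: "G a1 a2 a3 b1 b2 b3 c1 c2 c3 \<in> carrier H"
    if "a1 \<in> carrier H" "a2 \<in> carrier H" "a3 \<in> carrier H" "b1 \<in> carrier H" "b2 \<in> carrier H"
      "b3 \<in> carrier H" "c1 \<in> carrier H" "c2 \<in> carrier H" "c3 \<in> carrier H"
    for a1 a2 a3 b1 b2 b3 c1 c2 c3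
    unfolding G_def using that by (intro closed)
  have left: "(\<lambda>x. star x y) \<in> linear_maps R H H" and right: "(\<lambda>x. star y x) \<in> linear_maps R H H"
    if "y \<in> carrier H" for y
    using bilinear_left[OF bilinear_star linear_id that] bilinear_right[OF bilinear_star that linear_id]
    by auto
  have "star (star a b) c = S H (\<lambda>a1 a2. S H (\<lambda>b1 b2. \<phi> b2 a1 \<odot>\<^bsub>H\<^esub> star (a2 \<otimes>\<^bsub>H\<^esub> b1) c) b) a"
    by (intro linear_star[OF left] closed)
  also have "\<dots> = S H (\<lambda>a1 a'. S H (\<lambda>b' b3. S H (\<lambda>a2 a3. S H (\<lambda>b1 b2. S H (\<lambda>c1 c'. S H (\<lambda>c2 c3.
      G a1 a2 a3 b1 b2 b3 c1 c2 c3) c') c) b') a') b) a"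
    by (rule S_cong, rule S_cong, subst mult_star)
      (auto simp: S_smult module_H closed G_def m_assoc R.m_assoc smult_assoc1[symmetric] intro!: S_cong)
  also have "\<dots> = S H (\<lambda>a1 a'. S H (\<lambda>a2 a3. S H (\<lambda>b' b3. S H (\<lambda>b1 b2. S H (\<lambda>c1 c'. S H (\<lambda>c2 c3.
      G a1 a2 a3 b1 b2 b3 c1 c2 c3) c') c) b') b) a') a"
    by (rule S_cong, rule S_swap) (assumption | intro closed G)+
  also have "\<dots> = S H (\<lambda>a1 a'. S H (\<lambda>a2 a3. S H (\<lambda>b1 b'. S H (\<lambda>b2 b3. S H (\<lambda>c1 c'. S H (\<lambda>c2 c3.
      G a1 a2 a3 b1 b2 b3 c1 c2 c3) c') c) b') b) a') a"
    by (rule S_cong, rule S_cong, rule S_coassoc) (unfold G_def, (assumption | intro lin closed)+)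
  also have "\<dots> = S H (\<lambda>b1 b'. S H (\<lambda>b2 b3. S H (\<lambda>a1 a'. S H (\<lambda>a2 a3. S H (\<lambda>c1 c'. S H (\<lambda>c2 c3.
      G a1 a2 a3 b1 b2 b3 c1 c2 c3) c') c) a') a) b') b"
    by (intro sweedler3_swap closed G)
  also have "\<dots> = S H (\<lambda>b1 b'. S H (\<lambda>b2 b3. S H (\<lambda>c1 c'. S H (\<lambda>c2 c3. S H (\<lambda>a1 a'. S H (\<lambda>a2 a3.
      G a1 a2 a3 b1 b2 b3 c1 c2 c3) a') a) c') c) b') b"
    by (rule S_cong, rule S_cong, rule sweedler3_swap) (assumption | intro closed G)+
  also have "\<dots> = S H (\<lambda>b1 b'. S H (\<lambda>b2 b3. S H (\<lambda>c' c3. S H (\<lambda>c1 c2. S H (\<lambda>a1 a'. S H (\<lambda>a2 a3.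
      G a1 a2 a3 b1 b2 b3 c1 c2 c3) a') a) c') c) b') b"
    by (rule S_cong, rule S_cong, rule S_coassoc[symmetric]) (unfold G_def, (assumption | intro lin closed)+)
  also have "\<dots> = S H (\<lambda>b1 b'. S H (\<lambda>c' c3. S H (\<lambda>b2 b3. S H (\<lambda>c1 c2. S H (\<lambda>a1 a'. S H (\<lambda>a2 a3.
      G a1 a2 a3 b1 b2 b3 c1 c2 c3) a') a) c') b') c) b"
    by (rule S_cong, rule S_swap) (assumption | intro closed G)+
  also have "\<dots> = S H (\<lambda>b1 b2. S H (\<lambda>c1 c2. \<phi> c2 b1 \<odot>\<^bsub>H\<^esub> star a (b2 \<otimes>\<^bsub>H\<^esub> c1)) c) b"
    by (rule S_cong, rule S_cong, subst star_mult)
      (auto simp: S_smult module_H closed G_def m_assoc R.m_ac smult_assoc1[symmetric] intro!: S_cong)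
  also have "\<dots> = star a (star b c)"
    by (intro linear_star[OF right, symmetric] closed)
  finally show ?thesis .
qed

lemma star_one_left:
  assumes "a \<in> carrier H"
  shows "star \<one>\<^bsub>H\<^esub> a = a"
proof -
  have "star \<one>\<^bsub>H\<^esub> a = S H (\<lambda>b1 b2. \<phi> b2 \<one>\<^bsub>H\<^esub> \<odot>\<^bsub>H\<^esub> (\<one>\<^bsub>H\<^esub> \<otimes>\<^bsub>H\<^esub> b1)) a"
    unfolding star_def by (intro S_one lin closed one_closed assms)
  also have "\<dots> = S H (\<lambda>b1 b2. counit H b2 \<odot>\<^bsub>H\<^esub> b1) a"
    by (intro S_cong assms) (simp add: pairing_one_right)
  also have "\<dots> = a" by (rule counit_right[OF assms])
  finally show ?thesis .
qed

lemma star_one_right: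
  assumes "a \<in> carrier H"
  shows "star a \<one>\<^bsub>H\<^esub> = a"
proof -
  have "star a \<one>\<^bsub>H\<^esub> = S H (\<lambda>a1 a2. \<phi> \<one>\<^bsub>H\<^esub> a1 \<odot>\<^bsub>H\<^esub> (a2 \<otimes>\<^bsub>H\<^esub> \<one>\<^bsub>H\<^esub>)) a"
    unfolding star_def by (rule S_cong, rule S_one) (assumption | intro lin closed smult_closed one_closed assms)+
  also have "\<dots> = S H (\<lambda>a1 a2. counit H a1 \<odot>\<^bsub>H\<^esub> a2) a"
    by (intro S_cong assms) (simp add: pairing_one_left)
  also have "\<dots> = a" by (rule counit_left[OF assms])
  finally show ?thesis .
qed

end

lemma iHopf_simps [simp]:
  "carrier (iHopf H \<phi>) = carrier H"
  "one (iHopf H \<phi>) = one H"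
  "ring.zero (iHopf H \<phi>) = ring.zero H"
  "add (iHopf H \<phi>) = add H"
  "smult (iHopf H \<phi>) = smult H"
  by (simp_all add: iHopf_def)

context paired_bialgebra
begin

lemma iHopf_mult: "monoid.mult (iHopf H \<phi>) = star"
  by (simp add: iHopf_def star_def fun_eq_iff)

lemma unital_algebra_iHopf: "unital_algebra R (iHopf H \<phi>)"
proof -
  have mon: "abelian_group (iHopf H \<phi>)"
    by (intro abelian_groupI) (auto simp: a_ac intro: bexI[of _ "\<ominus>\<^bsub>H\<^esub> _"] l_neg)
  note l = bilinear_left[OF bilinear_star linear_id] and r = bilinear_right[OF bilinear_star _ linear_id]
  show ?thesis
    by (intro unital_algebra.intro moduleI ringI mon monoidI unital_algebra_axioms.intro cring_R)
      (simp_all add: iHopf_mult star_assoc star_one_left star_one_right star_closed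
        smult_l_distr smult_r_distr smult_assoc1
        linear_add[OF l] linear_add[OF r] linear_smult[OF l] linear_smult[OF r])
qed

end

section \<open>Tensor products of bialgebras\<close>

text \<open>\<open>tensor_hopf\<close> and \<open>tensor_algebra\<close> are different records that
  agree in all algebra fields; the algebra laws proved for one are carried to the other by this
  lemma.\<close>

lemma unital_algebra_cong:
  assumes "unital_algebra R A"
    and "carrier B = carrier A" "monoid.mult B = monoid.mult A" "one B = one A"
      "ring.zero B = ring.zero A" "add B = add A" "smult B = smult A"
  shows "unital_algebra R B"
proof -
  interpret A: unital_algebra R A by fact
  have grp: "abelian_group B"
    by (intro abelian_groupI) (auto simp: assms A.a_ac intro: bexI[of _ "\<ominus>\<^bsub>A\<^esub> _"] A.l_neg)
  show ?thesis
    by (intro unital_algebra.intro moduleI ringI grp monoidI unital_algebra_axioms.intro A.is_cring)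
      (simp_all add: assms A.m_assoc A.l_distr A.r_distr A.smult_l_distr A.smult_r_distr
        A.smult_assoc1 A.smult_mult_left A.smult_mult_right)
qed

text \<open>The relations see the factors only through their carriers, additions and scalar
  multiplications, and through the zero of the left factor.\<close>

lemma tensor_eq_cong:
  assumes "tensor_eq R M N xs ys"
    and eqs: "carrier M' = carrier M" "ring.zero M' = ring.zero M" "add M' = add M" "smult M' = smult M"
      "carrier N' = carrier N" "add N' = add N" "smult N' = smult N"
  shows "tensor_eq R M' N' xs ys"
  using assms(1)
proof induction
  case (refl xs)
  then show ?case by (intro tensor_eq.refl) (simp add: eqs)
next
  case (commute xs ys)
  then show ?case by (intro tensor_eq.commute) (simp_all add: eqs)
next
  case (zero y)
  then show ?case using tensor_eq.zero[of y N' R M'] by (simp add: eqs)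
next
  case (add_left x x' y)
  then show ?case using tensor_eq.add_left[of x M' x' y N' R] by (simp add: eqs)
next
  case (add_right x y y')
  then show ?case using tensor_eq.add_right[of x M' y N' y' R] by (simp add: eqs)
next
  case (scalar c x y)
  then show ?case using tensor_eq.scalar[of c R x M' y N'] by (simp add: eqs)
qed (blast intro: tensor_eq.sym tensor_eq.trans tensor_eq.append)+

lemma tensor_algebra_cong:
  assumes "carrier M' = carrier M" "monoid.mult M' = monoid.mult M" "one M' = one M"
      "ring.zero M' = ring.zero M" "add M' = add M" "smult M' = smult M"
    and "carrier N' = carrier N" "monoid.mult N' = monoid.mult N" "one N' = one N"
      "ring.zero N' = ring.zero N" "add N' = add N" "smult N' = smult N"
  shows "tensor_algebra R M' N' = tensor_algebra R M N"
    and "pure_tensor R M' N' = pure_tensor R M N"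
proof -
  have "tensor_eq R M' N' = tensor_eq R M N"
    by (intro ext iffI; erule tensor_eq_cong; simp add: assms)
  then have "tensor_class R M' N' = tensor_class R M N"
    by (simp add: tensor_class_def fun_eq_iff)
  then show "tensor_algebra R M' N' = tensor_algebra R M N" "pure_tensor R M' N' = pure_tensor R M N"
    by (simp_all add: tensor_algebra_def pure_tensor_def assms fun_eq_iff)
qed

lemma tensor_hopf_simps:
  "carrier (tensor_hopf R H K) = carrier (tensor_algebra R H K)"
  "monoid.mult (tensor_hopf R H K) = monoid.mult (tensor_algebra R H K)"
  "one (tensor_hopf R H K) = one (tensor_algebra R H K)"
  "ring.zero (tensor_hopf R H K) = ring.zero (tensor_algebra R H K)"
  "add (tensor_hopf R H K) = add (tensor_algebra R H K)"
  "smult (tensor_hopf R H K) = smult (tensor_algebra R H K)"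
  "counit (tensor_hopf R H K) = tensor_sum R (\<lambda>c d. counit H c \<otimes>\<^bsub>R\<^esub> counit K d)"
  by (simp_all add: tensor_hopf_def Let_def)

text \<open>The coproduct of \<open>tensor_hopf\<close> is defined with values in the tensor square
  of \<open>tensor_algebra R H K\<close>, whereas the bialgebra axioms speak of the square of
  \<open>tensor_hopf\<close> itself. The two squares are equal.\<close>

lemma tensor_algebra_tensor_hopf:
  "tensor_algebra R (tensor_hopf R H K) (tensor_hopf R H K) =
    tensor_algebra R (tensor_algebra R H K) (tensor_algebra R H K)"
  "pure_tensor R (tensor_hopf R H K) (tensor_hopf R H K) =
    pure_tensor R (tensor_algebra R H K) (tensor_algebra R H K)"
  by (rule tensor_algebra_cong; simp add: tensor_hopf_simps)+

lemma linear_maps_tensor_hopf: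
  "linear_maps R (tensor_hopf R H K) P = linear_maps R (tensor_algebra R H K) P"
  "linear_maps R P (tensor_hopf R H K) = linear_maps R P (tensor_algebra R H K)"
  by (simp_all add: linear_maps_def tensor_hopf_simps)

lemma S_swap_mixed:
  assumes "comultiplication R H" "comultiplication R K" "module R P" "a \<in> carrier H" "b \<in> carrier K"
    and "\<And>x y u v. \<lbrakk>x \<in> carrier H; y \<in> carrier H; u \<in> carrier K; v \<in> carrier K\<rbrakk>
      \<Longrightarrow> f x y u v \<in> carrier P"
  shows "sweedler2 H P (\<lambda>x y. sweedler2 K P (\<lambda>u v. f x y u v) b) a =
    sweedler2 K P (\<lambda>u v. sweedler2 H P (\<lambda>x y. f x y u v) a) b"
proof -
  interpret H: comultiplication R H by fact
  interpret K: comultiplication R K by fact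
  show ?thesis
    unfolding sweedler2_def
    by (intro tensor_sum_swap[OF H.module_H H.module_H K.module_H K.module_H] H.comult_closed
        K.comult_closed assms)
qed

text \<open>Two distinct factors keep the legs of the left and of the right factor apart by their
  types. The diagonal case is the instance \<open>D\<close> with both factors equal to H.\<close>

locale bialgebra_product = H: bialgebra R H + K: bialgebra R K
  for R :: "('f, 'm) ring_scheme"
    and H :: "('f, 'h, 'x) hopf_scheme" and K :: "('f, 'k, 'y) hopf_scheme"
begin

abbreviation T where "T \<equiv> tensor_hopf R H K"
abbreviation TT where "TT \<equiv> tensor_algebra R T T"
abbreviation pr where "pr \<equiv> pure_tensor R H K"

lemma unital_algebra_T: "unital_algebra R T"
  by (rule unital_algebra_cong[OF unital_algebra_tensor_algebra[OF H.unital_algebra_H K.unital_algebra_H]])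
    (simp_all add: tensor_hopf_simps)

lemma module_T: "module R T"
  by (rule unital_algebra.axioms(1)[OF unital_algebra_T])

lemmas module_TT = module_tensor_algebra[OF module_T module_T]

lemma bilinear_pr: "pr \<in> bilinear_maps R H K T"
  using bilinear_pure_tensor[OF H.module_H K.module_H]
  by (simp add: bilinear_maps_def linear_maps_tensor_hopf)

lemma pr_closed: "\<lbrakk>x \<in> carrier H; y \<in> carrier K\<rbrakk> \<Longrightarrow> pr x y \<in> carrier T"
  by (rule bilinear_closed[OF bilinear_pr])

lemma pr_mult:
  "\<lbrakk>x \<in> carrier H; x' \<in> carrier H; y \<in> carrier K; y' \<in> carrier K\<rbrakk>
    \<Longrightarrow> pr x y \<otimes>\<^bsub>T\<^esub> pr x' y' = pr (x \<otimes>\<^bsub>H\<^esub> x') (y \<otimes>\<^bsub>K\<^esub> y')"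
  using pure_tensor_mult[OF H.unital_algebra_H K.unital_algebra_H] by (simp add: tensor_hopf_simps)

lemma one_T: "\<one>\<^bsub>T\<^esub> = pr \<one>\<^bsub>H\<^esub> \<one>\<^bsub>K\<^esub>"
  by (simp add: tensor_hopf_simps tensor_algebra_simps)

lemma linear_T_ext:
  assumes "module R P" "h \<in> linear_maps R T P" "k \<in> linear_maps R T P" "X \<in> carrier T"
    and "\<And>x y. \<lbrakk>x \<in> carrier H; y \<in> carrier K\<rbrakk> \<Longrightarrow> h (pr x y) = k (pr x y)"
  shows "h X = k X"
  using assms by (intro linear_tensor_ext[OF H.module_H K.module_H assms(1), of h k X])
    (simp_all add: linear_maps_tensor_hopf tensor_hopf_simps)

lemmas bilinear_T_pure = bilinear_pure_tensor[OF module_T module_T]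

lemmas lin = linear_id
  bilinear_left[OF bilinear_pr] bilinear_right[OF bilinear_pr]
  bilinear_left[OF bilinear_T_pure] bilinear_right[OF bilinear_T_pure]
  bilinear_left[OF bilinear_mult[OF H.unital_algebra_H]]
  bilinear_right[OF bilinear_mult[OF H.unital_algebra_H]]
  bilinear_left[OF bilinear_mult[OF K.unital_algebra_H]]
  bilinear_right[OF bilinear_mult[OF K.unital_algebra_H]]
  bilinear_left[OF bilinear_mult[OF unital_algebra_T]]
  bilinear_right[OF bilinear_mult[OF unital_algebra_T]]
  H.linear_S K.linear_S H.linear_S_inner K.linear_S_inner

lemmas closed = pr_closed pure_tensor_closed H.m_closed K.m_closed H.S_closed K.S_closed
  H.module_H K.module_H module_T module_TT

lemmas swap = S_swap_mixed[OF H.comultiplication_axioms K.comultiplication_axioms]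

lemma comult_T:
  "comult T = tensor_sum TT (\<lambda>c d. sweedler2 H TT (\<lambda>c1 c2. sweedler2 K TT (\<lambda>d1 d2.
    pure_tensor R T T (pr c1 d1) (pr c2 d2)) d) c)"
  unfolding tensor_algebra_tensor_hopf by (simp add: tensor_hopf_def Let_def)

lemma bilinear_comult_T:
  "(\<lambda>c d. sweedler2 H TT (\<lambda>c1 c2. sweedler2 K TT (\<lambda>d1 d2.
    pure_tensor R T T (pr c1 d1) (pr c2 d2)) d) c) \<in> bilinear_maps R H K TT"
  by (rule bilinear_mapsI) (assumption | intro lin closed)+

lemma comult_pr:
  assumes "c \<in> carrier H" "d \<in> carrier K"
  shows "comult T (pr c d) = sweedler2 H TT (\<lambda>c1 c2. sweedler2 K TT (\<lambda>d1 d2.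
    pure_tensor R T T (pr c1 d1) (pr c2 d2)) d) c"
  unfolding comult_T
  by (rule tensor_sum_pure_tensor[OF H.module_H K.module_H module_TT bilinear_comult_T assms])

sublocale T: comultiplication R T
proof (intro comultiplication.intro module_T comultiplication_axioms.intro)
  show "comult T \<in> linear_maps R T TT"
    unfolding comult_T linear_maps_tensor_hopf
    by (rule linear_tensor_sum[OF H.module_H K.module_H module_TT bilinear_comult_T])
qed

text \<open>Together with \<open>linear_T_ext\<close> this reduces identities on the tensor product
  to double sums over H and K.\<close>

lemma S_pr:
  assumes "module R P" "c \<in> carrier H" "d \<in> carrier K"
    and l: "\<And>y. y \<in> carrier T \<Longrightarrow> (\<lambda>x. f x y) \<in> linear_maps R T P"
      "\<And>x. x \<in> carrier T \<Longrightarrow> (\<lambda>y. f x y) \<in> linear_maps R T P"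
  shows "T.S P f (pr c d) =
    sweedler2 H P (\<lambda>c1 c2. sweedler2 K P (\<lambda>d1 d2. f (pr c1 d1) (pr c2 d2)) d) c"
proof -
  have bil: "f \<in> bilinear_maps R T T P" by (intro bilinear_mapsI l)
  note f = linear_tensor_sum[OF module_T module_T assms(1) bil]
  have "T.S P f (pr c d) = tensor_sum P f (sweedler2 H TT (\<lambda>c1 c2. sweedler2 K TT (\<lambda>d1 d2.
      pure_tensor R T T (pr c1 d1) (pr c2 d2)) d) c)"
    by (simp add: sweedler2_def[of T] comult_pr assms)
  also have "\<dots> = sweedler2 H P (\<lambda>c1 c2. tensor_sum P f (sweedler2 K TT (\<lambda>d1 d2.
      pure_tensor R T T (pr c1 d1) (pr c2 d2)) d)) c"
    by (intro H.linear_commutes_S[OF f] closed assms)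
  also have "\<dots> = sweedler2 H P (\<lambda>c1 c2. sweedler2 K P (\<lambda>d1 d2. tensor_sum P f
      (pure_tensor R T T (pr c1 d1) (pr c2 d2))) d) c"
    by (rule H.S_cong, rule K.linear_commutes_S[OF f]) (assumption | intro closed assms)+
  also have "\<dots> = sweedler2 H P (\<lambda>c1 c2. sweedler2 K P (\<lambda>d1 d2. f (pr c1 d1) (pr c2 d2)) d) c"
    by (rule H.S_cong, rule K.S_cong, rule tensor_sum_pure_tensor[OF module_T module_T assms(1) bil])
      (assumption | intro closed assms)+
  finally show ?thesis .
qed

text \<open>Both sides are bilinear, so pure tensors suffice. There \<open>S_mult\<close> yields the
  sums in the order c, c', d, d', while the product in \<open>TT\<close> requires c, d, c', d';
  exchanging the middle two is the whole difference.\<close>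

lemma comult_T_mult:
  assumes "X \<in> carrier T" "Y \<in> carrier T"
  shows "comult T (X \<otimes>\<^bsub>T\<^esub> Y) = comult T X \<otimes>\<^bsub>TT\<^esub> comult T Y"
proof -
  note uTT = unital_algebra_tensor_algebra[OF unital_algebra_T unital_algebra_T]
  note mTT = bilinear_mult[OF uTT]
  note lin = lin bilinear_left[OF mTT] bilinear_right[OF mTT]
    linear_comp[OF T.linear_comult]
  note closed = closed T.comult_closed bilinear_closed[OF mTT] unital_algebra.axioms(2)[OF unital_algebra_T]
  have pure: "comult T (pr c d \<otimes>\<^bsub>T\<^esub> pr c' d') = comult T (pr c d) \<otimes>\<^bsub>TT\<^esub> comult T (pr c' d')"
    if [simp]: "c \<in> carrier H" "d \<in> carrier K" "c' \<in> carrier H" "d' \<in> carrier K" for c d c' d'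
  proof -
    note closed = closed that
    let ?q = "\<lambda>c1 c2 d1 d2. pure_tensor R T T (pr c1 d1) (pr c2 d2)"
    have "comult T (pr c d \<otimes>\<^bsub>T\<^esub> pr c' d') = sweedler2 H TT (\<lambda>c1 c2. sweedler2 K TT (\<lambda>d1 d2.
        ?q c1 c2 d1 d2) (d \<otimes>\<^bsub>K\<^esub> d')) (c \<otimes>\<^bsub>H\<^esub> c')"
      by (simp add: pr_mult comult_pr)
    also have "\<dots> = sweedler2 H TT (\<lambda>c1 c2. sweedler2 H TT (\<lambda>c1' c2'. sweedler2 K TT (\<lambda>d1 d2.
        ?q (c1 \<otimes>\<^bsub>H\<^esub> c1') (c2 \<otimes>\<^bsub>H\<^esub> c2') d1 d2) (d \<otimes>\<^bsub>K\<^esub> d')) c') c"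
      by (rule H.S_mult) (assumption | intro lin closed)+
    also have "\<dots> = sweedler2 H TT (\<lambda>c1 c2. sweedler2 H TT (\<lambda>c1' c2'. sweedler2 K TT (\<lambda>d1 d2.
        sweedler2 K TT (\<lambda>d1' d2'.
          ?q (c1 \<otimes>\<^bsub>H\<^esub> c1') (c2 \<otimes>\<^bsub>H\<^esub> c2') (d1 \<otimes>\<^bsub>K\<^esub> d1') (d2 \<otimes>\<^bsub>K\<^esub> d2')) d') d) c') c"
      by (rule H.S_cong, rule H.S_cong, rule K.S_mult) (assumption | intro lin closed)+
    also have "\<dots> = sweedler2 H TT (\<lambda>c1 c2. sweedler2 K TT (\<lambda>d1 d2. sweedler2 H TT (\<lambda>c1' c2'.
        sweedler2 K TT (\<lambda>d1' d2'.
          ?q (c1 \<otimes>\<^bsub>H\<^esub> c1') (c2 \<otimes>\<^bsub>H\<^esub> c2') (d1 \<otimes>\<^bsub>K\<^esub> d1') (d2 \<otimes>\<^bsub>K\<^esub> d2')) d') c') d) c"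
      by (rule H.S_cong, rule swap)
        (assumption | intro closed)+
    also have "\<dots> = sweedler2 H TT (\<lambda>c1 c2. sweedler2 K TT (\<lambda>d1 d2. sweedler2 H TT (\<lambda>c1' c2'.
        sweedler2 K TT (\<lambda>d1' d2'. ?q c1 c2 d1 d2 \<otimes>\<^bsub>TT\<^esub> ?q c1' c2' d1' d2') d') c') d) c"
      by (intro H.S_cong K.S_cong closed)
        (simp add: pure_tensor_mult[OF unital_algebra_T unital_algebra_T] closed pr_mult)
    also have "\<dots> = sweedler2 H TT (\<lambda>c1 c2. sweedler2 K TT (\<lambda>d1 d2. sweedler2 H TT (\<lambda>c1' c2'.
        ?q c1 c2 d1 d2 \<otimes>\<^bsub>TT\<^esub> sweedler2 K TT (\<lambda>d1' d2'. ?q c1' c2' d1' d2') d') c') d) c"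
      by (rule H.S_cong, rule K.S_cong, rule H.S_cong, rule K.linear_commutes_S[symmetric])
        (assumption | intro lin closed)+
    also have "\<dots> = sweedler2 H TT (\<lambda>c1 c2. sweedler2 K TT (\<lambda>d1 d2.
        ?q c1 c2 d1 d2 \<otimes>\<^bsub>TT\<^esub> comult T (pr c' d')) d) c"
      unfolding comult_pr[OF that(3,4)]
      by (rule H.S_cong, rule K.S_cong, rule H.linear_commutes_S[symmetric])
        (assumption | intro lin closed)+
    also have "\<dots> = sweedler2 H TT (\<lambda>c1 c2. sweedler2 K TT (\<lambda>d1 d2.
        ?q c1 c2 d1 d2) d \<otimes>\<^bsub>TT\<^esub> comult T (pr c' d')) c"
      by (rule H.S_cong, rule K.linear_commutes_S[symmetric])
        (assumption | intro lin closed)+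
    also have "\<dots> = comult T (pr c d) \<otimes>\<^bsub>TT\<^esub> comult T (pr c' d')"
      unfolding comult_pr[OF that(1,2)]
      by (rule H.linear_commutes_S[symmetric]) (assumption | intro lin closed)+
    finally show ?thesis .
  qed
  note closed = closed bilinear_closed[OF bilinear_mult[OF unital_algebra_T]] assms
  show ?thesis
  proof (rule linear_T_ext[OF module_TT _ _ assms(1)])
    fix c d assume cd: "c \<in> carrier H" "d \<in> carrier K"
    show "comult T (pr c d \<otimes>\<^bsub>T\<^esub> Y) = comult T (pr c d) \<otimes>\<^bsub>TT\<^esub> comult T Y"
      by (rule linear_T_ext[OF module_TT _ _ assms(2)]) (assumption | intro lin closed cd pure)+
  qed (assumption | intro lin closed)+
qed

text \<open>On pure tensors each axiom separates, after a reordering of the mixed sums, into the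
  same axiom for H and for K.\<close>

sublocale T: bialgebra R T
proof -
  have eps: "(\<lambda>c d. counit H c \<otimes>\<^bsub>R\<^esub> counit K d) \<in> bilinear_maps R H K (regular_module R)"
    by (rule bilinear_mapsI)
      (assumption | intro bilinear_left[OF bilinear_mult_scalar[OF H.cring_R]]
        bilinear_right[OF bilinear_mult_scalar[OF H.cring_R], unfolded regular_module_simps(1)]
        linear_comp[OF H.linear_counit] linear_comp[OF K.linear_counit] linear_id
        H.counit_closed K.counit_closed | simp add: H.counit_closed K.counit_closed)+
  have counit: "counit T = tensor_sum (regular_module R) (\<lambda>c d. counit H c \<otimes>\<^bsub>R\<^esub> counit K d)"
    by (simp add: tensor_hopf_simps tensor_sum_def fun_eq_iff)
  have counit_pr: "counit T (pr c d) = counit H c \<otimes>\<^bsub>R\<^esub> counit K d"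
    if "c \<in> carrier H" "d \<in> carrier K" for c d
    unfolding counit
    by (rule tensor_sum_pure_tensor[OF H.module_H K.module_H H.module_scalars eps that])
  have linear_counit: "counit T \<in> linear_maps R T (regular_module R)"
    unfolding counit linear_maps_tensor_hopf
    by (rule linear_tensor_sum[OF H.module_H K.module_H H.module_scalars eps])
  have counit_closed: "counit T X \<in> carrier R" if "X \<in> carrier T" for X
    using linear_closed[OF linear_counit that] by simp
  note lin = lin linear_comp[OF linear_counit] T.linear_S T.linear_S_inner
    bilinear_left[OF bilinear_mult_scalar[OF H.cring_R], unfolded regular_module_simps(1)]
    bilinear_right[OF bilinear_mult_scalar[OF H.cring_R], unfolded regular_module_simps(1)]
    bilinear_left[OF bilinear_smult] bilinear_right[OF bilinear_smult, unfolded regular_module_simps(1)]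
    linear_comp[OF T.linear_comult] linear_comp[OF H.linear_counit] linear_comp[OF K.linear_counit]
  note closed = closed T.S_closed H.module_scalars T.comult_closed
    bilinear_closed[OF bilinear_mult[OF unital_algebra_T]] counit_closed H.counit_closed K.counit_closed
  have counit_mult: "counit T (X \<otimes>\<^bsub>T\<^esub> Y) = counit T X \<otimes>\<^bsub>R\<^esub> counit T Y"
    if XY: "X \<in> carrier T" "Y \<in> carrier T" for X Y
  proof (rule linear_T_ext[OF H.module_scalars _ _ XY(1)])
    fix c d assume cd: "c \<in> carrier H" "d \<in> carrier K"
    show "counit T (pr c d \<otimes>\<^bsub>T\<^esub> Y) = counit T (pr c d) \<otimes>\<^bsub>R\<^esub> counit T Y"
    proof (rule linear_T_ext[OF H.module_scalars _ _ XY(2)])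
      fix c' d' assume "c' \<in> carrier H" "d' \<in> carrier K"
      with cd show "counit T (pr c d \<otimes>\<^bsub>T\<^esub> pr c' d') = counit T (pr c d) \<otimes>\<^bsub>R\<^esub> counit T (pr c' d')"
        by (simp add: pr_mult counit_pr H.counit_mult K.counit_mult H.counit_closed K.counit_closed
            H.R.m_ac)
    qed (assumption | intro lin closed XY cd)+
  qed (assumption | intro lin closed XY)+
  have one: "\<one>\<^bsub>T\<^esub> = pr \<one>\<^bsub>H\<^esub> \<one>\<^bsub>K\<^esub>" by (rule one_T)
  show "bialgebra R T"
  proof (intro bialgebra.intro unital_algebra_T bialgebra_axioms.intro)
    have "comult T (pr \<one>\<^bsub>H\<^esub> \<one>\<^bsub>K\<^esub>) = sweedler2 H TT (\<lambda>c1 c2.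
        pure_tensor R T T (pr c1 \<one>\<^bsub>K\<^esub>) (pr c2 \<one>\<^bsub>K\<^esub>)) \<one>\<^bsub>H\<^esub>"
      unfolding comult_pr[OF H.one_closed K.one_closed]
      by (rule H.S_cong, rule K.S_one) (assumption | intro lin closed H.one_closed)+
    also have "\<dots> = pure_tensor R T T \<one>\<^bsub>T\<^esub> \<one>\<^bsub>T\<^esub>"
      unfolding one by (rule H.S_one) (assumption | intro lin closed K.one_closed)+
    finally have "comult T \<one>\<^bsub>T\<^esub> = pure_tensor R T T \<one>\<^bsub>T\<^esub> \<one>\<^bsub>T\<^esub>"
      by (simp only: one)
    then show "comult T \<in> unital_algebra_homs R T TT"
      using T.linear_comult comult_T_mult
      by (simp add: unital_algebra_homs_def algebra_homs_def tensor_algebra_simps)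
    show "counit T \<in> unital_algebra_homs R T (regular_module R)"
      using linear_counit counit_mult
      by (simp add: unital_algebra_homs_def algebra_homs_def one counit_pr H.counit_one K.counit_one)
    fix X assume X: "X \<in> carrier T"
    show "T.S T (\<lambda>a1 a2. counit T a1 \<odot>\<^bsub>T\<^esub> a2) X = X"
    proof (rule linear_T_ext[OF module_T _ linear_id X])
      fix c d assume cd: "c \<in> carrier H" "d \<in> carrier K"
      have "T.S T (\<lambda>a1 a2. counit T a1 \<odot>\<^bsub>T\<^esub> a2) (pr c d) =
        sweedler2 H T (\<lambda>c1 c2. sweedler2 K T (\<lambda>d1 d2. counit T (pr c1 d1) \<odot>\<^bsub>T\<^esub> pr c2 d2) d) c"
        by (rule S_pr) (assumption | intro lin closed cd)+
      \<comment> \<open>The counit of d1 is placed outermost, so that the inner sum over d collapses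
        first and leaves a counit sum over c.\<close>
      also have "\<dots> = sweedler2 H T (\<lambda>c1 c2. sweedler2 K T (\<lambda>d1 d2. counit K d1 \<odot>\<^bsub>T\<^esub>
          (counit H c1 \<odot>\<^bsub>T\<^esub> pr c2 d2)) d) c"
        by (intro H.S_cong K.S_cong cd)
          (simp add: counit_pr closed T.smult_assoc1[symmetric] H.R.m_comm)
      also have "\<dots> = sweedler2 H T (\<lambda>c1 c2. counit H c1 \<odot>\<^bsub>T\<^esub> pr c2 d) c"
        by (rule H.S_cong, rule K.S_counit_left) (assumption | intro lin closed cd)+
      also have "\<dots> = pr c d"
        by (rule H.S_counit_left) (assumption | intro lin closed cd)+
      finally show "T.S T (\<lambda>a1 a2. counit T a1 \<odot>\<^bsub>T\<^esub> a2) (pr c d) = pr c d" .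
    qed (assumption | intro lin closed)+
    show "T.S T (\<lambda>a1 a2. counit T a2 \<odot>\<^bsub>T\<^esub> a1) X = X"
    proof (rule linear_T_ext[OF module_T _ linear_id X])
      fix c d assume cd: "c \<in> carrier H" "d \<in> carrier K"
      have "T.S T (\<lambda>a1 a2. counit T a2 \<odot>\<^bsub>T\<^esub> a1) (pr c d) =
        sweedler2 H T (\<lambda>c1 c2. sweedler2 K T (\<lambda>d1 d2. counit T (pr c2 d2) \<odot>\<^bsub>T\<^esub> pr c1 d1) d) c"
        by (rule S_pr) (assumption | intro lin closed cd)+
      also have "\<dots> = sweedler2 H T (\<lambda>c1 c2. sweedler2 K T (\<lambda>d1 d2. counit K d2 \<odot>\<^bsub>T\<^esub>
          (counit H c2 \<odot>\<^bsub>T\<^esub> pr c1 d1)) d) c"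
        by (intro H.S_cong K.S_cong cd)
          (simp add: counit_pr closed T.smult_assoc1[symmetric] H.R.m_comm)
      also have "\<dots> = sweedler2 H T (\<lambda>c1 c2. counit H c2 \<odot>\<^bsub>T\<^esub> pr c1 d) c"
        by (rule H.S_cong, rule K.S_counit_right) (assumption | intro lin closed cd)+
      also have "\<dots> = pr c d"
        by (rule H.S_counit_right) (assumption | intro lin closed cd)+
      finally show "T.S T (\<lambda>a1 a2. counit T a2 \<odot>\<^bsub>T\<^esub> a1) (pr c d) = pr c d" .
    qed (assumption | intro lin closed)+
    let ?T3 = "tensor_algebra R T TT"
    note m3 = module_tensor_algebra[OF module_T module_TT]
    note bil3 = bilinear_pure_tensor[OF module_T module_TT]
    note lin = lin bilinear_left[OF bil3] bilinear_right[OF bil3]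
    note closed = closed m3
    let ?q = "\<lambda>x y z. pure_tensor R T TT x (pure_tensor R T T y z)"
    show "T.S ?T3 (\<lambda>x z. T.S ?T3 (\<lambda>u v. ?q u v z) x) X =
      T.S ?T3 (\<lambda>x y. pure_tensor R T TT x (comult T y)) X"
    proof (rule linear_T_ext[OF m3 _ _ X])
      fix c d assume cd: "c \<in> carrier H" "d \<in> carrier K"
      note closed = closed cd
      let ?p = "\<lambda>c1 c2 c3 d1 d2 d3. ?q (pr c1 d1) (pr c2 d2) (pr c3 d3)"
      have "T.S ?T3 (\<lambda>x z. T.S ?T3 (\<lambda>u v. ?q u v z) x) (pr c d) =
        sweedler2 H ?T3 (\<lambda>c' c3. sweedler2 K ?T3 (\<lambda>d' d3.
          T.S ?T3 (\<lambda>u v. ?q u v (pr c3 d3)) (pr c' d')) d) c"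
        by (rule S_pr) (assumption | intro lin closed)+
      also have "\<dots> = sweedler2 H ?T3 (\<lambda>c' c3. sweedler2 K ?T3 (\<lambda>d' d3.
          sweedler2 H ?T3 (\<lambda>c1 c2. sweedler2 K ?T3 (\<lambda>d1 d2. ?p c1 c2 c3 d1 d2 d3) d') c') d) c"
        by (rule H.S_cong, rule K.S_cong, rule S_pr) (assumption | intro lin closed)+
      \<comment> \<open>With both sums over legs of c outside and both over legs of d inside,
        coassociativity of K and then that of H can be applied separately. A second exchange
        restores the mixed order.\<close>
      also have "\<dots> = sweedler2 H ?T3 (\<lambda>c' c3. sweedler2 H ?T3 (\<lambda>c1 c2.
          sweedler2 K ?T3 (\<lambda>d' d3. sweedler2 K ?T3 (\<lambda>d1 d2. ?p c1 c2 c3 d1 d2 d3) d') d) c') c"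
        by (rule H.S_cong, rule swap[symmetric])
          (assumption | intro closed)+
      also have "\<dots> = sweedler2 H ?T3 (\<lambda>c' c3. sweedler2 H ?T3 (\<lambda>c1 c2.
          sweedler2 K ?T3 (\<lambda>d1 d'. sweedler2 K ?T3 (\<lambda>d2 d3. ?p c1 c2 c3 d1 d2 d3) d') d) c') c"
        by (rule H.S_cong, rule H.S_cong, rule K.S_coassoc) (assumption | intro lin closed)+
      also have "\<dots> = sweedler2 H ?T3 (\<lambda>c1 c'. sweedler2 H ?T3 (\<lambda>c2 c3.
          sweedler2 K ?T3 (\<lambda>d1 d'. sweedler2 K ?T3 (\<lambda>d2 d3. ?p c1 c2 c3 d1 d2 d3) d') d) c') c"
        by (rule H.S_coassoc) (assumption | intro lin closed)+
      also have "\<dots> = sweedler2 H ?T3 (\<lambda>c1 c'. sweedler2 K ?T3 (\<lambda>d1 d'.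
          sweedler2 H ?T3 (\<lambda>c2 c3. sweedler2 K ?T3 (\<lambda>d2 d3. ?p c1 c2 c3 d1 d2 d3) d') c') d) c"
        by (rule H.S_cong, rule swap)
          (assumption | intro closed)+
      also have "\<dots> = sweedler2 H ?T3 (\<lambda>c1 c'. sweedler2 K ?T3 (\<lambda>d1 d'.
          sweedler2 H ?T3 (\<lambda>c2 c3. pure_tensor R T TT (pr c1 d1) (sweedler2 K TT (\<lambda>d2 d3.
            pure_tensor R T T (pr c2 d2) (pr c3 d3)) d')) c') d) c"
        by (rule H.S_cong, rule K.S_cong, rule H.S_cong, rule K.linear_commutes_S[symmetric])
          (assumption | intro lin closed)+
      also have "\<dots> = sweedler2 H ?T3 (\<lambda>c1 c'. sweedler2 K ?T3 (\<lambda>d1 d'.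
          pure_tensor R T TT (pr c1 d1) (comult T (pr c' d'))) d) c"
        by (rule H.S_cong, rule K.S_cong, subst comult_pr, assumption, assumption,
            rule H.linear_commutes_S[symmetric])
          (assumption | intro lin closed)+
      also have "\<dots> = T.S ?T3 (\<lambda>x y. pure_tensor R T TT x (comult T y)) (pr c d)"
        by (rule S_pr[symmetric]) (assumption | intro lin closed)+
      finally show "T.S ?T3 (\<lambda>x z. T.S ?T3 (\<lambda>u v. ?q u v z) x) (pr c d) =
        T.S ?T3 (\<lambda>x y. pure_tensor R T TT x (comult T y)) (pr c d)" .
    qed (assumption | intro lin closed)+
  qed
qed

end

section \<open>Rearranging iterated coproducts\<close>

context comultiplication
begin

text \<open>The digits in the name count the nested sums exchanged. The inner sum comultiplies the
  leg a' produced by the outer one, so these two have to move as a block.\<close>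

lemma S_swap12:
  assumes "module R P" "a \<in> carrier H" "b \<in> carrier H"
    and f: "\<And>x y z u v. \<lbrakk>x \<in> carrier H; y \<in> carrier H; z \<in> carrier H; u \<in> carrier H; v \<in> carrier H\<rbrakk>
      \<Longrightarrow> f x y z u v \<in> carrier P"
  shows "S P (\<lambda>u v. S P (\<lambda>x a'. S P (\<lambda>y z. f x y z u v) a') a) b =
    S P (\<lambda>x a'. S P (\<lambda>y z. S P (\<lambda>u v. f x y z u v) b) a') a"
proof -
  have "S P (\<lambda>u v. S P (\<lambda>x a'. S P (\<lambda>y z. f x y z u v) a') a) b =
    S P (\<lambda>x a'. S P (\<lambda>u v. S P (\<lambda>y z. f x y z u v) a') b) a"
    by (rule S_swap) (assumption | intro S_closed assms)+
  also have "\<dots> = S P (\<lambda>x a'. S P (\<lambda>y z. S P (\<lambda>u v. f x y z u v) b) a') a"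
    by (rule S_cong, rule S_swap) (assumption | intro S_closed assms)+
  finally show ?thesis .
qed

lemma S_swap22:
  assumes "module R P" "a \<in> carrier H" "p \<in> carrier H" "q \<in> carrier H"
    and f: "\<And>x y z u v s t. \<lbrakk>x \<in> carrier H; y \<in> carrier H; z \<in> carrier H; u \<in> carrier H;
      v \<in> carrier H; s \<in> carrier H; t \<in> carrier H\<rbrakk> \<Longrightarrow> f x y z u v s t \<in> carrier P"
  shows "S P (\<lambda>x a'. S P (\<lambda>y z. S P (\<lambda>u v. S P (\<lambda>s t. f x y z u v s t) q) p) a') a =
    S P (\<lambda>u v. S P (\<lambda>s t. S P (\<lambda>x a'. S P (\<lambda>y z. f x y z u v s t) a') a) q) p"
proof -
  have "S P (\<lambda>x a'. S P (\<lambda>y z. S P (\<lambda>u v. S P (\<lambda>s t. f x y z u v s t) q) p) a') a =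
    S P (\<lambda>u v. S P (\<lambda>x a'. S P (\<lambda>y z. S P (\<lambda>s t. f x y z u v s t) q) a') a) p"
    by (rule S_swap12[symmetric]) (assumption | intro S_closed assms)+
  also have "\<dots> = S P (\<lambda>u v. S P (\<lambda>s t. S P (\<lambda>x a'. S P (\<lambda>y z. f x y z u v s t) a') a) q) p"
    by (rule S_cong, rule S_swap12[symmetric]) (assumption | intro S_closed assms)+
  finally show ?thesis .
qed

end

context bialgebra
begin

text \<open>This rule and the next two bring the bracketings that occur below to the one nested to
  the right. This one serves three legs whose first and third are comultiplied again, as happens
  when products are multiplied out.\<close>

lemma S5_outer:
  assumes P: "module R P" and a: "a \<in> carrier H"
    and g: "\<And>a2 a3 a4 a5. \<lbrakk>a2 \<in> carrier H; a3 \<in> carrier H; a4 \<in> carrier H; a5 \<in> carrier H\<rbrakk>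
        \<Longrightarrow> (\<lambda>x. g x a2 a3 a4 a5) \<in> linear_maps R H P"
      "\<And>a1 a3 a4 a5. \<lbrakk>a1 \<in> carrier H; a3 \<in> carrier H; a4 \<in> carrier H; a5 \<in> carrier H\<rbrakk>
        \<Longrightarrow> (\<lambda>x. g a1 x a3 a4 a5) \<in> linear_maps R H P"
      "\<And>a1 a2 a4 a5. \<lbrakk>a1 \<in> carrier H; a2 \<in> carrier H; a4 \<in> carrier H; a5 \<in> carrier H\<rbrakk>
        \<Longrightarrow> (\<lambda>x. g a1 a2 x a4 a5) \<in> linear_maps R H P"
      "\<And>a1 a2 a3 a5. \<lbrakk>a1 \<in> carrier H; a2 \<in> carrier H; a3 \<in> carrier H; a5 \<in> carrier H\<rbrakk>
        \<Longrightarrow> (\<lambda>x. g a1 a2 a3 x a5) \<in> linear_maps R H P"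
      "\<And>a1 a2 a3 a4. \<lbrakk>a1 \<in> carrier H; a2 \<in> carrier H; a3 \<in> carrier H; a4 \<in> carrier H\<rbrakk>
        \<Longrightarrow> (\<lambda>x. g a1 a2 a3 a4 x) \<in> linear_maps R H P"
  shows "S P (\<lambda>a1 a'. S P (\<lambda>a2 a3. S P (\<lambda>u v. S P (\<lambda>s t. g s t a2 u v) a1) a3) a') a =
    S P (\<lambda>a1 c. S P (\<lambda>a2 c. S P (\<lambda>a3 c. S P (\<lambda>a4 a5. g a1 a2 a3 a4 a5) c) c) c) a"
proof -
  have gc: "g a1 a2 a3 a4 a5 \<in> carrier P"
    if "a1 \<in> carrier H" "a2 \<in> carrier H" "a3 \<in> carrier H" "a4 \<in> carrier H" "a5 \<in> carrier H"
    for a1 a2 a3 a4 a5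
    using that by (intro linear_closed[OF g(1)])
  note rules = P a S_closed gc linear_id linear_S linear_S_inner module_H g
  have "S P (\<lambda>a1 a'. S P (\<lambda>a2 a3. S P (\<lambda>u v. S P (\<lambda>s t. g s t a2 u v) a1) a3) a') a =
    S P (\<lambda>a1 a'. S P (\<lambda>s t. S P (\<lambda>a2 a3. S P (\<lambda>u v. g s t a2 u v) a3) a') a1) a"
    by (rule S_cong, rule S_swap12[symmetric]) (assumption | intro rules)+
  also have "\<dots> = S P (\<lambda>s a'. S P (\<lambda>t a'. S P (\<lambda>a2 a3. S P (\<lambda>u v. g s t a2 u v) a3) a') a') a"
    by (rule S_coassoc) (assumption | intro rules)+
  finally show ?thesis .
qed

text \<open>The last leg is split off first, for a pairing outside; of the three legs of the
  remainder the middle one is comultiplied again.\<close>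

lemma S5_left:
  assumes P: "module R P" and a: "a \<in> carrier H"
    and g: "\<And>a2 a3 a4 a5. \<lbrakk>a2 \<in> carrier H; a3 \<in> carrier H; a4 \<in> carrier H; a5 \<in> carrier H\<rbrakk>
        \<Longrightarrow> (\<lambda>x. g x a2 a3 a4 a5) \<in> linear_maps R H P"
      "\<And>a1 a3 a4 a5. \<lbrakk>a1 \<in> carrier H; a3 \<in> carrier H; a4 \<in> carrier H; a5 \<in> carrier H\<rbrakk>
        \<Longrightarrow> (\<lambda>x. g a1 x a3 a4 a5) \<in> linear_maps R H P"
      "\<And>a1 a2 a4 a5. \<lbrakk>a1 \<in> carrier H; a2 \<in> carrier H; a4 \<in> carrier H; a5 \<in> carrier H\<rbrakk>
        \<Longrightarrow> (\<lambda>x. g a1 a2 x a4 a5) \<in> linear_maps R H P"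
      "\<And>a1 a2 a3 a5. \<lbrakk>a1 \<in> carrier H; a2 \<in> carrier H; a3 \<in> carrier H; a5 \<in> carrier H\<rbrakk>
        \<Longrightarrow> (\<lambda>x. g a1 a2 a3 x a5) \<in> linear_maps R H P"
      "\<And>a1 a2 a3 a4. \<lbrakk>a1 \<in> carrier H; a2 \<in> carrier H; a3 \<in> carrier H; a4 \<in> carrier H\<rbrakk>
        \<Longrightarrow> (\<lambda>x. g a1 a2 a3 a4 x) \<in> linear_maps R H P"
  shows "S P (\<lambda>b' b5. S P (\<lambda>b1 b''. S P (\<lambda>d b4. S P (\<lambda>b2 b3. g b1 b2 b3 b4 b5) d) b'') b') a =
    S P (\<lambda>a1 c. S P (\<lambda>a2 c. S P (\<lambda>a3 c. S P (\<lambda>a4 a5. g a1 a2 a3 a4 a5) c) c) c) a"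
proof -
  have gc: "g a1 a2 a3 a4 a5 \<in> carrier P"
    if "a1 \<in> carrier H" "a2 \<in> carrier H" "a3 \<in> carrier H" "a4 \<in> carrier H" "a5 \<in> carrier H"
    for a1 a2 a3 a4 a5
    using that by (intro linear_closed[OF g(1)])
  note rules = P a S_closed gc linear_id linear_S linear_S_inner module_H g
  have "S P (\<lambda>b' b5. S P (\<lambda>b1 b''. S P (\<lambda>d b4. S P (\<lambda>b2 b3. g b1 b2 b3 b4 b5) d) b'') b') a =
    S P (\<lambda>b1 b'. S P (\<lambda>b'' b5. S P (\<lambda>d b4. S P (\<lambda>b2 b3. g b1 b2 b3 b4 b5) d) b'') b') a"
    by (rule S_coassoc) (assumption | intro rules)+
  also have "\<dots> = S P (\<lambda>b1 b'. S P (\<lambda>d b''. S P (\<lambda>b4 b5. S P (\<lambda>b2 b3. g b1 b2 b3 b4 b5) d) b'') b') a"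
    by (rule S_cong, rule S_coassoc) (assumption | intro rules)+
  also have "\<dots> = S P (\<lambda>b1 b'. S P (\<lambda>d b''. S P (\<lambda>b2 b3. S P (\<lambda>b4 b5. g b1 b2 b3 b4 b5) b'') d) b') a"
    by (rule S_cong, rule S_cong, rule S_swap) (assumption | intro rules)+
  also have "\<dots> = S P (\<lambda>b1 b'. S P (\<lambda>b2 b''. S P (\<lambda>b3 b''. S P (\<lambda>b4 b5. g b1 b2 b3 b4 b5) b'') b'') b') a"
    by (rule S_cong, rule S_coassoc) (assumption | intro rules)+
  finally show ?thesis .
qed

text \<open>Mirror image of \<open>S5_left\<close>: it is the first leg that is split off at the
  outset.\<close>

lemma S5_inner:
  assumes P: "module R P" and a: "a \<in> carrier H"
    and g: "\<And>a2 a3 a4 a5. \<lbrakk>a2 \<in> carrier H; a3 \<in> carrier H; a4 \<in> carrier H; a5 \<in> carrier H\<rbrakk>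
        \<Longrightarrow> (\<lambda>x. g x a2 a3 a4 a5) \<in> linear_maps R H P"
      "\<And>a1 a3 a4 a5. \<lbrakk>a1 \<in> carrier H; a3 \<in> carrier H; a4 \<in> carrier H; a5 \<in> carrier H\<rbrakk>
        \<Longrightarrow> (\<lambda>x. g a1 x a3 a4 a5) \<in> linear_maps R H P"
      "\<And>a1 a2 a4 a5. \<lbrakk>a1 \<in> carrier H; a2 \<in> carrier H; a4 \<in> carrier H; a5 \<in> carrier H\<rbrakk>
        \<Longrightarrow> (\<lambda>x. g a1 a2 x a4 a5) \<in> linear_maps R H P"
      "\<And>a1 a2 a3 a5. \<lbrakk>a1 \<in> carrier H; a2 \<in> carrier H; a3 \<in> carrier H; a5 \<in> carrier H\<rbrakk>
        \<Longrightarrow> (\<lambda>x. g a1 a2 a3 x a5) \<in> linear_maps R H P"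
      "\<And>a1 a2 a3 a4. \<lbrakk>a1 \<in> carrier H; a2 \<in> carrier H; a3 \<in> carrier H; a4 \<in> carrier H\<rbrakk>
        \<Longrightarrow> (\<lambda>x. g a1 a2 a3 a4 x) \<in> linear_maps R H P"
  shows "S P (\<lambda>a1 a'. S P (\<lambda>a2 a''. S P (\<lambda>c a5. S P (\<lambda>a3 a4. g a1 a2 a3 a4 a5) c) a'') a') a =
    S P (\<lambda>a1 c. S P (\<lambda>a2 c. S P (\<lambda>a3 c. S P (\<lambda>a4 a5. g a1 a2 a3 a4 a5) c) c) c) a"
proof -
  have gc: "g a1 a2 a3 a4 a5 \<in> carrier P"
    if "a1 \<in> carrier H" "a2 \<in> carrier H" "a3 \<in> carrier H" "a4 \<in> carrier H" "a5 \<in> carrier H"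
    for a1 a2 a3 a4 a5
    using that by (intro linear_closed[OF g(1)])
  have "S P (\<lambda>a1 a'. S P (\<lambda>a2 a''. S P (\<lambda>c a5. S P (\<lambda>a3 a4. g a1 a2 a3 a4 a5) c) a'') a') a =
    S P (\<lambda>a1 a'. S P (\<lambda>a2 a''. S P (\<lambda>a3 c. S P (\<lambda>a4 a5. g a1 a2 a3 a4 a5) c) a'') a') a"
    by (rule S_cong, rule S_cong, rule S_coassoc)
      (assumption | intro P a S_closed gc linear_id linear_S linear_S_inner module_H g)+
  then show ?thesis .
qed

lemma S3_mult:
  assumes P: "module R P" and a: "a \<in> carrier H" and b: "b \<in> carrier H"
    and g: "\<And>y z. \<lbrakk>y \<in> carrier H; z \<in> carrier H\<rbrakk> \<Longrightarrow> (\<lambda>x. g x y z) \<in> linear_maps R H P"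
      "\<And>x z. \<lbrakk>x \<in> carrier H; z \<in> carrier H\<rbrakk> \<Longrightarrow> (\<lambda>y. g x y z) \<in> linear_maps R H P"
      "\<And>x y. \<lbrakk>x \<in> carrier H; y \<in> carrier H\<rbrakk> \<Longrightarrow> (\<lambda>z. g x y z) \<in> linear_maps R H P"
  shows "S P (\<lambda>x c. S P (\<lambda>y z. g x y z) c) (a \<otimes>\<^bsub>H\<^esub> b) =
    S P (\<lambda>a1 a'. S P (\<lambda>a2 a3. S P (\<lambda>b1 b'. S P (\<lambda>b2 b3.
      g (a1 \<otimes>\<^bsub>H\<^esub> b1) (a2 \<otimes>\<^bsub>H\<^esub> b2) (a3 \<otimes>\<^bsub>H\<^esub> b3)) b') b) a') a"
proof -
  have gc: "g x y z \<in> carrier P" if "x \<in> carrier H" "y \<in> carrier H" "z \<in> carrier H" for x y z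
    using that by (intro linear_closed[OF g(1)])
  note rules = P a b S_closed gc linear_id linear_S linear_S_inner module_H g m_closed
  have "S P (\<lambda>x c. S P (\<lambda>y z. g x y z) c) (a \<otimes>\<^bsub>H\<^esub> b) =
    S P (\<lambda>a1 a'. S P (\<lambda>b1 b'. S P (\<lambda>y z. g (a1 \<otimes>\<^bsub>H\<^esub> b1) y z) (a' \<otimes>\<^bsub>H\<^esub> b')) b) a"
    by (rule S_mult) (assumption | intro rules)+
  also have "\<dots> = S P (\<lambda>a1 a'. S P (\<lambda>b1 b'. S P (\<lambda>a2 a3. S P (\<lambda>b2 b3.
      g (a1 \<otimes>\<^bsub>H\<^esub> b1) (a2 \<otimes>\<^bsub>H\<^esub> b2) (a3 \<otimes>\<^bsub>H\<^esub> b3)) b') a') b) a"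
    by (rule S_cong, rule S_cong, rule S_mult) (assumption | intro rules)+
  also have "\<dots> = S P (\<lambda>a1 a'. S P (\<lambda>a2 a3. S P (\<lambda>b1 b'. S P (\<lambda>b2 b3.
      g (a1 \<otimes>\<^bsub>H\<^esub> b1) (a2 \<otimes>\<^bsub>H\<^esub> b2) (a3 \<otimes>\<^bsub>H\<^esub> b3)) b') b) a') a"
    by (rule S_cong, rule S_swap) (assumption | intro rules)+
  finally show ?thesis .
qed

end


section \<open>The diagonal pairing\<close>

lemma tensor_sum_regular: "tensor_sum (regular_module R) f = tensor_sum R f"
  by (simp add: tensor_sum_def fun_eq_iff)

sublocale paired_bialgebra \<subseteq> D: bialgebra_product R H H ..

context paired_bialgebra
begin

lemma bilinear_diagonal_pairing:
  "diagonal_pairing R \<phi> \<in> bilinear_maps R D.T D.T (regular_module R)"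
proof -
  have "(\<lambda>X Y. tensor_sum (regular_module R) (\<lambda>c d. tensor_sum (regular_module R)
      (\<lambda>a b. \<phi> a d \<otimes>\<^bsub>R\<^esub> \<phi> c b) Y) X)
    \<in> bilinear_maps R (tensor_algebra R H H) (tensor_algebra R H H) (regular_module R)"
    by (rule bilinear_tensor_sum2) (assumption | intro module_H module_scalars lin closed)+
  then show ?thesis
    by (simp add: bilinear_maps_def diagonal_pairing_def[abs_def] tensor_sum_regular linear_maps_tensor_hopf
        tensor_hopf_simps)
qed

lemma diagonal_pairing_pure:
  assumes "c \<in> carrier H" "d \<in> carrier H" "a \<in> carrier H" "b \<in> carrier H"
  shows "diagonal_pairing R \<phi> (D.pr c d) (D.pr a b) = \<phi> a d \<otimes>\<^bsub>R\<^esub> \<phi> c b"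
proof -
  let ?K = "regular_module R"
  have "diagonal_pairing R \<phi> (D.pr c d) (D.pr a b) =
      tensor_sum ?K (\<lambda>a b. \<phi> a d \<otimes>\<^bsub>R\<^esub> \<phi> c b) (D.pr a b)"
    unfolding diagonal_pairing_def tensor_sum_regular[where R = R, symmetric]
    by (rule tensor_sum_pure_tensor[OF module_H module_H module_scalars], rule bilinear_mapsI)
      (assumption | intro module_H module_scalars lin closed assms pure_tensor_closed
        linear_maps_tensor_sum[OF module_H module_H module_H module_scalars])+
  also have "\<dots> = \<phi> a d \<otimes>\<^bsub>R\<^esub> \<phi> c b"
    by (rule tensor_sum_pure_tensor[OF module_H module_H module_scalars], rule bilinear_mapsI)
      (assumption | intro lin closed assms)+
  finally show ?thesis .
qed

lemma S_scalar_product: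
  assumes "a \<in> carrier H" "b \<in> carrier H"
    and "\<And>x y. \<lbrakk>x \<in> carrier H; y \<in> carrier H\<rbrakk> \<Longrightarrow> f x y \<in> carrier R"
    and "\<And>x y. \<lbrakk>x \<in> carrier H; y \<in> carrier H\<rbrakk> \<Longrightarrow> g x y \<in> carrier R"
  shows "S R f a \<otimes>\<^bsub>R\<^esub> S R g b =
    S (regular_module R) (\<lambda>x y. S (regular_module R) (\<lambda>u v. f x y \<otimes>\<^bsub>R\<^esub> g u v) b) a"
proof -
  have "S R g b \<in> carrier R"
    using S_closed[OF module_scalars assms(2), of g] assms(4) by (simp add: S_regular)
  then have "S R f a \<otimes>\<^bsub>R\<^esub> S R g b = S (regular_module R) (\<lambda>x y. f x y \<otimes>\<^bsub>R\<^esub> S R g b) a"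
    using S_smult_left[OF module_scalars, of "S R g b" a f] assms by simp
  also have "\<dots> = S (regular_module R) (\<lambda>x y. S (regular_module R) (\<lambda>u v. f x y \<otimes>\<^bsub>R\<^esub> g u v) b) a"
    using S_smult[OF module_scalars, of _ b g] assms by (intro S_cong) (simp_all add: S_regular)
  finally show ?thesis .
qed

text \<open>The pairing is crossed: \<phi>(a, d) has the second factor of the left argument in its
  right slot. So each of the two multiplicativity laws on H \<otimes> H needs both laws of \<phi>,
  one for each of its two factors, and pure tensors suffice by linearity.\<close>

lemma paired_diagonal: "paired_bialgebra R D.T (diagonal_pairing R \<phi>)"
proof (intro paired_bialgebra.intro D.T.bialgebra_axioms paired_bialgebra_axioms.intro)
  let ?K = "regular_module R"
  let ?psi = "diagonal_pairing R \<phi>"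
  note bil = bilinear_diagonal_pairing
  show "?psi \<in> bilinear_maps R D.T D.T ?K" by (rule bil)
  have psi_closed: "?psi X Y \<in> carrier R" if "X \<in> carrier D.T" "Y \<in> carrier D.T" for X Y
    using bilinear_closed[OF bil that] by simp
  note lin = lin D.lin bilinear_left[OF bil] bilinear_right[OF bil] D.T.linear_S D.T.linear_S_inner
    linear_comp[OF D.T.linear_counit]
  note closed = closed D.closed psi_closed module_scalars D.T.m_closed one_closed D.T.one_closed
  have mult: "D.pr a b \<otimes>\<^bsub>D.T\<^esub> D.pr a' b' = D.pr (a \<otimes>\<^bsub>H\<^esub> a') (b \<otimes>\<^bsub>H\<^esub> b')"
    if "a \<in> carrier H" "b \<in> carrier H" "a' \<in> carrier H" "b' \<in> carrier H" for a b a' b'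
    using that by (simp add: D.pr_mult)
  have eps: "(\<lambda>c d. counit H c \<otimes>\<^bsub>R\<^esub> counit H d) \<in> bilinear_maps R H H ?K"
    by (rule bilinear_mapsI)
      (assumption | intro lin linear_comp[OF linear_counit] counit_closed)+
  have counit_pr: "counit D.T (D.pr c d) = counit H c \<otimes>\<^bsub>R\<^esub> counit H d"
    if "c \<in> carrier H" "d \<in> carrier H" for c d
    unfolding tensor_hopf_simps tensor_sum_regular[where R = R, symmetric]
    by (rule tensor_sum_pure_tensor[OF module_H module_H module_scalars eps that])
  fix X assume X: "X \<in> carrier D.T"
  note ext = D.linear_T_ext[OF module_scalars]
  show "?psi X \<one>\<^bsub>D.T\<^esub> = counit D.T X"
    by (rule ext[of "\<lambda>X. ?psi X \<one>\<^bsub>D.T\<^esub>", OF _ _ X])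
      (simp add: D.one_T diagonal_pairing_pure counit_pr pairing_one_left pairing_one_right
        counit_closed R.m_comm | assumption | intro lin closed)+
  show "?psi \<one>\<^bsub>D.T\<^esub> X = counit D.T X"
    by (rule ext[of "\<lambda>X. ?psi \<one>\<^bsub>D.T\<^esub> X", OF _ _ X])
      (simp add: D.one_T diagonal_pairing_pure counit_pr pairing_one_left pairing_one_right
        counit_closed R.m_comm | assumption | intro lin closed)+
  fix Y Z assume Y: "Y \<in> carrier D.T" and Z: "Z \<in> carrier D.T"
  note closed = closed X Y Z
  have "?psi X (Y \<otimes>\<^bsub>D.T\<^esub> Z) = D.T.S ?K (\<lambda>X1 X2. ?psi X1 Y \<otimes>\<^bsub>R\<^esub> ?psi X2 Z) X"
  proof (rule ext[of "\<lambda>X. ?psi X (Y \<otimes>\<^bsub>D.T\<^esub> Z)", OF _ _ X])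
    fix c d assume cd: "c \<in> carrier H" "d \<in> carrier H"
    show "?psi (D.pr c d) (Y \<otimes>\<^bsub>D.T\<^esub> Z) = D.T.S ?K (\<lambda>X1 X2. ?psi X1 Y \<otimes>\<^bsub>R\<^esub> ?psi X2 Z) (D.pr c d)"
    proof (rule ext[of "\<lambda>Y. ?psi (D.pr c d) (Y \<otimes>\<^bsub>D.T\<^esub> Z)", OF _ _ Y])
      fix a b assume ab: "a \<in> carrier H" "b \<in> carrier H"
      show "?psi (D.pr c d) (D.pr a b \<otimes>\<^bsub>D.T\<^esub> Z) =
        D.T.S ?K (\<lambda>X1 X2. ?psi X1 (D.pr a b) \<otimes>\<^bsub>R\<^esub> ?psi X2 Z) (D.pr c d)"
      proof (rule ext[of "\<lambda>Z. ?psi (D.pr c d) (D.pr a b \<otimes>\<^bsub>D.T\<^esub> Z)", OF _ _ Z])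
        fix a' b' assume ab': "a' \<in> carrier H" "b' \<in> carrier H"
        note closed = closed cd ab ab'
        \<comment> \<open>Commutativity puts the sum over c in front, matching the order in which
          \<open>D.S_pr\<close> sums over the two factors.\<close>
        have "?psi (D.pr c d) (D.pr a b \<otimes>\<^bsub>D.T\<^esub> D.pr a' b') =
          S R (\<lambda>c1 c2. \<phi> c1 b \<otimes>\<^bsub>R\<^esub> \<phi> c2 b') c \<otimes>\<^bsub>R\<^esub> S R (\<lambda>d1 d2. \<phi> a d1 \<otimes>\<^bsub>R\<^esub> \<phi> a' d2) d"
          using cd ab ab'
          by (simp add: mult diagonal_pairing_pure m_closed R.m_comm[of "\<phi> _ d"] pairing_closed)
            (simp add: pairing_mult_left pairing_mult_right)
        also have "\<dots> = S ?K (\<lambda>c1 c2. S ?K (\<lambda>d1 d2.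
            \<phi> c1 b \<otimes>\<^bsub>R\<^esub> \<phi> c2 b' \<otimes>\<^bsub>R\<^esub> (\<phi> a d1 \<otimes>\<^bsub>R\<^esub> \<phi> a' d2)) d) c"
          by (rule S_scalar_product) (assumption | intro closed)+
        also have "\<dots> = S ?K (\<lambda>c1 c2. S ?K (\<lambda>d1 d2.
            ?psi (D.pr c1 d1) (D.pr a b) \<otimes>\<^bsub>R\<^esub> ?psi (D.pr c2 d2) (D.pr a' b')) d) c"
          by (rule S_cong, rule S_cong)
            (use cd ab ab' in \<open>simp_all add: diagonal_pairing_pure pairing_closed R.m_ac\<close>)
        also have "\<dots> = D.T.S ?K (\<lambda>X1 X2. ?psi X1 (D.pr a b) \<otimes>\<^bsub>R\<^esub> ?psi X2 (D.pr a' b')) (D.pr c d)"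
          by (rule D.S_pr[symmetric]) (assumption | intro lin closed)+
        finally show "?psi (D.pr c d) (D.pr a b \<otimes>\<^bsub>D.T\<^esub> D.pr a' b') =
          D.T.S ?K (\<lambda>X1 X2. ?psi X1 (D.pr a b) \<otimes>\<^bsub>R\<^esub> ?psi X2 (D.pr a' b')) (D.pr c d)" .
      qed (assumption | intro lin closed cd ab)+
    qed (assumption | intro lin closed cd)+
  qed (assumption | intro lin closed)+
  then show "?psi X (Y \<otimes>\<^bsub>D.T\<^esub> Z) = D.T.S R (\<lambda>X1 X2. ?psi X1 Y \<otimes>\<^bsub>R\<^esub> ?psi X2 Z) X"
    by (simp only: D.T.S_regular)
  have "?psi (X \<otimes>\<^bsub>D.T\<^esub> Y) Z = D.T.S ?K (\<lambda>Z1 Z2. ?psi X Z1 \<otimes>\<^bsub>R\<^esub> ?psi Y Z2) Z"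
  proof (rule ext[of "\<lambda>Z. ?psi (X \<otimes>\<^bsub>D.T\<^esub> Y) Z", OF _ _ Z])
    fix a b assume ab: "a \<in> carrier H" "b \<in> carrier H"
    show "?psi (X \<otimes>\<^bsub>D.T\<^esub> Y) (D.pr a b) = D.T.S ?K (\<lambda>Z1 Z2. ?psi X Z1 \<otimes>\<^bsub>R\<^esub> ?psi Y Z2) (D.pr a b)"
    proof (rule ext[of "\<lambda>X. ?psi (X \<otimes>\<^bsub>D.T\<^esub> Y) (D.pr a b)", OF _ _ X])
      fix c d assume cd: "c \<in> carrier H" "d \<in> carrier H"
      show "?psi (D.pr c d \<otimes>\<^bsub>D.T\<^esub> Y) (D.pr a b) =
        D.T.S ?K (\<lambda>Z1 Z2. ?psi (D.pr c d) Z1 \<otimes>\<^bsub>R\<^esub> ?psi Y Z2) (D.pr a b)"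
      proof (rule ext[of "\<lambda>Y. ?psi (D.pr c d \<otimes>\<^bsub>D.T\<^esub> Y) (D.pr a b)", OF _ _ Y])
        fix c' d' assume cd': "c' \<in> carrier H" "d' \<in> carrier H"
        note closed = closed cd ab cd'
        have "?psi (D.pr c d \<otimes>\<^bsub>D.T\<^esub> D.pr c' d') (D.pr a b) =
          S R (\<lambda>a1 a2. \<phi> a1 d \<otimes>\<^bsub>R\<^esub> \<phi> a2 d') a \<otimes>\<^bsub>R\<^esub> S R (\<lambda>b1 b2. \<phi> c b1 \<otimes>\<^bsub>R\<^esub> \<phi> c' b2) b"
          using cd ab cd'
          by (simp add: mult diagonal_pairing_pure m_closed pairing_closed)
            (simp add: pairing_mult_left pairing_mult_right)
        also have "\<dots> = S ?K (\<lambda>a1 a2. S ?K (\<lambda>b1 b2.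
            \<phi> a1 d \<otimes>\<^bsub>R\<^esub> \<phi> a2 d' \<otimes>\<^bsub>R\<^esub> (\<phi> c b1 \<otimes>\<^bsub>R\<^esub> \<phi> c' b2)) b) a"
          by (rule S_scalar_product) (assumption | intro closed)+
        also have "\<dots> = S ?K (\<lambda>a1 a2. S ?K (\<lambda>b1 b2.
            ?psi (D.pr c d) (D.pr a1 b1) \<otimes>\<^bsub>R\<^esub> ?psi (D.pr c' d') (D.pr a2 b2)) b) a"
          by (rule S_cong, rule S_cong)
            (use cd ab cd' in \<open>simp_all add: diagonal_pairing_pure pairing_closed R.m_ac\<close>)
        also have "\<dots> = D.T.S ?K (\<lambda>Z1 Z2. ?psi (D.pr c d) Z1 \<otimes>\<^bsub>R\<^esub> ?psi (D.pr c' d') Z2) (D.pr a b)"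
          by (rule D.S_pr[symmetric]) (assumption | intro lin closed)+
        finally show "?psi (D.pr c d \<otimes>\<^bsub>D.T\<^esub> D.pr c' d') (D.pr a b) =
          D.T.S ?K (\<lambda>Z1 Z2. ?psi (D.pr c d) Z1 \<otimes>\<^bsub>R\<^esub> ?psi (D.pr c' d') Z2) (D.pr a b)" .
      qed (assumption | intro lin closed cd ab)+
    qed (assumption | intro lin closed ab)+
  qed (assumption | intro lin closed)+
  then show "?psi (X \<otimes>\<^bsub>D.T\<^esub> Y) Z = D.T.S R (\<lambda>Z1 Z2. ?psi X Z1 \<otimes>\<^bsub>R\<^esub> ?psi Y Z2) Z"
    by (simp only: D.T.S_regular)
qed

abbreviation diag_iH where "diag_iH \<equiv> iHopf D.T (diagonal_pairing R \<phi>)"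

lemma unital_algebra_diag_iH: "unital_algebra R diag_iH"
  by (rule paired_bialgebra.unital_algebra_iHopf[OF paired_diagonal])

lemma diag_iH_mult_pure:
  assumes "a \<in> carrier H" "b \<in> carrier H" "c \<in> carrier H" "d \<in> carrier H"
  shows "D.pr a b \<otimes>\<^bsub>diag_iH\<^esub> D.pr c d = S D.T (\<lambda>a1 a2. S D.T (\<lambda>b1 b2. S D.T (\<lambda>c1 c2. S D.T (\<lambda>d1 d2.
    (\<phi> a1 d2 \<otimes>\<^bsub>R\<^esub> \<phi> c2 b1) \<odot>\<^bsub>D.T\<^esub> D.pr (a2 \<otimes>\<^bsub>H\<^esub> c1) (b2 \<otimes>\<^bsub>H\<^esub> d1)) d) c) b) a"
proof -
  let ?psi = "diagonal_pairing R \<phi>"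
  note bil = bilinear_diagonal_pairing
  have psi_closed: "?psi X Y \<in> carrier R" if "X \<in> carrier D.T" "Y \<in> carrier D.T" for X Y
    using bilinear_closed[OF bil that] by simp
  note lin = lin D.lin bilinear_left[OF bil] bilinear_right[OF bil] D.T.linear_S D.T.linear_S_inner
  note closed = closed D.closed psi_closed D.T.m_closed D.T.smult_closed D.T.S_closed assms
  have "D.pr a b \<otimes>\<^bsub>diag_iH\<^esub> D.pr c d = D.T.S D.T (\<lambda>X1 X2. D.T.S D.T (\<lambda>Y1 Y2.
      ?psi Y2 X1 \<odot>\<^bsub>D.T\<^esub> (X2 \<otimes>\<^bsub>D.T\<^esub> Y1)) (D.pr c d)) (D.pr a b)"
    by (simp add: iHopf_def)
  also have "\<dots> = S D.T (\<lambda>a1 a2. S D.T (\<lambda>b1 b2. D.T.S D.T (\<lambda>Y1 Y2.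
      ?psi Y2 (D.pr a1 b1) \<odot>\<^bsub>D.T\<^esub> (D.pr a2 b2 \<otimes>\<^bsub>D.T\<^esub> Y1)) (D.pr c d)) b) a"
    by (rule D.S_pr) (assumption | intro lin closed)+
  also have "\<dots> = S D.T (\<lambda>a1 a2. S D.T (\<lambda>b1 b2. S D.T (\<lambda>c1 c2. S D.T (\<lambda>d1 d2.
      ?psi (D.pr c2 d2) (D.pr a1 b1) \<odot>\<^bsub>D.T\<^esub> (D.pr a2 b2 \<otimes>\<^bsub>D.T\<^esub> D.pr c1 d1)) d) c) b) a"
    by (rule S_cong, rule S_cong, rule D.S_pr) (assumption | intro lin closed)+
  also have "\<dots> = S D.T (\<lambda>a1 a2. S D.T (\<lambda>b1 b2. S D.T (\<lambda>c1 c2. S D.T (\<lambda>d1 d2.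
    (\<phi> a1 d2 \<otimes>\<^bsub>R\<^esub> \<phi> c2 b1) \<odot>\<^bsub>D.T\<^esub> D.pr (a2 \<otimes>\<^bsub>H\<^esub> c1) (b2 \<otimes>\<^bsub>H\<^esub> d1)) d) c) b) a"
    by (intro S_cong assms) (simp add: diagonal_pairing_pure D.pr_mult)
  finally show ?thesis .
qed

end

section \<open>Algebra homomorphisms out of a twisted iHopf algebra\<close>

context paired_bialgebra
begin

lemma S_closed_scalar:
  assumes "a \<in> carrier H" "\<And>x y. \<lbrakk>x \<in> carrier H; y \<in> carrier H\<rbrakk> \<Longrightarrow> f x y \<in> carrier R"
  shows "S (regular_module R) f a \<in> carrier R"
  using S_closed[OF module_scalars assms(1), of f] assms(2) by simp

lemma S_regular_smult_left:
  assumes "module R P" "p \<in> carrier P" "a \<in> carrier H"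
    and "\<And>x y. \<lbrakk>x \<in> carrier H; y \<in> carrier H\<rbrakk> \<Longrightarrow> f x y \<in> carrier R"
  shows "S (regular_module R) f a \<odot>\<^bsub>P\<^esub> p = S P (\<lambda>x y. f x y \<odot>\<^bsub>P\<^esub> p) a"
  unfolding S_regular by (rule S_smult_left[OF assms])

text \<open>The order x, z, y, w of the sums is made for \<open>contract_mult\<close>, where x and z
  are legs of one element and y and w legs of the other: the sums belonging to one element stay
  together.\<close>

lemma pairing_mult_mult:
  assumes "x \<in> carrier H" "y \<in> carrier H" "z \<in> carrier H" "w \<in> carrier H"
  shows "\<phi> (x \<otimes>\<^bsub>H\<^esub> y) (z \<otimes>\<^bsub>H\<^esub> w) =
    S (regular_module R) (\<lambda>x1 x2. S (regular_module R) (\<lambda>z1 z2. S (regular_module R) (\<lambda>y1 y2.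
      S (regular_module R) (\<lambda>w1 w2. \<phi> x1 z1 \<otimes>\<^bsub>R\<^esub> \<phi> x2 w1 \<otimes>\<^bsub>R\<^esub> (\<phi> y1 z2 \<otimes>\<^bsub>R\<^esub> \<phi> y2 w2)) w) y) z) x"
proof -
  let ?K = "regular_module R"
  let ?g = "\<lambda>x1 x2 y1 y2 z1 z2 w1 w2.
    \<phi> x1 z1 \<otimes>\<^bsub>R\<^esub> \<phi> x2 w1 \<otimes>\<^bsub>R\<^esub> (\<phi> y1 z2 \<otimes>\<^bsub>R\<^esub> \<phi> y2 w2)"
  note closed = closed S_closed_scalar module_scalars assms
  have "\<phi> (x \<otimes>\<^bsub>H\<^esub> y) (z \<otimes>\<^bsub>H\<^esub> w) = S ?K (\<lambda>p q. \<phi> x p \<otimes>\<^bsub>R\<^esub> \<phi> y q) (z \<otimes>\<^bsub>H\<^esub> w)"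
    unfolding S_regular by (rule pairing_mult_left) (intro closed)+
  also have "\<dots> = S ?K (\<lambda>z1 z2. S ?K (\<lambda>w1 w2.
      \<phi> x (z1 \<otimes>\<^bsub>H\<^esub> w1) \<otimes>\<^bsub>R\<^esub> \<phi> y (z2 \<otimes>\<^bsub>H\<^esub> w2)) w) z"
    by (rule S_mult) (assumption | intro lin closed)+
  also have "\<dots> = S ?K (\<lambda>z1 z2. S ?K (\<lambda>w1 w2. S ?K (\<lambda>x1 x2. S ?K (\<lambda>y1 y2.
      ?g x1 x2 y1 y2 z1 z2 w1 w2) y) x) w) z"
    by (rule S_cong, rule S_cong, simp only: pairing_mult_right assms, rule S_scalar_product)
      (assumption | intro closed)+
  also have "\<dots> = S ?K (\<lambda>z1 z2. S ?K (\<lambda>x1 x2. S ?K (\<lambda>w1 w2. S ?K (\<lambda>y1 y2.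
      ?g x1 x2 y1 y2 z1 z2 w1 w2) y) w) x) z"
    by (rule S_cong, rule S_swap) (assumption | intro closed | simp add: closed)+
  also have "\<dots> = S ?K (\<lambda>z1 z2. S ?K (\<lambda>x1 x2. S ?K (\<lambda>y1 y2. S ?K (\<lambda>w1 w2.
      ?g x1 x2 y1 y2 z1 z2 w1 w2) w) y) x) z"
    by (rule S_cong, rule S_cong, rule S_swap) (assumption | intro closed | simp add: closed)+
  also have "\<dots> = S ?K (\<lambda>x1 x2. S ?K (\<lambda>z1 z2. S ?K (\<lambda>y1 y2. S ?K (\<lambda>w1 w2.
      ?g x1 x2 y1 y2 z1 z2 w1 w2) w) y) z) x"
    by (rule S_swap) (assumption | intro closed | simp add: closed)+
  finally show ?thesis .
qed

text \<open>The outer two of three legs are paired with each other. For the twisted pairing, as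
  \<open>tw.contract\<close>, this is the map X behind \<Psi>.\<close>

definition contract where
  "contract a = S H (\<lambda>a1 a'. S H (\<lambda>a2 a3. \<phi> a3 a1 \<odot>\<^bsub>H\<^esub> a2) a') a"

lemma linear_contract: "contract \<in> linear_maps R H H"
  unfolding contract_def[abs_def] by (assumption | intro lin closed smult_closed)+

lemma star_contract:
  assumes "x \<in> carrier H" "y \<in> carrier H"
  shows "star (contract x) (contract y) =
    S H (\<lambda>x1 x'. S H (\<lambda>x2 x3. S H (\<lambda>y1 y'. S H (\<lambda>y2 y3. S H (\<lambda>p q. S H (\<lambda>r s.
      (\<phi> x3 x1 \<otimes>\<^bsub>R\<^esub> \<phi> y3 y1 \<otimes>\<^bsub>R\<^esub> \<phi> s p) \<odot>\<^bsub>H\<^esub> (q \<otimes>\<^bsub>H\<^esub> r)) y2) x2) y') y) x') x"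
proof -
  note star_left = bilinear_left[OF bilinear_star linear_id]
    and star_right = bilinear_right[OF bilinear_star _ linear_id]
  note closed = closed smult_closed star_closed assms linear_closed[OF linear_contract]
  have "star (contract x) (contract y) =
      S H (\<lambda>x1 x'. star (S H (\<lambda>x2 x3. \<phi> x3 x1 \<odot>\<^bsub>H\<^esub> x2) x') (contract y)) x"
    unfolding contract_def[of x]
    by (rule linear_commutes_S[OF star_left]) (assumption | intro closed)+
  also have "\<dots> = S H (\<lambda>x1 x'. S H (\<lambda>x2 x3. star (\<phi> x3 x1 \<odot>\<^bsub>H\<^esub> x2) (contract y)) x') x"
    by (rule S_cong, rule linear_commutes_S[OF star_left]) (assumption | intro closed)+
  also have "\<dots> = S H (\<lambda>x1 x'. S H (\<lambda>x2 x3. S H (\<lambda>y1 y'.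
      star (\<phi> x3 x1 \<odot>\<^bsub>H\<^esub> x2) (S H (\<lambda>y2 y3. \<phi> y3 y1 \<odot>\<^bsub>H\<^esub> y2) y')) y) x') x"
    unfolding contract_def[of y]
    by (rule S_cong, rule S_cong, rule linear_commutes_S[OF star_right]) (assumption | intro closed)+
  also have "\<dots> = S H (\<lambda>x1 x'. S H (\<lambda>x2 x3. S H (\<lambda>y1 y'. S H (\<lambda>y2 y3.
      star (\<phi> x3 x1 \<odot>\<^bsub>H\<^esub> x2) (\<phi> y3 y1 \<odot>\<^bsub>H\<^esub> y2)) y') y) x') x"
    by (rule S_cong, rule S_cong, rule S_cong, rule linear_commutes_S[OF star_right])
      (assumption | intro closed)+
  also have "\<dots> = S H (\<lambda>x1 x'. S H (\<lambda>x2 x3. S H (\<lambda>y1 y'. S H (\<lambda>y2 y3. S H (\<lambda>p q. S H (\<lambda>r s.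
      (\<phi> x3 x1 \<otimes>\<^bsub>R\<^esub> \<phi> y3 y1 \<otimes>\<^bsub>R\<^esub> \<phi> s p) \<odot>\<^bsub>H\<^esub> (q \<otimes>\<^bsub>H\<^esub> r)) y2) x2) y') y) x') x"
  proof (rule S_cong, rule S_cong, rule S_cong, rule S_cong)
    fix x1 x' x2 x3 y1 y' y2 y3
    assume xy: "x1 \<in> carrier H" "x3 \<in> carrier H" "x2 \<in> carrier H" "y1 \<in> carrier H"
      "y2 \<in> carrier H" "y3 \<in> carrier H"
    have "star (\<phi> x3 x1 \<odot>\<^bsub>H\<^esub> x2) (\<phi> y3 y1 \<odot>\<^bsub>H\<^esub> y2) = (\<phi> x3 x1 \<otimes>\<^bsub>R\<^esub> \<phi> y3 y1) \<odot>\<^bsub>H\<^esub> star x2 y2"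
      using xy by (simp add: linear_smult[OF star_left] linear_smult[OF star_right] pairing_closed
          star_closed smult_assoc1[symmetric] R.m_comm)
    also have "\<dots> = S H (\<lambda>p q. S H (\<lambda>r s.
      (\<phi> x3 x1 \<otimes>\<^bsub>R\<^esub> \<phi> y3 y1 \<otimes>\<^bsub>R\<^esub> \<phi> s p) \<odot>\<^bsub>H\<^esub> (q \<otimes>\<^bsub>H\<^esub> r)) y2) x2"
      unfolding star_def using xy
      by (auto simp: S_smult module_H closed smult_assoc1 intro!: S_cong)
    finally show "star (\<phi> x3 x1 \<odot>\<^bsub>H\<^esub> x2) (\<phi> y3 y1 \<odot>\<^bsub>H\<^esub> y2) = S H (\<lambda>p q. S H (\<lambda>r s.
      (\<phi> x3 x1 \<otimes>\<^bsub>R\<^esub> \<phi> y3 y1 \<otimes>\<^bsub>R\<^esub> \<phi> s p) \<odot>\<^bsub>H\<^esub> (q \<otimes>\<^bsub>H\<^esub> r)) y2) x2" .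
  qed (use assms in auto)
  finally show ?thesis .
qed

text \<open>Pairing a3 b3 with a1 b1 creates \<phi>(a4, a1), \<phi>(a5, b1), \<phi>(b4, a2) and
  \<phi>(b5, b2) in the numbering of five legs. The first and the last contract the two factors, the
  third is the pairing of \<open>star\<close> on the middle legs, and the second stays outside as
  the pairing of the twisted law.\<close>

lemma contract_mult:
  assumes "a \<in> carrier H" "b \<in> carrier H"
  shows "contract (a \<otimes>\<^bsub>H\<^esub> b) =
    S H (\<lambda>a1 a2. S H (\<lambda>b1 b2. \<phi> a2 b1 \<odot>\<^bsub>H\<^esub> star (contract a1) (contract b2)) b) a"
proof -
  define E where "E a1 a2 a3 a4 a5 b1 b2 b3 b4 b5 =
    (\<phi> a4 a1 \<otimes>\<^bsub>R\<^esub> \<phi> a5 b1 \<otimes>\<^bsub>R\<^esub> (\<phi> b4 a2 \<otimes>\<^bsub>R\<^esub> \<phi> b5 b2)) \<odot>\<^bsub>H\<^esub> (a3 \<otimes>\<^bsub>H\<^esub> b3)"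
    for a1 a2 a3 a4 a5 b1 b2 b3 b4 b5
  note closed = closed smult_closed S_closed_scalar assms
  have E: "E a1 a2 a3 a4 a5 b1 b2 b3 b4 b5 \<in> carrier H"
    if "a1 \<in> carrier H" "a2 \<in> carrier H" "a3 \<in> carrier H" "a4 \<in> carrier H" "a5 \<in> carrier H"
      "b1 \<in> carrier H" "b2 \<in> carrier H" "b3 \<in> carrier H" "b4 \<in> carrier H" "b5 \<in> carrier H"
    for a1 a2 a3 a4 a5 b1 b2 b3 b4 b5
    unfolding E_def using that by (intro closed)
  have "contract (a \<otimes>\<^bsub>H\<^esub> b) = S H (\<lambda>a1 a'. S H (\<lambda>a2 a3. S H (\<lambda>b1 b'. S H (\<lambda>b2 b3.
      \<phi> (a3 \<otimes>\<^bsub>H\<^esub> b3) (a1 \<otimes>\<^bsub>H\<^esub> b1) \<odot>\<^bsub>H\<^esub> (a2 \<otimes>\<^bsub>H\<^esub> b2)) b') b) a') a"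
    unfolding contract_def by (rule S3_mult) (assumption | intro lin closed)+
  \<comment> \<open>The pairings comultiply both outer legs of a and of b, which is how three legs
    become five.\<close>
  also have "\<dots> = S H (\<lambda>a1 a'. S H (\<lambda>a2 a3. S H (\<lambda>b1 b'. S H (\<lambda>b2 b3.
      S H (\<lambda>u v. S H (\<lambda>s t. S H (\<lambda>u' v'. S H (\<lambda>s' t'.
        E s t a2 u v s' t' b2 u' v') b1) b3) a1) a3) b') b) a') a"
    by (intro S_cong assms)
      (auto simp: pairing_mult_mult S_regular_smult_left module_H closed E_def intro!: S_cong)
  also have "\<dots> = S H (\<lambda>a1 a'. S H (\<lambda>a2 a3. S H (\<lambda>u v. S H (\<lambda>s t.
      S H (\<lambda>b1 b'. S H (\<lambda>b2 b3. S H (\<lambda>u' v'. S H (\<lambda>s' t'.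
        E s t a2 u v s' t' b2 u' v') b1) b3) b') b) a1) a3) a') a"
    by (rule S_cong, rule S_cong, rule S_swap22) (assumption | intro closed E)+
  also have "\<dots> = S H (\<lambda>a1 a'. S H (\<lambda>a2 a3. S H (\<lambda>u v. S H (\<lambda>s t.
      S H (\<lambda>b1 c. S H (\<lambda>b2 c. S H (\<lambda>b3 c. S H (\<lambda>b4 b5.
        E s t a2 u v b1 b2 b3 b4 b5) c) c) c) b) a1) a3) a') a"
    by (rule S_cong, rule S_cong, rule S_cong, rule S_cong, rule S5_outer)
      (unfold E_def, (assumption | intro lin closed)+)
  also have "\<dots> = S H (\<lambda>a1 c. S H (\<lambda>a2 c. S H (\<lambda>a3 c. S H (\<lambda>a4 a5.
      S H (\<lambda>b1 c. S H (\<lambda>b2 c. S H (\<lambda>b3 c. S H (\<lambda>b4 b5.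
        E a1 a2 a3 a4 a5 b1 b2 b3 b4 b5) c) c) c) b) c) c) c) a"
    by (rule S5_outer) (unfold E_def, (assumption | intro lin closed)+)
  also have "\<dots> = S H (\<lambda>a' a5. S H (\<lambda>a1 a''. S H (\<lambda>c a4. S H (\<lambda>a2 a3.
      S H (\<lambda>b1 c. S H (\<lambda>b2 c. S H (\<lambda>b3 c. S H (\<lambda>b4 b5.
        E a1 a2 a3 a4 a5 b1 b2 b3 b4 b5) c) c) c) b) c) a'') a') a"
    by (rule S5_left[symmetric]) (unfold E_def, (assumption | intro lin closed)+)
  also have "\<dots> = S H (\<lambda>a' a5. S H (\<lambda>a1 a''. S H (\<lambda>c a4. S H (\<lambda>a2 a3.
      S H (\<lambda>b1 b'. S H (\<lambda>b2 b''. S H (\<lambda>d b5. S H (\<lambda>b3 b4.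
        E a1 a2 a3 a4 a5 b1 b2 b3 b4 b5) d) b'') b') b) c) a'') a') a"
    by (rule S_cong, rule S_cong, rule S_cong, rule S_cong, rule S5_inner[symmetric])
      (unfold E_def, (assumption | intro lin closed)+)
  also have "\<dots> = S H (\<lambda>a' a5. S H (\<lambda>a1 a''. S H (\<lambda>c a4. S H (\<lambda>b1 b'. S H (\<lambda>a2 a3.
      S H (\<lambda>b2 b''. S H (\<lambda>d b5. S H (\<lambda>b3 b4.
        E a1 a2 a3 a4 a5 b1 b2 b3 b4 b5) d) b'') b') c) b) a'') a') a"
    by (rule S_cong, rule S_cong, rule S_cong, rule S_swap) (assumption | intro closed E)+
  also have "\<dots> = S H (\<lambda>a' a5. S H (\<lambda>a1 a''. S H (\<lambda>c a4. S H (\<lambda>b1 b'.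
      S H (\<lambda>b2 b''. S H (\<lambda>d b5. S H (\<lambda>a2 a3. S H (\<lambda>b3 b4.
        E a1 a2 a3 a4 a5 b1 b2 b3 b4 b5) d) c) b'') b') b) a'') a') a"
    by (rule S_cong, rule S_cong, rule S_cong, rule S_cong, rule S_swap12) (assumption | intro closed E)+
  also have "\<dots> = S H (\<lambda>a' a5. S H (\<lambda>b1 b'. S H (\<lambda>a1 a''. S H (\<lambda>c a4.
      S H (\<lambda>b2 b''. S H (\<lambda>d b5. S H (\<lambda>a2 a3. S H (\<lambda>b3 b4.
        E a1 a2 a3 a4 a5 b1 b2 b3 b4 b5) d) c) b'') b') a'') a') b) a"
    by (rule S_cong, rule S_swap12[symmetric]) (assumption | intro closed E)+
  also have "\<dots> = S H (\<lambda>a1 a2. S H (\<lambda>b1 b2. \<phi> a2 b1 \<odot>\<^bsub>H\<^esub> star (contract a1) (contract b2)) b) a"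
    by (rule S_cong, rule S_cong, subst star_contract)
      (auto simp: S_smult module_H closed E_def R.m_ac smult_assoc1[symmetric] intro!: S_cong)
  finally show ?thesis .
qed

end

section \<open>The twist by an endomorphism\<close>

lemma linear_maps_iHopf [simp]:
  "linear_maps R (iHopf H \<phi>) P = linear_maps R H P"
  "linear_maps R P (iHopf H \<phi>) = linear_maps R P H"
  by (simp_all add: linear_maps_def)

lemma bilinear_maps_iHopf [simp]:
  "bilinear_maps R M (iHopf H \<phi>) P = bilinear_maps R M H P"
  "bilinear_maps R (iHopf H \<phi>) M P = bilinear_maps R H M P"
  by (simp_all add: bilinear_maps_def)

lemma sweedler2_iHopf [simp]: "sweedler2 H (iHopf K \<phi>) f a = sweedler2 H K f a"
  by (simp add: sweedler2_def tensor_sum_def)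

locale twisted_pairing = paired_bialgebra R H \<phi>
  for R :: "('f, 'm) ring_scheme" and H :: "('f, 'h, 'x) hopf_scheme" and \<phi> +
  fixes \<tau> :: "'h \<Rightarrow> 'h"
  assumes tau_hom: "\<tau> \<in> unital_algebra_homs R H H"
    and comult_tau: "a \<in> carrier H \<Longrightarrow> comult H (\<tau> a) =
      sweedler2 H (tensor_algebra R H H) (\<lambda>a1 a2. pure_tensor R H H (\<tau> a1) (\<tau> a2)) a"
    and counit_tau: "a \<in> carrier H \<Longrightarrow> counit H (\<tau> a) = counit H a"
begin

lemma linear_tau: "\<tau> \<in> linear_maps R H H"
  using tau_hom by (simp add: unital_algebra_homs_def algebra_homs_def)

lemma tau_closed: "a \<in> carrier H \<Longrightarrow> \<tau> a \<in> carrier H"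
  by (rule linear_closed[OF linear_tau])

lemma tau_one: "\<tau> \<one>\<^bsub>H\<^esub> = \<one>\<^bsub>H\<^esub>"
  using tau_hom by (simp add: unital_algebra_homs_def)

lemma tau_mult: "\<lbrakk>a \<in> carrier H; b \<in> carrier H\<rbrakk> \<Longrightarrow> \<tau> (a \<otimes>\<^bsub>H\<^esub> b) = \<tau> a \<otimes>\<^bsub>H\<^esub> \<tau> b"
  using tau_hom by (simp add: unital_algebra_homs_def algebra_homs_def)

lemma S_tau:
  assumes "module R P" "a \<in> carrier H"
    and l: "\<And>y. y \<in> carrier H \<Longrightarrow> (\<lambda>x. f x y) \<in> linear_maps R H P"
      "\<And>x. x \<in> carrier H \<Longrightarrow> (\<lambda>y. f x y) \<in> linear_maps R H P"
  shows "S P f (\<tau> a) = S P (\<lambda>x y. f (\<tau> x) (\<tau> y)) a"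
proof -
  note m2 = module_tensor_algebra[OF module_H module_H]
  have bil: "f \<in> bilinear_maps R H H P" by (intro bilinear_mapsI l)
  note f = linear_tensor_sum[OF module_H module_H assms(1) bil]
  have "S P f (\<tau> a) =
      tensor_sum P f (S (tensor_algebra R H H) (\<lambda>x y. pure_tensor R H H (\<tau> x) (\<tau> y)) a)"
    by (simp add: sweedler2_def[of H P] comult_tau assms(2))
  also have "\<dots> = S P (\<lambda>x y. tensor_sum P f (pure_tensor R H H (\<tau> x) (\<tau> y))) a"
    by (intro linear_commutes_S[OF f m2] assms pure_tensor_closed tau_closed)
  also have "\<dots> = S P (\<lambda>x y. f (\<tau> x) (\<tau> y)) a"
    by (rule S_cong, rule tensor_sum_pure_tensor[OF module_H module_H assms(1) bil])
      (intro tau_closed assms | assumption)+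
  finally show ?thesis .
qed

text \<open>That \<tau> is an algebra map gives multiplicativity in the first slot; that it is a
  coalgebra map gives multiplicativity in the second.\<close>

lemma paired_twist: "paired_bialgebra R H (\<lambda>a b. \<phi> (\<tau> a) b)"
proof (intro paired_bialgebra.intro bialgebra_axioms paired_bialgebra_axioms.intro)
  note lin = lin linear_tau
  show "(\<lambda>a b. \<phi> (\<tau> a) b) \<in> bilinear_maps R H H (regular_module R)"
    by (rule bilinear_mapsI) (assumption | intro lin tau_closed)+
  fix a b b' assume ab: "a \<in> carrier H" "b \<in> carrier H" "b' \<in> carrier H"
  show "\<phi> (\<tau> a) \<one>\<^bsub>H\<^esub> = counit H a" "\<phi> (\<tau> \<one>\<^bsub>H\<^esub>) a = counit H a"
    using ab by (simp_all add: pairing_one_right pairing_one_left tau_closed tau_one counit_tau)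
  show "\<phi> (\<tau> a) (b \<otimes>\<^bsub>H\<^esub> b') = S R (\<lambda>a1 a2. \<phi> (\<tau> a1) b \<otimes>\<^bsub>R\<^esub> \<phi> (\<tau> a2) b') a"
    unfolding pairing_mult_right[OF tau_closed[OF ab(1)] ab(2,3)] S_regular[symmetric]
    by (rule S_tau) (assumption | intro lin closed module_scalars ab)+
  show "\<phi> (\<tau> (a \<otimes>\<^bsub>H\<^esub> b)) b' = S R (\<lambda>b1 b2. \<phi> (\<tau> a) b1 \<otimes>\<^bsub>R\<^esub> \<phi> (\<tau> b) b2) b'"
    using ab by (simp add: tau_mult pairing_mult_left tau_closed)
qed

sublocale tw: paired_bialgebra R H "\<lambda>a b. \<phi> (\<tau> a) b"
  by (rule paired_twist)

abbreviation tw_iH where "tw_iH \<equiv> iHopf H (\<lambda>a b. \<phi> (\<tau> a) b)"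

text \<open>Moving \<tau> inside the coproducts makes the sums run over legs of x and z themselves,
  so that coassociativity for a and b can be applied to them later.\<close>

lemma diag_iH_mult_tau:
  assumes "x \<in> carrier H" "y \<in> carrier H" "z \<in> carrier H" "w \<in> carrier H"
  shows "D.pr (\<tau> x) y \<otimes>\<^bsub>diag_iH\<^esub> D.pr (\<tau> z) w =
    S D.T (\<lambda>u v. S D.T (\<lambda>s t. S D.T (\<lambda>u' v'. S D.T (\<lambda>s' t'.
      (\<phi> (\<tau> u) t' \<otimes>\<^bsub>R\<^esub> \<phi> (\<tau> v') s) \<odot>\<^bsub>D.T\<^esub> D.pr (\<tau> v \<otimes>\<^bsub>H\<^esub> \<tau> u') (t \<otimes>\<^bsub>H\<^esub> s')) w) z) y) x"
proof -
  note lin = lin D.lin linear_comp[OF linear_tau]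
  note closed = closed D.closed D.T.smult_closed assms tau_closed
  have "D.pr (\<tau> x) y \<otimes>\<^bsub>diag_iH\<^esub> D.pr (\<tau> z) w =
    S D.T (\<lambda>u v. S D.T (\<lambda>s t. S D.T (\<lambda>u' v'. S D.T (\<lambda>s' t'.
      (\<phi> u t' \<otimes>\<^bsub>R\<^esub> \<phi> v' s) \<odot>\<^bsub>D.T\<^esub> D.pr (v \<otimes>\<^bsub>H\<^esub> u') (t \<otimes>\<^bsub>H\<^esub> s')) w) (\<tau> z)) y) (\<tau> x)"
    by (rule diag_iH_mult_pure) (intro closed)+
  also have "\<dots> = S D.T (\<lambda>u v. S D.T (\<lambda>s t. S D.T (\<lambda>u' v'. S D.T (\<lambda>s' t'.
      (\<phi> (\<tau> u) t' \<otimes>\<^bsub>R\<^esub> \<phi> v' s) \<odot>\<^bsub>D.T\<^esub> D.pr (\<tau> v \<otimes>\<^bsub>H\<^esub> u') (t \<otimes>\<^bsub>H\<^esub> s')) w) (\<tau> z)) y) x"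
    by (rule S_tau) (assumption | intro lin closed)+
  also have "\<dots> = S D.T (\<lambda>u v. S D.T (\<lambda>s t. S D.T (\<lambda>u' v'. S D.T (\<lambda>s' t'.
      (\<phi> (\<tau> u) t' \<otimes>\<^bsub>R\<^esub> \<phi> (\<tau> v') s) \<odot>\<^bsub>D.T\<^esub> D.pr (\<tau> v \<otimes>\<^bsub>H\<^esub> \<tau> u') (t \<otimes>\<^bsub>H\<^esub> s')) w) z) y) x"
    by (rule S_cong, rule S_cong, rule S_tau) (assumption | intro lin closed)+
  finally show ?thesis .
qed

end

text \<open>Both homomorphisms of the theorem are instances of one construction: \<open>\<xi>\<close> has values in
  \<open>A = F\<close> with \<open>X = \<chi>\<close>, and \<open>\<Psi>\<close> has \<open>A = iH\<close> with \<open>X\<close> the map \<open>contract\<close>.\<close>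

locale twisted_map = twisted_pairing R H \<phi> \<tau> + A: unital_algebra R A + B: unital_algebra R B
  for R :: "('f, 'm) ring_scheme" and H :: "('f, 'h, 'x) hopf_scheme" and \<phi> \<tau>
    and A :: "('f, 'a, 'y) module_scheme" and B :: "('f, 'b, 'z) module_scheme" +
  fixes m :: "'a \<Rightarrow> ('h \<times> 'h) list set \<Rightarrow> 'b" and X :: "'h \<Rightarrow> 'a"
  assumes bilinear_m: "m \<in> bilinear_maps R A D.T B"
    and m_mult: "\<lbrakk>x \<in> carrier A; y \<in> carrier A; u \<in> carrier D.T; v \<in> carrier D.T\<rbrakk> \<Longrightarrow>
      m (x \<otimes>\<^bsub>A\<^esub> y) (u \<otimes>\<^bsub>diag_iH\<^esub> v) = m x u \<otimes>\<^bsub>B\<^esub> m y v"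
    and linear_X: "X \<in> linear_maps R H A"
    and X_mult: "\<lbrakk>a \<in> carrier H; b \<in> carrier H\<rbrakk> \<Longrightarrow> X (a \<otimes>\<^bsub>H\<^esub> b) =
      sweedler2 H A (\<lambda>a1 a2. sweedler2 H A (\<lambda>b1 b2. \<phi> (\<tau> a2) b1 \<odot>\<^bsub>A\<^esub> (X a1 \<otimes>\<^bsub>A\<^esub> X b2)) b) a"
begin

text \<open>The map \<open>m\<close> plays the part of the tensor sign between A and H \<otimes> H.
  For \<Psi> it is \<open>pure_tensor\<close>; for \<xi> it is scalar multiplication, so scalars are
  absorbed without an identification of F \<otimes> M with M.\<close>

definition lift where
  "lift a = S B (\<lambda>a1 a'. S B (\<lambda>a2 a3. m (X a2) (D.pr (\<tau> a3) a1)) a') a"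

lemmas modules = A.module_axioms B.module_axioms

lemma X_closed: "a \<in> carrier H \<Longrightarrow> X a \<in> carrier A"
  by (rule linear_closed[OF linear_X])

lemma m_closed': "\<lbrakk>x \<in> carrier A; u \<in> carrier D.T\<rbrakk> \<Longrightarrow> m x u \<in> carrier B"
  by (rule bilinear_closed[OF bilinear_m])

lemmas lin' = lin D.lin linear_comp[OF linear_tau] linear_comp[OF linear_X]
  bilinear_left[OF bilinear_m] bilinear_right[OF bilinear_m]
  bilinear_left[OF bilinear_mult[OF A.unital_algebra_axioms]]
  bilinear_right[OF bilinear_mult[OF A.unital_algebra_axioms]]
  bilinear_left[OF bilinear_mult[OF B.unital_algebra_axioms]]
  bilinear_right[OF bilinear_mult[OF B.unital_algebra_axioms]]

lemmas closed' = closed D.closed D.T.smult_closed tau_closed X_closed m_closed' modules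
  A.m_closed B.m_closed A.smult_closed B.smult_closed

lemma linear_lift: "lift \<in> linear_maps R H B"
  unfolding lift_def[abs_def] by (assumption | intro lin' closed')+

text \<open>The product in \<open>diag_iH\<close> comultiplies \<tau>(a3) and a1, and likewise for
  b, so each element ends up with five legs. On the side of \<open>tw.star\<close>, a1 and b5 go
  into the outer pairing, \<open>lift\<close> consumes the rest, and X receives the middle parts
  made of a3, a4 and of b2, b3. Hence the legs of a are regrouped by \<open>S5_inner\<close> and
  those of b by \<open>S5_left\<close>.\<close>

lemma lift_mult:
  assumes "a \<in> carrier H" "b \<in> carrier H"
  shows "lift (tw.star a b) = lift a \<otimes>\<^bsub>B\<^esub> lift b"
proof -
  define E where "E a1 a2 a3 a4 a5 b1 b2 b3 b4 b5 =
    (\<phi> (\<tau> a4) b2 \<otimes>\<^bsub>R\<^esub> \<phi> (\<tau> b5) a1) \<odot>\<^bsub>B\<^esub>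
      m (X a3 \<otimes>\<^bsub>A\<^esub> X b3) (D.pr (\<tau> a5 \<otimes>\<^bsub>H\<^esub> \<tau> b4) (a2 \<otimes>\<^bsub>H\<^esub> b1))"
    for a1 a2 a3 a4 a5 b1 b2 b3 b4 b5
  note closed = closed' assms linear_closed[OF linear_lift]
  have E: "E a1 a2 a3 a4 a5 b1 b2 b3 b4 b5 \<in> carrier B"
    if "a1 \<in> carrier H" "a2 \<in> carrier H" "a3 \<in> carrier H" "a4 \<in> carrier H" "a5 \<in> carrier H"
      "b1 \<in> carrier H" "b2 \<in> carrier H" "b3 \<in> carrier H" "b4 \<in> carrier H" "b5 \<in> carrier H"
    for a1 a2 a3 a4 a5 b1 b2 b3 b4 b5
    unfolding E_def using that by (intro closed)
  have m_sum: "m z (S D.T f c) = S B (\<lambda>x y. m z (f x y)) c"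
    if "z \<in> carrier A" "c \<in> carrier H"
      "\<And>x y. \<lbrakk>x \<in> carrier H; y \<in> carrier H\<rbrakk> \<Longrightarrow> f x y \<in> carrier D.T" for z f c
    by (rule linear_commutes_S[OF bilinear_right[OF bilinear_m that(1) linear_id]])
      (intro closed that | assumption)+
  have m_sum_left: "m (S A f c) u = S B (\<lambda>x y. m (f x y) u) c"
    if "u \<in> carrier D.T" "c \<in> carrier H"
      "\<And>x y. \<lbrakk>x \<in> carrier H; y \<in> carrier H\<rbrakk> \<Longrightarrow> f x y \<in> carrier A" for u f c
    by (rule linear_commutes_S[OF bilinear_left[OF bilinear_m linear_id that(1)]])
      (intro closed that | assumption)+
  have m_smult: "m z (c \<odot>\<^bsub>D.T\<^esub> u) = c \<odot>\<^bsub>B\<^esub> m z u"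
    if "z \<in> carrier A" "c \<in> carrier R" "u \<in> carrier D.T" for z c u
    by (rule linear_smult[OF bilinear_right[OF bilinear_m that(1) linear_id] that(2,3)])
  have m_smult_left: "m (c \<odot>\<^bsub>A\<^esub> z) u = c \<odot>\<^bsub>B\<^esub> m z u"
    if "z \<in> carrier A" "c \<in> carrier R" "u \<in> carrier D.T" for z c u
    by (rule linear_smult[OF bilinear_left[OF bilinear_m linear_id that(3)] that(2,1)])
  have "lift a \<otimes>\<^bsub>B\<^esub> lift b =
      S B (\<lambda>a1 a'. S B (\<lambda>a2 a3. m (X a2) (D.pr (\<tau> a3) a1)) a' \<otimes>\<^bsub>B\<^esub> lift b) a"
    unfolding lift_def[of a]
    by (rule linear_commutes_S) (assumption | intro lin' closed)+
  also have "\<dots> = S B (\<lambda>a1 a'. S B (\<lambda>a2 a3. m (X a2) (D.pr (\<tau> a3) a1) \<otimes>\<^bsub>B\<^esub> lift b) a') a"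
    by (rule S_cong, rule linear_commutes_S) (assumption | intro lin' closed)+
  also have "\<dots> = S B (\<lambda>a1 a'. S B (\<lambda>a2 a3. S B (\<lambda>b1 b'.
      m (X a2) (D.pr (\<tau> a3) a1) \<otimes>\<^bsub>B\<^esub> S B (\<lambda>b2 b3. m (X b2) (D.pr (\<tau> b3) b1)) b') b) a') a"
    unfolding lift_def[of b]
    by (rule S_cong, rule S_cong, rule linear_commutes_S) (assumption | intro lin' closed)+
  also have "\<dots> = S B (\<lambda>a1 a'. S B (\<lambda>a2 a3. S B (\<lambda>b1 b'. S B (\<lambda>b2 b3.
      m (X a2) (D.pr (\<tau> a3) a1) \<otimes>\<^bsub>B\<^esub> m (X b2) (D.pr (\<tau> b3) b1)) b') b) a') a"
    by (rule S_cong, rule S_cong, rule S_cong, rule linear_commutes_S)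
      (assumption | intro lin' closed)+
  also have "\<dots> = S B (\<lambda>a1 a'. S B (\<lambda>a2 a3. S B (\<lambda>b1 b'. S B (\<lambda>b2 b3.
      m (X a2 \<otimes>\<^bsub>A\<^esub> X b2) (D.pr (\<tau> a3) a1 \<otimes>\<^bsub>diag_iH\<^esub> D.pr (\<tau> b3) b1)) b') b) a') a"
    by (intro S_cong assms) (simp add: m_mult closed)
  also have "\<dots> = S B (\<lambda>a1 a'. S B (\<lambda>a2 a3. S B (\<lambda>b1 b'. S B (\<lambda>b2 b3.
      S B (\<lambda>u v. S B (\<lambda>s t. S B (\<lambda>u' v'. S B (\<lambda>s' t'.
        E s t a2 u v s' t' b2 u' v') b1) b3) a1) a3) b') b) a') a"
    by (intro S_cong assms)
      (auto simp: diag_iH_mult_tau m_sum m_smult closed E_def intro!: S_cong)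
  also have "\<dots> = S B (\<lambda>a1 a'. S B (\<lambda>a2 a3. S B (\<lambda>u v. S B (\<lambda>s t.
      S B (\<lambda>b1 b'. S B (\<lambda>b2 b3. S B (\<lambda>u' v'. S B (\<lambda>s' t'.
        E s t a2 u v s' t' b2 u' v') b1) b3) b') b) a1) a3) a') a"
    by (rule S_cong, rule S_cong, rule S_swap22) (assumption | intro closed E)+
  also have "\<dots> = S B (\<lambda>a1 a'. S B (\<lambda>a2 a3. S B (\<lambda>u v. S B (\<lambda>s t.
      S B (\<lambda>b1 c. S B (\<lambda>b2 c. S B (\<lambda>b3 c. S B (\<lambda>b4 b5.
        E s t a2 u v b1 b2 b3 b4 b5) c) c) c) b) a1) a3) a') a"
    by (rule S_cong, rule S_cong, rule S_cong, rule S_cong, rule S5_outer)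
      (unfold E_def, (assumption | intro lin' closed)+)
  also have "\<dots> = S B (\<lambda>a1 c. S B (\<lambda>a2 c. S B (\<lambda>a3 c. S B (\<lambda>a4 a5.
      S B (\<lambda>b1 c. S B (\<lambda>b2 c. S B (\<lambda>b3 c. S B (\<lambda>b4 b5.
        E a1 a2 a3 a4 a5 b1 b2 b3 b4 b5) c) c) c) b) c) c) c) a"
    by (rule S5_outer) (unfold E_def, (assumption | intro lin' closed)+)
  also have "\<dots> = S B (\<lambda>a1 a'. S B (\<lambda>a2 a''. S B (\<lambda>c a5. S B (\<lambda>a3 a4.
      S B (\<lambda>b1 c. S B (\<lambda>b2 c. S B (\<lambda>b3 c. S B (\<lambda>b4 b5.
        E a1 a2 a3 a4 a5 b1 b2 b3 b4 b5) c) c) c) b) c) a'') a') a"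
    by (rule S5_inner[symmetric]) (unfold E_def, (assumption | intro lin' closed)+)
  also have "\<dots> = S B (\<lambda>a1 a'. S B (\<lambda>a2 a''. S B (\<lambda>c a5. S B (\<lambda>a3 a4.
      S B (\<lambda>b' b5. S B (\<lambda>b1 b''. S B (\<lambda>d b4. S B (\<lambda>b2 b3.
        E a1 a2 a3 a4 a5 b1 b2 b3 b4 b5) d) b'') b') b) c) a'') a') a"
    by (rule S_cong, rule S_cong, rule S_cong, rule S_cong, rule S5_left[symmetric])
      (unfold E_def, (assumption | intro lin' closed)+)
  also have "\<dots> = S B (\<lambda>a1 a'. S B (\<lambda>a2 a''. S B (\<lambda>c a5. S B (\<lambda>b' b5. S B (\<lambda>a3 a4.
      S B (\<lambda>b1 b''. S B (\<lambda>d b4. S B (\<lambda>b2 b3.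
        E a1 a2 a3 a4 a5 b1 b2 b3 b4 b5) d) b'') b') c) b) a'') a') a"
    by (rule S_cong, rule S_cong, rule S_cong, rule S_swap) (assumption | intro closed E)+
  also have "\<dots> = S B (\<lambda>a1 a'. S B (\<lambda>a2 a''. S B (\<lambda>c a5. S B (\<lambda>b' b5.
      S B (\<lambda>b1 b''. S B (\<lambda>d b4. S B (\<lambda>a3 a4. S B (\<lambda>b2 b3.
        E a1 a2 a3 a4 a5 b1 b2 b3 b4 b5) d) c) b'') b') b) a'') a') a"
    by (rule S_cong, rule S_cong, rule S_cong, rule S_cong, rule S_swap12) (assumption | intro closed E)+
  also have "\<dots> = S B (\<lambda>a1 a'. S B (\<lambda>b' b5. S B (\<lambda>a2 a''. S B (\<lambda>c a5.
      S B (\<lambda>b1 b''. S B (\<lambda>d b4. S B (\<lambda>a3 a4. S B (\<lambda>b2 b3.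
        E a1 a2 a3 a4 a5 b1 b2 b3 b4 b5) d) c) b'') b') a'') a') b) a"
    by (rule S_cong, rule S_swap12[symmetric]) (assumption | intro closed E)+
  also have "\<dots> = S B (\<lambda>a1 a2. S B (\<lambda>b1 b2. \<phi> (\<tau> b2) a1 \<odot>\<^bsub>B\<^esub> lift (a2 \<otimes>\<^bsub>H\<^esub> b1)) b) a"
  proof (rule S_cong, rule S_cong)
    fix a1 a' b' b5
    assume ab: "a1 \<in> carrier H" "a' \<in> carrier H" "b' \<in> carrier H" "b5 \<in> carrier H"
    have lift: "lift (a' \<otimes>\<^bsub>H\<^esub> b') = S B (\<lambda>a2 a''. S B (\<lambda>c a5. S B (\<lambda>b1 b''. S B (\<lambda>d b4.
        m (X (c \<otimes>\<^bsub>H\<^esub> d)) (D.pr (\<tau> (a5 \<otimes>\<^bsub>H\<^esub> b4)) (a2 \<otimes>\<^bsub>H\<^esub> b1))) b'') b') a'') a'"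
      unfolding lift_def by (rule S3_mult) (assumption | intro lin' closed ab)+
    show "S B (\<lambda>a2 a''. S B (\<lambda>c a5. S B (\<lambda>b1 b''. S B (\<lambda>d b4.
        S B (\<lambda>a3 a4. S B (\<lambda>b2 b3. E a1 a2 a3 a4 a5 b1 b2 b3 b4 b5) d) c) b'') b') a'') a' =
      \<phi> (\<tau> b5) a1 \<odot>\<^bsub>B\<^esub> lift (a' \<otimes>\<^bsub>H\<^esub> b')"
      unfolding lift using ab
      by (auto simp: S_smult X_mult m_sum_left m_smult_left tau_mult closed E_def
          B.smult_assoc1[symmetric] R.m_comm intro!: S_cong)
  qed (rule assms)+
  also have "\<dots> = lift (tw.star a b)"
    by (rule tw.linear_star[symmetric]) (intro linear_lift closed)+
  finally show ?thesis by (rule HOL.sym)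
qed

lemma lift_hom: "lift \<in> algebra_homs R tw_iH B"
  using linear_lift lift_mult by (simp add: algebra_homs_def tw.iHopf_mult)

text \<open>In both instances \<open>m\<close> sends the pair of units to the unit of B, so
  unitality of \<open>lift\<close> comes down to X(1) = 1.\<close>

lemma lift_one: "lift \<one>\<^bsub>H\<^esub> = m (X \<one>\<^bsub>H\<^esub>) \<one>\<^bsub>D.T\<^esub>"
proof -
  have "lift \<one>\<^bsub>H\<^esub> = S B (\<lambda>a2 a3. m (X a2) (D.pr (\<tau> a3) \<one>\<^bsub>H\<^esub>)) \<one>\<^bsub>H\<^esub>"
    unfolding lift_def by (rule S_one) (assumption | intro lin' closed' one_closed)+
  also have "\<dots> = m (X \<one>\<^bsub>H\<^esub>) (D.pr (\<tau> \<one>\<^bsub>H\<^esub>) \<one>\<^bsub>H\<^esub>)"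
    by (rule S_one) (assumption | intro lin' closed' one_closed)+
  finally show ?thesis by (simp add: tau_one D.one_T)
qed

end

section \<open>From Hopf algebras to the two homomorphisms\<close>

lemma paired_bialgebra_hopf:
  assumes "hopf_algebra F H" "hopf_pairing F H \<phi>"
  shows "paired_bialgebra F H \<phi>"
  using assms
  by (intro paired_bialgebra.intro paired_bialgebra_axioms.intro hopf_algebra_imp_bialgebra)
    (simp_all add: hopf_pairing_def bilinear_form_def bilinear_maps_def)

theorem theoremA:
  fixes F :: "('f, 'm) ring_scheme"
    and H :: "('f, 'h, 'x) hopf_scheme"
    and \<phi> :: "'h \<Rightarrow> 'h \<Rightarrow> 'f"
    and \<tau> :: "'h \<Rightarrow> 'h"
    and \<chi> :: "'h \<Rightarrow> 'f"
  assumes "field F"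
    and "hopf_algebra F H"
    and "bij_betw (antipode H) (carrier H) (carrier H)"
    and "hopf_pairing F H \<phi>"
    and "hopf_endomorphism F H \<tau>"
    and "\<chi> \<in> linear_maps F H (regular_module F)"
    and "twisted_compatible F H \<phi> \<tau> \<chi>"
  defines "HH \<equiv> tensor_algebra F H H"
    and "iH \<equiv> twisted_iHopf H \<phi> \<tau>"
    and "iHH \<equiv> diagonal_iHopf F H \<phi>"
  defines "T \<equiv> tensor_algebra F iH iHH"
  shows "unital_algebra F iH \<and> \<one>\<^bsub>iH\<^esub> = \<one>\<^bsub>H\<^esub> \<and>
    unital_algebra F iHH \<and> \<one>\<^bsub>iHH\<^esub> = pure_tensor F H H \<one>\<^bsub>H\<^esub> \<one>\<^bsub>H\<^esub> \<and>
    unital_algebra F T \<and>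
    (\<exists>\<xi> \<Psi>.
      \<xi> \<in> algebra_homs F iH iHH \<and>
      ((\<exists>a\<in>carrier H. \<chi> a \<noteq> \<zero>\<^bsub>F\<^esub>) \<longrightarrow> \<xi> \<in> unital_algebra_homs F iH iHH) \<and>
      \<Psi> \<in> unital_algebra_homs F iH T \<and>
      (\<forall>a\<in>carrier H.
        \<xi> a = sweedler3 H HH
          (\<lambda>a1 a2 a3. \<chi> a2 \<odot>\<^bsub>HH\<^esub> pure_tensor F H H (\<tau> a3) a1) a) \<and>
      (\<forall>a\<in>carrier H.
        \<Psi> a = sweedler5 H T
          (\<lambda>a1 a2 a3 a4 a5. \<phi> (\<tau> a4) a2 \<odot>\<^bsub>T\<^esub>
            pure_tensor F iH iHH a3 (pure_tensor F H H (\<tau> a5) a1)) a))"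
proof -
  interpret F: field F by fact
  interpret twisted_pairing F H \<phi> \<tau>
    using assms(5)
    by (intro twisted_pairing.intro paired_bialgebra_hopf twisted_pairing_axioms.intro assms)
      (simp_all add: hopf_endomorphism_def)
  have iH: "iH = iHopf H (\<lambda>a b. \<phi> (\<tau> a) b)" and iHH: "iHH = iHopf D.T (diagonal_pairing F \<phi>)"
    by (simp_all add: iH_def twisted_iHopf_def iHH_def diagonal_iHopf_def)
  have uiH: "unital_algebra F iH" unfolding iH by (rule tw.unital_algebra_iHopf)
  have uiHH: "unital_algebra F iHH" unfolding iHH by (rule unital_algebra_diag_iH)
  have uT: "unital_algebra F T" unfolding T_def by (rule unital_algebra_tensor_algebra[OF uiH uiHH])
  interpret iH: unital_algebra F iH by (rule uiH)
  interpret iHH: unital_algebra F iHH by (rule uiHH)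
  interpret T: unital_algebra F T by (rule uT)
  have one_iHH: "\<one>\<^bsub>iHH\<^esub> = pure_tensor F H H \<one>\<^bsub>H\<^esub> \<one>\<^bsub>H\<^esub>" by (simp add: iHH D.one_T)
  have modules: "module F iH" "module F iHH"
    by (rule unital_algebra.axioms(1)[OF uiH], rule unital_algebra.axioms(1)[OF uiHH])
  have chi_closed: "\<chi> a \<in> carrier F" if "a \<in> carrier H" for a
    using linear_closed[OF assms(6) that] by simp
  \<comment> \<open>Twisted compatibility is the law \<open>X_mult\<close> for scalar values, up to
    the order of the three factors.\<close>
  have chi_mult: "\<chi> (a \<otimes>\<^bsub>H\<^esub> b) = S (regular_module F) (\<lambda>a1 a2. S (regular_module F) (\<lambda>b1 b2.
      \<phi> (\<tau> a2) b1 \<otimes>\<^bsub>F\<^esub> (\<chi> a1 \<otimes>\<^bsub>F\<^esub> \<chi> b2)) b) a"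
    if "a \<in> carrier H" "b \<in> carrier H" for a b
    using assms(7) that unfolding twisted_compatible_def S_regular
    by (auto intro!: S_cong simp: chi_closed pairing_closed tau_closed F.m_comm)
  interpret \<xi>: twisted_map F H \<phi> \<tau> "regular_module F" iHH "smult iHH" \<chi>
  proof (intro twisted_map.intro twisted_map_axioms.intro twisted_pairing_axioms
      unital_algebra_regular_module uiHH cring_R)
    show "smult iHH \<in> bilinear_maps F (regular_module F) D.T iHH"
      using bilinear_smult[OF modules(2)] by (simp add: iHH)
    show "\<chi> \<in> linear_maps F H (regular_module F)" by (rule assms(6))
    show "(x \<otimes>\<^bsub>regular_module F\<^esub> y) \<odot>\<^bsub>iHH\<^esub> (u \<otimes>\<^bsub>diag_iH\<^esub> v) =
        (x \<odot>\<^bsub>iHH\<^esub> u) \<otimes>\<^bsub>iHH\<^esub> (y \<odot>\<^bsub>iHH\<^esub> v)"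
      if "x \<in> carrier (regular_module F)" "y \<in> carrier (regular_module F)"
        "u \<in> carrier D.T" "v \<in> carrier D.T" for x y u v
    proof -
      have "u \<in> carrier iHH" "v \<in> carrier iHH" using that by (simp_all add: iHH)
      then show ?thesis
        using that
        by (simp add: iHH[symmetric] iHH.smult_mult_left iHH.smult_mult_right
            iHH.smult_assoc1[symmetric] F.m_comm)
    qed
  qed (simp add: chi_mult)
  interpret \<Psi>: twisted_map F H \<phi> \<tau> iH T "pure_tensor F iH iHH" tw.contract
  proof (intro twisted_map.intro twisted_map_axioms.intro twisted_pairing_axioms uiH uT)
    show "pure_tensor F iH iHH \<in> bilinear_maps F iH D.T T"
      using bilinear_pure_tensor[OF modules] by (simp add: iHH T_def)
    show "tw.contract \<in> linear_maps F H iH"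
      using tw.linear_contract by (simp add: iH)
    show "pure_tensor F iH iHH (x \<otimes>\<^bsub>iH\<^esub> y) (u \<otimes>\<^bsub>diag_iH\<^esub> v) =
        pure_tensor F iH iHH x u \<otimes>\<^bsub>T\<^esub> pure_tensor F iH iHH y v"
      if "x \<in> carrier iH" "y \<in> carrier iH" "u \<in> carrier D.T" "v \<in> carrier D.T" for x y u v
    proof -
      have "u \<in> carrier iHH" "v \<in> carrier iHH" using that by (simp_all add: iHH)
      then show ?thesis
        using pure_tensor_mult[OF uiH uiHH] that by (simp add: T_def iHH[symmetric])
    qed
    show "tw.contract (a \<otimes>\<^bsub>H\<^esub> b) = sweedler2 H iH (\<lambda>a1 a2. sweedler2 H iH (\<lambda>b1 b2.
        \<phi> (\<tau> a2) b1 \<odot>\<^bsub>iH\<^esub> (tw.contract a1 \<otimes>\<^bsub>iH\<^esub> tw.contract b2)) b) a"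
      if "a \<in> carrier H" "b \<in> carrier H" for a b
      using tw.contract_mult[OF that] by (simp add: iH tw.iHopf_mult)
  qed
  \<comment> \<open>Twisted compatibility at b = 1 collapses by the counit to \<chi>(a) = \<chi>(a)
    \<chi>(1), and cancelling a nonzero \<chi>(a) gives \<chi>(1) = 1. The zero functional is
    twisted compatible as well, and for it \<xi> vanishes.\<close>
  have xi_one: "\<xi>.lift \<one>\<^bsub>iH\<^esub> = \<one>\<^bsub>iHH\<^esub>" if "a \<in> carrier H" "\<chi> a \<noteq> \<zero>\<^bsub>F\<^esub>" for a
  proof -
    let ?K = "regular_module F"
    note rules = tw.lin tw.closed linear_comp[OF assms(6)] chi_closed module_scalars one_closed that
    have "\<chi> a = \<chi> (a \<otimes>\<^bsub>H\<^esub> \<one>\<^bsub>H\<^esub>)" using that by simp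
    also have "\<dots> = S ?K (\<lambda>a1 a2. \<phi> (\<tau> a2) \<one>\<^bsub>H\<^esub> \<otimes>\<^bsub>F\<^esub> (\<chi> a1 \<otimes>\<^bsub>F\<^esub> \<chi> \<one>\<^bsub>H\<^esub>)) a"
      unfolding chi_mult[OF that(1) one_closed]
      by (rule S_cong, rule S_one) (assumption | intro rules)+
    also have "\<dots> = S ?K (\<lambda>a1 a2. counit H a2 \<odot>\<^bsub>?K\<^esub> (\<chi> a1 \<otimes>\<^bsub>F\<^esub> \<chi> \<one>\<^bsub>H\<^esub>)) a"
      by (intro S_cong that) (simp add: tw.pairing_one_right)
    also have "\<dots> = \<chi> a \<otimes>\<^bsub>F\<^esub> \<chi> \<one>\<^bsub>H\<^esub>"
      by (rule S_counit_right) (assumption | intro rules)+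
    finally have "\<chi> \<one>\<^bsub>H\<^esub> = \<one>\<^bsub>F\<^esub>"
      using that F.m_lcancel[of "\<chi> a" "\<chi> \<one>\<^bsub>H\<^esub>" "\<one>\<^bsub>F\<^esub>"] by (simp add: chi_closed)
    then show ?thesis using iHH.one_closed \<xi>.lift_one by (simp add: iH iHH)
  qed
  have Psi_one: "\<Psi>.lift \<one>\<^bsub>iH\<^esub> = \<one>\<^bsub>T\<^esub>"
  proof -
    have "tw.contract \<one>\<^bsub>H\<^esub> = S H (\<lambda>a2 a3. \<phi> (\<tau> a3) \<one>\<^bsub>H\<^esub> \<odot>\<^bsub>H\<^esub> a2) \<one>\<^bsub>H\<^esub>"
      unfolding tw.contract_def
      by (rule S_one) (assumption | intro tw.lin tw.closed smult_closed one_closed)+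
    also have "\<dots> = \<phi> (\<tau> \<one>\<^bsub>H\<^esub>) \<one>\<^bsub>H\<^esub> \<odot>\<^bsub>H\<^esub> \<one>\<^bsub>H\<^esub>"
      by (rule S_one) (assumption | intro tw.lin tw.closed smult_closed one_closed)+
    also have "\<dots> = \<one>\<^bsub>H\<^esub>" by (simp add: tw.pairing_one_right counit_one)
    finally show ?thesis using \<Psi>.lift_one by (simp add: iH iHH T_def tensor_algebra_simps)
  qed
  \<comment> \<open>\<open>HH\<close> and \<open>iHH\<close> differ in their products but share
    zero, addition and scalar multiplication, so the two sums are literally the same.\<close>
  have xi: "\<xi>.lift a = sweedler3 H HH (\<lambda>a1 a2 a3. \<chi> a2 \<odot>\<^bsub>HH\<^esub> pure_tensor F H H (\<tau> a3) a1) a" for a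
    unfolding \<xi>.lift_def
    by (simp add: sweedler3_def[abs_def] iHH HH_def sweedler2_def tensor_sum_def
        tensor_hopf_simps)
  have Psi: "\<Psi>.lift a = sweedler5 H T (\<lambda>a1 a2 a3 a4 a5. \<phi> (\<tau> a4) a2 \<odot>\<^bsub>T\<^esub>
      pure_tensor F iH iHH a3 (pure_tensor F H H (\<tau> a5) a1)) a" if a: "a \<in> carrier H" for a
  proof -
    let ?p = "\<lambda>x a5 a1. pure_tensor F iH iHH x (pure_tensor F H H (\<tau> a5) a1)"
    have closed_iH: "x \<in> carrier iH" if "x \<in> carrier H" for x using that by (simp add: iH)
    have left: "(\<lambda>x. pure_tensor F iH iHH x u) \<in> linear_maps F H T" if "u \<in> carrier D.T" for u
      using bilinear_left[OF \<Psi>.bilinear_m linear_id that] by (simp add: iH)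
    note rules = tw.lin \<Psi>.lin' linear_comp[OF left] tw.closed \<Psi>.closed' closed_iH a
    \<comment> \<open>Expanding the contraction gives three legs inside the middle of three, a1 | a2
      a3 a4 | a5. Coassociativity then renumbers them as five legs nested to the right, in two
      moves.\<close>
    have "\<Psi>.lift a = S T (\<lambda>a1 a'. S T (\<lambda>c a5. S T (\<lambda>a2 c'. S T (\<lambda>a3 a4.
        \<phi> (\<tau> a4) a2 \<odot>\<^bsub>T\<^esub> ?p a3 a5 a1) c') c) a') a"
      unfolding \<Psi>.lift_def
    proof (rule S_cong, rule S_cong)
      fix a1 a' c a5 assume c: "a1 \<in> carrier H" "c \<in> carrier H" "a5 \<in> carrier H"
      note l = left[OF D.pr_closed[OF tau_closed[OF c(3)] c(1)]]
      have "?p (tw.contract c) a5 a1 = S T (\<lambda>a2 c'. ?p (S H (\<lambda>a3 a4. \<phi> (\<tau> a4) a2 \<odot>\<^bsub>H\<^esub> a3) c') a5 a1) c"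
        unfolding tw.contract_def
        by (rule linear_commutes_S[OF l]) (assumption | intro rules smult_closed c)+
      also have "\<dots> = S T (\<lambda>a2 c'. S T (\<lambda>a3 a4. ?p (\<phi> (\<tau> a4) a2 \<odot>\<^bsub>H\<^esub> a3) a5 a1) c') c"
        by (rule S_cong, rule linear_commutes_S[OF l]) (assumption | intro rules smult_closed c)+
      also have "\<dots> = S T (\<lambda>a2 c'. S T (\<lambda>a3 a4. \<phi> (\<tau> a4) a2 \<odot>\<^bsub>T\<^esub> ?p a3 a5 a1) c') c"
        by (rule S_cong, rule S_cong, rule linear_smult[OF l]) (assumption | intro rules c)+
      finally show "?p (tw.contract c) a5 a1 =
        S T (\<lambda>a2 c'. S T (\<lambda>a3 a4. \<phi> (\<tau> a4) a2 \<odot>\<^bsub>T\<^esub> ?p a3 a5 a1) c') c" .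
    qed (rule a | assumption)+
    also have "\<dots> = S T (\<lambda>a1 a'. S T (\<lambda>a2 c. S T (\<lambda>c' a5. S T (\<lambda>a3 a4.
        \<phi> (\<tau> a4) a2 \<odot>\<^bsub>T\<^esub> ?p a3 a5 a1) c') c) a') a"
      by (rule S_cong, rule S_coassoc) (assumption | intro rules)+
    also have "\<dots> = S T (\<lambda>a1 a'. S T (\<lambda>a2 c. S T (\<lambda>a3 c'. S T (\<lambda>a4 a5.
        \<phi> (\<tau> a4) a2 \<odot>\<^bsub>T\<^esub> ?p a3 a5 a1) c') c) a') a"
      by (rule S5_inner) (assumption | intro rules)+
    finally show ?thesis
      by (simp add: sweedler3_def[abs_def] sweedler4_def[abs_def] sweedler5_def)
  qed
  have xi_hom: "\<xi>.lift \<in> algebra_homs F iH iHH" and Psi_hom: "\<Psi>.lift \<in> algebra_homs F iH T"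
    using \<xi>.lift_hom \<Psi>.lift_hom by (simp_all add: iH)
  show ?thesis
    using uiH uiHH uT one_iHH xi_hom Psi_hom xi_one Psi_one xi Psi
    by (intro conjI exI[of _ \<xi>.lift] exI[of _ \<Psi>.lift])
      (auto simp: unital_algebra_homs_def iH)
qed

end
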